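(* Let $\Gamma$ be a normalized zonal Fuchsian group, as in the context. For $x\in(0,1)$ let $(p_n/q_n)_n$ be the sequence of $\Gamma$-n-convergents and $(p_n^a/q_n^a)_n$ the sequence of $\Gamma$-convergents of $x$, and put $\theta_n(x)=q_n|q_nx-p_n|$ and $\theta^a_n(x)=q^a_n|q^a_nx-p^a_n|$. Then for almost all $x\in(0,1)$ (Lebesgue measure) $$\limsup_{n\to\infty}-\frac{\log\theta^a_n(x)}{\log n}=1,$$ and, assuming in addition that $\Gamma=\mathrm{PSL}_2(\mathbb{Z})$ or $U_\eta\notin\Gamma$, for almost all $x\in(0,1)$ $$\limsup_{n\to\infty}-\frac{\log\theta_n(x)}{\log n}=1.$$
   Context: **Setting.** $\mathbb{H}$ is the upper half-plane with its hyperbolic metric. $\Gamma\subset \mathrm{PSL}_2(\mathbb{R})$ is a discrete group such that $S=\mathbb{H}/\Gamma$ is a non-compact hyperbolic 2-orbifold of finite area and the stabilizer of $\infty$ in $\Gamma$, $\mathrm{Stab}(\infty)$, is generated by $z\mapsto z+1$ (a zonal Fuchsian group). For $m>0$ let $H_m=\{z: \mathrm{Im}(z)>m\}$, and let $C_k$ be the projection of $H_{1/k}$ to $S$. Let $\eta=\eta(\Gamma)$ be the smallest number with $H_\eta\cap g(H_\eta)=\emptyset$ for all $g\in\Gamma\setminus\mathrm{Stab}(\infty)$. Normalization: there is $h\in\Gamma$ with $h(\infty)=0$ and the closures of $H_\eta$ and $h(H_\eta)$ tangent at the single point $\eta i$. Put $U_\eta(z)=-\eta^2/z$. **Excursions (with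 $k=2$).** Let $\gamma$ be a unit-speed geodesic on $S$; a lift $\tilde\gamma$ to $\mathbb{H}$ has forward endpoint $\tilde\gamma_+$ and backward endpoint $\tilde\gamma_-$. An excursion of $\gamma$ is a point $e=\gamma(t_e)$ at which $\gamma$ is tangent to $C_d$ for some $d<2$, i.e. some lift $\tilde\gamma$ of $\gamma$ is tangent to $\partial H_{1/d}$ at $\tilde\gamma(t_e)$; $d=d(e)$ is its depth and $t_e$ its depth parameter (generically $d(e)$ is well defined and the lift is unique up to $\mathrm{Stab}(\infty)$). Let $J=[(-1,0)\times(0,\infty)]\cup[(0,1)\times(-\infty,0)]$ and $I=[(-1,0)\times(1,\infty)]\cup[(0,1)\times(-\infty,-1)]$. Let $\tilde\gamma_e$ be the unique lift tangent to $\partial H_{1/d(e)}$ at $\tilde\gamma_e(t_e)$ with $((\tilde\gamma_e)_+,(\tilde\gamma_e)_-)\in J$. The excursion $e$ is approximating if $((\tilde\gamma_e)_+,(\tilde\gamma_e)_-)\in I$. **$\Gamma$-rationals.** $\mathbb{Q}(\Gamma)$ is the $\Gamma$-orbit of $\infty$. If $g=\pm\begin{pmatrix}p&r\\ q&s\end{pmatrix}\in\Gamma$ with matrix in $\mathrm{SL}_2(\mathbb{R})$, then $g(\infty)=p/q$; normalized by $q>0$ (for finite points), $p$ and $q$ are uniquely determined by the point of $\mathbb{Q}(\Gamma)$, and each such point is written as the "fraction" $p/q$ with these $p,q$. **Convergents.** Given a lift $\tilde\gamma$ of $\gamma$ and an excursion $e=\gamma(t_e)$, let $\sigma$ be the geodesic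 ray orthogonal to $\gamma$ at $e$ heading directly out to the cusp in $C_2$, let $\tilde\sigma$ be its lift starting at $\tilde\gamma(t_e)$, and let $\varphi(\tilde\gamma,e)\in\mathbb{Q}(\Gamma)$ be the endpoint of $\tilde\sigma$ (equivalently, $\varphi(\tilde\gamma,e)=g(\infty)$ where $g\in\Gamma$ satisfies $g(\tilde\gamma_e)=\tilde\gamma$ as parametrized geodesics). For $x\in(0,1)$ let $\tilde\beta_x$ be the unit-speed vertical geodesic with $\tilde\beta_x(0)=x+2i$ and forward endpoint $x$, and $\beta_x$ its projection to $S$. The $\Gamma$-n-convergents of $x$ are the numbers $p_n/q_n=\varphi(\tilde\beta_x,e_n)$, where $e_1,e_2,\dots$ are the excursions of $\beta_x$ with nonnegative depth parameters in order of increasing depth parameter. The $\Gamma$-convergents $p_n^a/q_n^a$ are the analogous sequence using only approximating excursions. For almost all $x$ both sequences are infinite. *)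

theory Defs
  imports
    "HOL-Analysis.Analysis"
    "HOL-Algebra.Coset"
    "HOL-Algebra.Generated_Groups"
begin

section \<open>The group PSL(2,R) and its action\<close>

definition SL2R :: "(real^2^2) monoid" where
  "SL2R = \<lparr>carrier = {A. det A = 1}, mult = (**), one = mat 1\<rparr>"

text \<open>
  Elements of the quotient are cosets, i.e. sets of the form \<open>{A, - A}\<close> with \<open>det A = 1\<close>.
  For a set \<open>\<Gamma>\<close> of such cosets, \<open>\<Union>\<Gamma>\<close> is the set of all matrices representing elements of \<open>\<Gamma>\<close>.
\<close>
definition PSL2R :: "(real^2^2) set monoid" where
  "PSL2R = SL2R Mod {mat 1, - mat 1}"

definition pm :: "real^2^2 \<Rightarrow> (real^2^2) set" where
  "pm A = {A, - A}"

definition mat2 :: "real \<Rightarrow> real \<Rightarrow> real \<Rightarrow> real \<Rightarrow> real^2^2" where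
  "mat2 a b c d = vector [vector [a, b], vector [c, d]]"

definition act :: "real^2^2 \<Rightarrow> complex \<Rightarrow> complex" where
  "act A = moebius (complex_of_real (A$1$1)) (complex_of_real (A$1$2))
                   (complex_of_real (A$2$1)) (complex_of_real (A$2$2))"

text \<open>The image of the point at infinity, in \<open>\<real> \<union> {\<infinity>}\<close>; \<^const>\<open>None\<close> stands for \<open>\<infinity>\<close>.\<close>
definition act_inf :: "real^2^2 \<Rightarrow> real option" where
  "act_inf A = (if A$2$1 = 0 then None else Some (A$1$1 / A$2$1))"

definition PSL2Z :: "(real^2^2) set set" where
  "PSL2Z = {X \<in> carrier PSL2R. \<forall>A\<in>X. \<forall>i j. A$i$j \<in> \<int>}"

section \<open>The hyperbolic plane\<close>

definition halfplane :: "complex set" where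
  "halfplane = {z. 0 < Im z}"

definition horoball :: "real \<Rightarrow> complex set" where
  "horoball m = {z. m < Im z}"

definition hdist :: "complex \<Rightarrow> complex \<Rightarrow> real" where
  "hdist z w = arcosh (1 + (cmod (z - w))\<^sup>2 / (2 * Im z * Im w))"

definition harea :: "complex measure" where
  "harea = density lborel (\<lambda>z. ennreal (indicator halfplane z / (Im z)\<^sup>2))"

text \<open>In the hyperbolic plane every complete geodesic is globally length minimising.\<close>
definition unit_speed_geodesic :: "(real \<Rightarrow> complex) \<Rightarrow> bool" where
  "unit_speed_geodesic \<delta> \<longleftrightarrow>
     (\<forall>t. \<delta> t \<in> halfplane) \<and> (\<forall>s t. hdist (\<delta> s) (\<delta> t) = \<bar>s - t\<bar>)"

text \<open>
  The pair of (finite) forward and backward endpoints lies in \<open>E\<close>; false if one of the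
  endpoints is \<open>\<infinity>\<close>.
\<close>
definition endpoints_in :: "(real \<Rightarrow> complex) \<Rightarrow> (real \<times> real) set \<Rightarrow> bool" where
  "endpoints_in \<delta> E \<longleftrightarrow> (\<exists>u v. (\<delta> \<longlongrightarrow> complex_of_real u) at_top \<and>
      (\<delta> \<longlongrightarrow> complex_of_real v) at_bot \<and> (u, v) \<in> E)"

text \<open>Tangency at time \<open>t\<close> to the boundary \<open>{z. Im z = m}\<close> of \<^term>\<open>horoball m\<close>.\<close>
definition tangent_horoball :: "(real \<Rightarrow> complex) \<Rightarrow> real \<Rightarrow> real \<Rightarrow> bool" where
  "tangent_horoball \<delta> t m \<longleftrightarrow> Im (\<delta> t) = m \<and>
     (\<exists>v. v \<noteq> 0 \<and> (\<delta> has_vector_derivative complex_of_real v) (at t))"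

section \<open>The quotient surface\<close>

definition proj :: "(real^2^2) set set \<Rightarrow> complex \<Rightarrow> complex set" where
  "proj \<Gamma> z = (\<lambda>A. act A z) ` \<Union>\<Gamma>"

definition surface :: "(real^2^2) set set \<Rightarrow> complex set set" where
  "surface \<Gamma> = proj \<Gamma> ` halfplane"

definition surface_topology :: "(real^2^2) set set \<Rightarrow> complex set topology" where
  "surface_topology \<Gamma> = topology (\<lambda>U. U \<subseteq> surface \<Gamma> \<and>
      openin (top_of_set halfplane) {z \<in> halfplane. proj \<Gamma> z \<in> U})"

text \<open>
  The area of the quotient is the area of any Borel set of orbit representatives.
\<close>
definition finite_area :: "(real^2^2) set set \<Rightarrow> bool" where
  "finite_area \<Gamma> \<longleftrightarrow> (\<exists>F \<in> sets borel. F \<subseteq> halfplane \<and>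
      (\<forall>X \<in> surface \<Gamma>. \<exists>!z. z \<in> F \<inter> X) \<and> emeasure harea F < \<infinity>)"

section \<open>Zonal Fuchsian groups\<close>

definition stab_inf :: "(real^2^2) set set \<Rightarrow> (real^2^2) set set" where
  "stab_inf \<Gamma> = {X \<in> \<Gamma>. \<forall>A\<in>X. act_inf A = None}"

text \<open>
  Since \<^term>\<open>SL2R\<close> is a double cover of \<^term>\<open>PSL2R\<close>, a subgroup of the latter is discrete
  iff its preimage \<open>\<Union>\<Gamma>\<close> in \<^term>\<open>SL2R\<close> is.
\<close>
definition zonal_fuchsian :: "(real^2^2) set set \<Rightarrow> bool" where
  "zonal_fuchsian \<Gamma> \<longleftrightarrow>
     subgroup \<Gamma> PSL2R \<and> discrete (\<Union>\<Gamma>) \<and>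
     \<not> compact_space (surface_topology \<Gamma>) \<and> finite_area \<Gamma> \<and>
     stab_inf \<Gamma> = generate PSL2R {pm (mat2 1 1 0 1)}"

definition eta :: "(real^2^2) set set \<Rightarrow> real" where
  "eta \<Gamma> = (LEAST m. 0 < m \<and>
      (\<forall>X \<in> \<Gamma> - stab_inf \<Gamma>. \<forall>A\<in>X. horoball m \<inter> act A ` horoball m = {}))"

text \<open>
  The two horoballs below are disjoint by the choice of \<^term>\<open>eta \<Gamma>\<close>, so their closures
  are tangent exactly at the points that they share.
\<close>
definition normalized_zonal :: "(real^2^2) set set \<Rightarrow> bool" where
  "normalized_zonal \<Gamma> \<longleftrightarrow> (\<exists>A \<in> \<Union>\<Gamma>. act_inf A = Some 0 \<and>
      closure (horoball (eta \<Gamma>)) \<inter> closure (act A ` horoball (eta \<Gamma>)) = {Complex 0 (eta \<Gamma>)})"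

text \<open>The transformation \<open>z \<mapsto> - \<eta>\<^sup>2 / z\<close>.\<close>
definition U_eta :: "(real^2^2) set set \<Rightarrow> (real^2^2) set" where
  "U_eta \<Gamma> = pm (mat2 0 (- eta \<Gamma>) (1 / eta \<Gamma>) 0)"

text \<open>
  Numerator and denominator \<open>(p, q)\<close> of a finite point \<open>c\<close> in the orbit of \<open>\<infinity>\<close>; both are
  real numbers.
\<close>
definition fraction :: "(real^2^2) set set \<Rightarrow> real option \<Rightarrow> real \<times> real" where
  "fraction \<Gamma> c = (THE (p, q). \<exists>A \<in> \<Union>\<Gamma>. act_inf A = c \<and> A$1$1 = p \<and> A$2$1 = q \<and> 0 < q)"

section \<open>Excursions\<close>

definition J_set :: "(real \<times> real) set" where
  "J_set = {-1<..<0} \<times> {0<..} \<union> {0<..<1} \<times> {..<0}"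

definition I_set :: "(real \<times> real) set" where
  "I_set = {-1<..<0} \<times> {1<..} \<union> {0<..<1} \<times> {..<-1}"

text \<open>Here and below \<open>\<gamma> :: real \<Rightarrow> complex set\<close> is a unit-speed geodesic on \<^term>\<open>surface \<Gamma>\<close>.\<close>
definition is_lift ::
    "(real^2^2) set set \<Rightarrow> (real \<Rightarrow> complex set) \<Rightarrow> (real \<Rightarrow> complex) \<Rightarrow> bool" where
  "is_lift \<Gamma> \<gamma> \<delta> \<longleftrightarrow> unit_speed_geodesic \<delta> \<and> (\<forall>t. proj \<Gamma> (\<delta> t) = \<gamma> t)"

definition excursion_of_depth ::
    "(real^2^2) set set \<Rightarrow> (real \<Rightarrow> complex set) \<Rightarrow> real \<Rightarrow> real \<Rightarrow> bool" where
  "excursion_of_depth \<Gamma> \<gamma> t d \<longleftrightarrow> 0 < d \<and> d < 2 \<and>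
      (\<exists>\<delta>. is_lift \<Gamma> \<gamma> \<delta> \<and> tangent_horoball \<delta> t (1 / d))"

text \<open>
  An excursion is identified with its depth parameter \<open>t\<close>. The definite descriptions below are
  well defined for generic \<open>\<gamma>\<close> only; for the vertical geodesics used later this fails only
  for countably many \<open>x\<close>.
\<close>
definition excursion :: "(real^2^2) set set \<Rightarrow> (real \<Rightarrow> complex set) \<Rightarrow> real \<Rightarrow> bool" where
  "excursion \<Gamma> \<gamma> t \<longleftrightarrow> (\<exists>d. excursion_of_depth \<Gamma> \<gamma> t d)"

definition depth :: "(real^2^2) set set \<Rightarrow> (real \<Rightarrow> complex set) \<Rightarrow> real \<Rightarrow> real" where
  "depth \<Gamma> \<gamma> t = (THE d. excursion_of_depth \<Gamma> \<gamma> t d)"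

definition excursion_lift ::
    "(real^2^2) set set \<Rightarrow> (real \<Rightarrow> complex set) \<Rightarrow> real \<Rightarrow> real \<Rightarrow> complex" where
  "excursion_lift \<Gamma> \<gamma> t = (THE \<delta>. is_lift \<Gamma> \<gamma> \<delta> \<and>
      tangent_horoball \<delta> t (1 / depth \<Gamma> \<gamma> t) \<and> endpoints_in \<delta> J_set)"

definition approximating :: "(real^2^2) set set \<Rightarrow> (real \<Rightarrow> complex set) \<Rightarrow> real \<Rightarrow> bool" where
  "approximating \<Gamma> \<gamma> t \<longleftrightarrow> excursion \<Gamma> \<gamma> t \<and> endpoints_in (excursion_lift \<Gamma> \<gamma> t) I_set"

section \<open>Convergents\<close>

text \<open>
  The ray orthogonal to the excursion lift at its highest point and heading into the cusp is
  vertical with endpoint \<open>\<infinity>\<close>. If \<open>g\<close> maps the excursion lift to the given lift \<open>\<delta>\<close>,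
  then the corresponding ray orthogonal to \<open>\<delta>\<close> has endpoint \<open>g(\<infinity>)\<close>.
\<close>
definition cusp_point :: "(real^2^2) set set \<Rightarrow> (real \<Rightarrow> complex) \<Rightarrow> real \<Rightarrow> real option" where
  "cusp_point \<Gamma> \<delta> t = (THE c. \<exists>A \<in> \<Union>\<Gamma>.
      (\<forall>s. act A (excursion_lift \<Gamma> (\<lambda>r. proj \<Gamma> (\<delta> r)) t s) = \<delta> s) \<and> c = act_inf A)"

definition vertical :: "real \<Rightarrow> real \<Rightarrow> complex" where
  "vertical x t = Complex x (2 * exp (- t))"

definition beta :: "(real^2^2) set set \<Rightarrow> real \<Rightarrow> real \<Rightarrow> complex set" where
  "beta \<Gamma> x t = proj \<Gamma> (vertical x t)"

definition excursion_times :: "(real^2^2) set set \<Rightarrow> real \<Rightarrow> real set" where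
  "excursion_times \<Gamma> x = {t. 0 \<le> t \<and> excursion \<Gamma> (beta \<Gamma> x) t}"

definition approximating_times :: "(real^2^2) set set \<Rightarrow> real \<Rightarrow> real set" where
  "approximating_times \<Gamma> x = {t. 0 \<le> t \<and> approximating \<Gamma> (beta \<Gamma> x) t}"

text \<open>The \<open>n\<close>-th smallest element of \<open>T\<close>, counting from \<open>n = 1\<close>.\<close>
definition nth_elem :: "real set \<Rightarrow> nat \<Rightarrow> real" where
  "nth_elem T n = (THE t. t \<in> T \<and> finite {s \<in> T. s \<le> t} \<and> card {s \<in> T. s \<le> t} = n)"

definition n_convergent :: "(real^2^2) set set \<Rightarrow> real \<Rightarrow> nat \<Rightarrow> real \<times> real" where
  "n_convergent \<Gamma> x n =
     fraction \<Gamma> (cusp_point \<Gamma> (vertical x) (nth_elem (excursion_times \<Gamma> x) n))"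

definition convergent_a :: "(real^2^2) set set \<Rightarrow> real \<Rightarrow> nat \<Rightarrow> real \<times> real" where
  "convergent_a \<Gamma> x n =
     fraction \<Gamma> (cusp_point \<Gamma> (vertical x) (nth_elem (approximating_times \<Gamma> x) n))"

definition theta :: "(real^2^2) set set \<Rightarrow> nat \<Rightarrow> real \<Rightarrow> real" where
  "theta \<Gamma> n x = (case n_convergent \<Gamma> x n of (p, q) \<Rightarrow> q * \<bar>q * x - p\<bar>)"

definition theta_a :: "(real^2^2) set set \<Rightarrow> nat \<Rightarrow> real \<Rightarrow> real" where
  "theta_a \<Gamma> n x = (case convergent_a \<Gamma> x n of (p, q) \<Rightarrow> q * \<bar>q * x - p\<bar>)"

section \<open>Consistency of the encodings\<close>

lemma carrier_PSL2R: "carrier PSL2R = pm ` {A. det A = 1}"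
proof -
  have mm: "(- mat 1) ** A = - (A :: real^2^2)" for A
    by (simp add: vec_eq_iff matrix_matrix_mult_def mat_def sum_2 forall_2)
  have "r_coset SL2R {mat 1, - mat 1} A = pm A" for A :: "real^2^2"
    by (auto simp: r_coset_def SL2R_def pm_def mm)
  then show ?thesis
    by (auto simp: PSL2R_def carrier_FactGroup SL2R_def)
qed

lemma act_mat2_translation: "act (mat2 1 1 0 1) z = z + 1"
  by (simp add: act_def mat2_def moebius_def vector_def)

lemma act_U_eta:
  assumes "0 < e" and "z \<noteq> 0"
  shows "act (mat2 0 (- e) (1 / e) 0) z = - (complex_of_real e)\<^sup>2 / z"
  using assms by (simp add: act_def mat2_def moebius_def vector_def field_simps power2_eq_square)

lemma istopology_surface:
  "istopology (\<lambda>U. U \<subseteq> surface \<Gamma> \<and>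
      openin (top_of_set halfplane) {z \<in> halfplane. proj \<Gamma> z \<in> U})"
proof -
  have 1: "{z \<in> halfplane. proj \<Gamma> z \<in> S \<inter> T} =
      {z \<in> halfplane. proj \<Gamma> z \<in> S} \<inter> {z \<in> halfplane. proj \<Gamma> z \<in> T}" for S T
    by auto
  have 2: "{z \<in> halfplane. proj \<Gamma> z \<in> \<Union>K} =
      \<Union>((\<lambda>U. {z \<in> halfplane. proj \<Gamma> z \<in> U}) ` K)" for K
    by auto
  show ?thesis
    unfolding istopology_def 1 2 by (auto intro!: openin_Union)
qed

lemma quotient_map_proj: "quotient_map (top_of_set halfplane) (surface_topology \<Gamma>) (proj \<Gamma>)"
proof -
  have o: "openin (surface_topology \<Gamma>) U \<longleftrightarrow> U \<subseteq> surface \<Gamma> \<and>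
      openin (top_of_set halfplane) {z \<in> halfplane. proj \<Gamma> z \<in> U}" for U
    by (simp add: surface_topology_def topology_inverse'[OF istopology_surface])
  have "{z \<in> halfplane. proj \<Gamma> z \<in> surface \<Gamma>} = halfplane"
    by (auto simp: surface_def)
  then have "openin (surface_topology \<Gamma>) (surface \<Gamma>)"
    unfolding o by (metis openin_subtopology_self order_refl)
  then have "topspace (surface_topology \<Gamma>) = surface \<Gamma>"
    by (meson o openin_subset openin_topspace subset_antisym)
  then show ?thesis
    by (auto simp: quotient_map_def o surface_def)
qed

lemma vertical_0: "vertical x 0 = Complex x 2"
  by (simp add: vertical_def)

lemma vertical_forward: "(vertical x \<longlongrightarrow> complex_of_real x) at_top"
proof -
  have "((\<lambda>t::real. 2 * exp (- t)) \<longlongrightarrow> 2 * 0) at_top"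
    by (intro tendsto_intros filterlim_compose[OF exp_at_bot] filterlim_uminus_at_bot_at_top)
  then show ?thesis
    unfolding tendsto_complex_iff by (simp add: vertical_def)
qed

lemma unit_speed_geodesic_vertical: "unit_speed_geodesic (vertical x)"
proof -
  have "hdist (vertical x s) (vertical x t) = \<bar>s - t\<bar>" for s t
  proof -
    define a b where "a = exp s" and "b = exp t"
    have pos: "0 < a" "0 < b"
      by (simp_all add: a_def b_def)
    have "(cmod (vertical x s - vertical x t))\<^sup>2 = (2 / a - 2 / b)\<^sup>2"
      by (simp add: vertical_def cmod_power2 a_def b_def exp_minus divide_inverse)
    moreover have "2 * Im (vertical x s) * Im (vertical x t) = 8 / (a * b)"
      by (simp add: vertical_def a_def b_def exp_minus divide_inverse)
    moreover have "cosh \<bar>s - t\<bar> = (a / b + b / a) / 2"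
      unfolding cosh_real_abs by (simp add: cosh_def a_def b_def exp_diff)
    moreover have "1 + (2 / a - 2 / b)\<^sup>2 / (8 / (a * b)) = (a / b + b / a) / 2"
      using pos by (simp add: field_simps power2_eq_square)
    ultimately have "1 + (cmod (vertical x s - vertical x t))\<^sup>2 /
        (2 * Im (vertical x s) * Im (vertical x t)) = cosh \<bar>s - t\<bar>"
      by (simp only:)
    then show ?thesis
      unfolding hdist_def by (simp add: arcosh_cosh_real del: cosh_real_abs)
  qed
  then show ?thesis
    by (simp add: unit_speed_geodesic_def halfplane_def vertical_def)
qed

end

theory Submission
  imports Defs "HOL-Real_Asymp.Real_Asymp"
begin

text \<open>
  Lifting to the upper half-plane turns the theorem into one about approximation by cusps. Write
  \<open>L\<close> for the set of first columns \<open>(p, q)\<close>, \<open>q > 0\<close>, of matrices representing \<open>\<Gamma>\<close>, and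
  \<open>\<theta>(x, p/q) = q \<bar>q x - p\<bar>\<close>. Moving \<open>p/q\<close> to infinity makes the vertical geodesic over \<open>x\<close> a
  semicircle of radius \<open>1 / (2 \<theta>)\<close>, whose highest point belongs to the parameter
  \<open>ln (2 / \<bar>x - p/q\<bar>)\<close>. Hence, outside a countable set of \<open>x\<close>, the excursions of \<open>\<beta>_x\<close> are the
  \<open>p/q\<close> with \<open>\<theta> < 1\<close>, in the order of decreasing distance to \<open>x\<close>, and those with \<open>\<theta> < 1/2\<close>
  are approximating. Both parts of the theorem therefore follow from one statement
  (\<open>limsup_eq_1\<close>) about any set of fractions between \<open>{\<theta> < 1/2}\<close> and \<open>{\<theta> < 1}\<close>.

  The arithmetic input is Shimizu's lemma: distinct elements of \<open>L\<close> have determinant at least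
  \<open>1\<close> in absolute value, so \<open>\<bar>p/q - p'/q'\<bar> \<ge> 1 / (q q')\<close>.

  \<^emph>\<open>Upper bound.\<close> Let the rank of a fraction be the length of the longest chain of fractions
  ending in it, each approximating the next one to within \<open>1 / (8 q\<^sup>2)\<close>. Fractions of equal rank are
  so far apart that \<open>\<Sum> 1/q\<^sup>2\<close> over those of a given rank in a bounded interval is bounded
  independently of the rank. By the Borel--Cantelli lemma, for almost every \<open>x\<close> only
  finitely many \<open>b\<close> have \<open>\<theta>(x, b)\<close> below a constant times \<open>rank b\<close> to the power \<open>-(1 + \<epsilon>)\<close>. If \<open>\<theta>(x, b)\<close> is small, a
  chain ending in \<open>b\<close> consists of convergents of \<open>x\<close> that come no later than \<open>b\<close>; so the \<open>n\<close>-th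
  convergent has rank at most \<open>n\<close>, and \<open>\<theta>_n\<close> is eventually larger than a constant times \<open>n\<close> to the
  power \<open>-(1 + \<epsilon>)\<close>.

  \<^emph>\<open>Lower bound.\<close> Every dyadic block of denominators contains boundedly many convergents, so
  the index of \<open>p/q\<close> is \<open>O(log q + log (1/\<theta>))\<close>, and it is enough that for almost every \<open>x\<close> there
  is \<open>C\<close> with \<open>\<theta>(x, p/q) \<le> C / log q\<close> for infinitely many \<open>p/q\<close> (\<open>AE_well_approx\<close>). The set of \<open>x\<close>
  violating this is invariant under \<open>\<Gamma>\<close>. The matrix that sends infinity to
  \<open>p/q\<close> and the invariance under translations show that it fills at least a fixed proportion of every
  small neighbourhood of every \<open>p/q\<close> (\<open>ill_approx_near_fraction\<close>). If it had positive measure, a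
  second moment argument inside it would produce points lying in infinitely many of
  the neighbourhoods, a contradiction. This replaces the ergodicity of the geodesic flow.

  The second moment argument needs of the order of \<open>H\<^sup>2\<close> fractions with denominator comparable to
  \<open>H\<close> in a unit interval (\<open>card_unit_interval\<close>), and here finite area enters. Unfolding the
  area of the strip \<open>1/R < Im z < 2/R\<close> over a fundamental set bounds the average
  number of matrices moving a point into the strip from below by a multiple of \<open>R\<close>. That number is at
  most a multiple of \<open>R\<close> at every point, uniformly, because of the determinant condition; so the
  part of the fundamental set outside a large compact set is negligible, and some point in
  the compact set has many such matrices. Their bottom rows yield the desired fractions.
\<close>

section \<open>Two-by-two matrices\<close>

lemma mat2_entries [simp]:
  "mat2 a b c d $ 1 $ 1 = a" "mat2 a b c d $ 1 $ 2 = b"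
  "mat2 a b c d $ 2 $ 1 = c" "mat2 a b c d $ 2 $ 2 = d"
  by (simp_all add: mat2_def)

lemma mat2_eqI:
  fixes A B :: "real^2^2"
  assumes "A$1$1 = B$1$1" "A$1$2 = B$1$2" "A$2$1 = B$2$1" "A$2$2 = B$2$2"
  shows "A = B"
  using assms by (simp add: vec_eq_iff forall_2)

lemma mat2_mult_entries [simp]:
  fixes A B :: "real^2^2"
  shows "(A ** B) $ 1 $ 1 = A$1$1 * B$1$1 + A$1$2 * B$2$1"
    "(A ** B) $ 1 $ 2 = A$1$1 * B$1$2 + A$1$2 * B$2$2"
    "(A ** B) $ 2 $ 1 = A$2$1 * B$1$1 + A$2$2 * B$2$1"
    "(A ** B) $ 2 $ 2 = A$2$1 * B$1$2 + A$2$2 * B$2$2"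
  by (simp_all add: matrix_matrix_mult_def sum_2)

lemma mat_1_entries [simp]:
  "(mat 1 :: real^2^2) $ 1 $ 1 = 1" "(mat 1 :: real^2^2) $ 1 $ 2 = 0"
  "(mat 1 :: real^2^2) $ 2 $ 1 = 0" "(mat 1 :: real^2^2) $ 2 $ 2 = 1"
  by (simp_all add: mat_def)

abbreviation (input) unimodular :: "real^2^2 \<Rightarrow> bool" where
  "unimodular A \<equiv> A$1$1 * A$2$2 - A$1$2 * A$2$1 = 1"

lemma det_entries: "det (A :: real^2^2) = A$1$1 * A$2$2 - A$1$2 * A$2$1"
  by (simp add: det_2)

definition inv2 :: "real^2^2 \<Rightarrow> real^2^2" where
  "inv2 A = mat2 (A$2$2) (- A$1$2) (- A$2$1) (A$1$1)"

lemma inv2_entries [simp]: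
  "inv2 A $ 1 $ 1 = A$2$2" "inv2 A $ 1 $ 2 = - A$1$2"
  "inv2 A $ 2 $ 1 = - A$2$1" "inv2 A $ 2 $ 2 = A$1$1"
  by (simp_all add: inv2_def)

lemma inv2_mult: "det A = 1 \<Longrightarrow> inv2 A ** A = mat 1" "det A = 1 \<Longrightarrow> A ** inv2 A = mat 1"
  by (auto intro!: mat2_eqI simp: det_entries algebra_simps)

lemma det_inv2: "det (inv2 A) = det A"
  by (simp add: det_entries algebra_simps)

lemma det_uminus: "det (- A :: real^2^2) = det A"
  by (simp add: det_entries)

lemma minus_mult_mat:
  fixes A B :: "real^2^2"
  shows "(- A) ** B = - (A ** B)" "A ** (- B) = - (A ** B)"
  by (auto intro!: mat2_eqI)

section \<open>Representing matrices of a subgroup of PSL(2,R)\<close>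

lemma PSL2R_mult: "det A = 1 \<Longrightarrow> det B = 1 \<Longrightarrow> pm A \<otimes>\<^bsub>PSL2R\<^esub> pm B = pm (A ** B)"
  by (auto simp: PSL2R_def FactGroup_def set_mult_def pm_def SL2R_def minus_mult_mat)

lemma PSL2R_one: "\<one>\<^bsub>PSL2R\<^esub> = pm (mat 1)"
  by (simp add: PSL2R_def FactGroup_def pm_def)

lemma group_PSL2R: "group PSL2R"
proof (rule groupI)
  show "\<one>\<^bsub>PSL2R\<^esub> \<in> carrier PSL2R"
    by (auto simp: PSL2R_one carrier_PSL2R)
  show "x \<otimes>\<^bsub>PSL2R\<^esub> y \<in> carrier PSL2R" if "x \<in> carrier PSL2R" "y \<in> carrier PSL2R" for x y
    using that by (auto simp: carrier_PSL2R PSL2R_mult det_mul)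
  show "x \<otimes>\<^bsub>PSL2R\<^esub> y \<otimes>\<^bsub>PSL2R\<^esub> z = x \<otimes>\<^bsub>PSL2R\<^esub> (y \<otimes>\<^bsub>PSL2R\<^esub> z)"
    if "x \<in> carrier PSL2R" "y \<in> carrier PSL2R" "z \<in> carrier PSL2R" for x y z
    using that by (auto simp: carrier_PSL2R PSL2R_mult det_mul matrix_mul_assoc)
  show "\<one>\<^bsub>PSL2R\<^esub> \<otimes>\<^bsub>PSL2R\<^esub> x = x" if "x \<in> carrier PSL2R" for x
    using that by (auto simp: carrier_PSL2R PSL2R_one PSL2R_mult)
  show "\<exists>y\<in>carrier PSL2R. y \<otimes>\<^bsub>PSL2R\<^esub> x = \<one>\<^bsub>PSL2R\<^esub>" if x: "x \<in> carrier PSL2R" for x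
  proof -
    obtain A where A: "x = pm A" "det A = 1"
      using x by (auto simp: carrier_PSL2R)
    then have "pm (inv2 A) \<in> carrier PSL2R" "pm (inv2 A) \<otimes>\<^bsub>PSL2R\<^esub> x = \<one>\<^bsub>PSL2R\<^esub>"
      by (auto simp: carrier_PSL2R det_inv2 PSL2R_mult PSL2R_one inv2_mult)
    then show ?thesis by blast
  qed
qed

lemma PSL2R_inv: "det A = 1 \<Longrightarrow> inv\<^bsub>PSL2R\<^esub> (pm A) = pm (inv2 A)"
  by (rule group.inv_equality[OF group_PSL2R])
    (auto simp: carrier_PSL2R det_inv2 PSL2R_mult PSL2R_one inv2_mult)

definition transl :: "int \<Rightarrow> real^2^2" where
  "transl n = mat2 1 (of_int n) 0 1"

lemma generate_translations:
  assumes "X \<in> generate PSL2R {pm (mat2 1 1 0 1)}"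
  shows "\<exists>n. X = pm (transl n)"
  using assms
proof induction
  case one
  have "mat 1 = transl 0"
    by (auto intro!: mat2_eqI simp: transl_def)
  then show ?case by (auto simp: PSL2R_one)
next
  case (incl h)
  have "mat2 1 1 0 1 = transl 1"
    by (auto intro!: mat2_eqI simp: transl_def)
  with incl show ?case by auto
next
  case (inv h)
  have "inv2 (mat2 1 1 0 1) = transl (-1)" "det (mat2 1 1 0 1) = 1"
    by (auto intro!: mat2_eqI simp: transl_def det_entries)
  with inv show ?case by (auto simp: PSL2R_inv)
next
  case (eng h1 h2)
  then obtain n m where "h1 = pm (transl n)" "h2 = pm (transl m)" by auto
  moreover have "transl n ** transl m = transl (n + m)" "det (transl n) = 1" "det (transl m) = 1"
    by (auto intro!: mat2_eqI simp: transl_def det_entries)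
  ultimately show ?case by (auto simp: PSL2R_mult)
qed

locale zonal =
  fixes \<Gamma> :: "(real^2^2) set set"
  assumes zonal: "zonal_fuchsian \<Gamma>"
begin

text \<open>
  Since \<^const>\<open>act\<close> is defined on matrices, all arguments use the preimage of \<open>\<Gamma>\<close> in SL(2,R).
\<close>
definition M :: "(real^2^2) set" where
  "M = \<Union>\<Gamma>"

lemma subgroup: "subgroup \<Gamma> PSL2R"
  using zonal by (simp add: zonal_fuchsian_def)

lemma M_iff: "A \<in> M \<longleftrightarrow> det A = 1 \<and> pm A \<in> \<Gamma>"
proof
  assume "A \<in> M"
  then obtain X where X: "X \<in> \<Gamma>" "A \<in> X" by (auto simp: M_def)
  then obtain B where "X = pm B" "det B = 1"
    using subgroup.subset[OF subgroup] by (auto simp: carrier_PSL2R)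
  with X show "det A = 1 \<and> pm A \<in> \<Gamma>"
    by (auto simp: pm_def det_uminus insert_commute)
qed (auto simp: M_def pm_def)

lemma det_M: "A \<in> M \<Longrightarrow> unimodular A"
  using M_iff det_entries by metis

lemma M_mult: "A \<in> M \<Longrightarrow> B \<in> M \<Longrightarrow> A ** B \<in> M"
  unfolding M_iff using subgroup.m_closed[OF subgroup, of "pm A" "pm B"]
  by (auto simp: PSL2R_mult det_mul)

lemma M_inv: "A \<in> M \<Longrightarrow> inv2 A \<in> M"
  unfolding M_iff using subgroup.m_inv_closed[OF subgroup, of "pm A"]
  by (auto simp: PSL2R_inv det_inv2)

lemma M_uminus: "A \<in> M \<Longrightarrow> - A \<in> M"
  by (auto simp: M_iff pm_def det_uminus insert_commute)

lemma M_one: "mat 1 \<in> M"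
  using subgroup.one_closed[OF subgroup] by (auto simp: M_iff PSL2R_one)

lemma stab: "stab_inf \<Gamma> = generate PSL2R {pm (mat2 1 1 0 1)}"
  using zonal by (simp add: zonal_fuchsian_def)

lemma M_transl: "transl n \<in> M"
proof -
  have T: "transl 1 \<in> M"
  proof -
    have "pm (mat2 1 1 0 1) \<in> stab_inf \<Gamma>"
      unfolding stab by (rule generate.incl) simp
    moreover have "mat2 1 1 0 1 = transl 1"
      by (auto intro!: mat2_eqI simp: transl_def)
    ultimately show ?thesis
      by (auto simp: stab_inf_def M_def pm_def)
  qed
  have "transl (int k) \<in> M" for k
  proof (induction k)
    case 0
    have "transl 0 = mat 1" by (auto intro!: mat2_eqI simp: transl_def)
    then show ?case using M_one by simp
  next
    case (Suc k)
    have "transl (int (Suc k)) = transl 1 ** transl (int k)"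
      by (auto intro!: mat2_eqI simp: transl_def)
    then show ?case using M_mult[OF T Suc] by simp
  qed
  then have "transl (int (nat \<bar>n\<bar>)) \<in> M" "inv2 (transl (int (nat \<bar>n\<bar>))) \<in> M"
    by (blast intro: M_inv)+
  moreover have "inv2 (transl (int (nat \<bar>n\<bar>))) = transl (- int (nat \<bar>n\<bar>))"
    by (auto intro!: mat2_eqI simp: transl_def)
  ultimately show ?thesis
    by (cases "n \<ge> 0") auto
qed

lemma M_upper_triangular:
  assumes "A \<in> M" "A$2$1 = 0"
  shows "\<exists>n. A = transl n \<or> A = - transl n"
proof -
  have "pm A \<in> stab_inf \<Gamma>"
    using assms by (auto simp: stab_inf_def M_iff act_inf_def pm_def)
  then have "\<exists>n. pm A = pm (transl n)"
    unfolding stab by (rule generate_translations)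
  then show ?thesis
    by (auto simp: pm_def doubleton_eq_iff)
qed

lemma same_bottom_row:
  assumes A: "A \<in> M" and B: "B \<in> M" and e: "A$2$1 = B$2$1" "A$2$2 = B$2$2"
  shows "\<exists>n. B = transl n ** A"
proof -
  define U where "U = B ** inv2 A"
  have UM: "U \<in> M" unfolding U_def by (intro M_mult M_inv A B)
  have "U$2$1 = 0" "U$2$2 = 1"
    using det_M[OF A] e by (auto simp: U_def algebra_simps)
  then obtain n where "U = transl n"
    using M_upper_triangular[OF UM] by (auto simp: transl_def)
  moreover have "B = U ** A"
    using A by (simp add: U_def matrix_mul_assoc[symmetric] inv2_mult M_iff)
  ultimately show ?thesis by blast
qed

lemma discrete_M: "discrete M"
  using zonal by (simp add: zonal_fuchsian_def M_def)

text \<open>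
  Shimizu's lemma. If \<open>0 < \<bar>c\<bar> < 1\<close>, conjugating the translation \<open>z \<mapsto> z + 1\<close> again and again by
  the previous result squares the entry \<open>c\<close> each time, so the conjugates converge to the
  translation without ever reaching it.
\<close>
lemma shimizu:
  assumes A: "A \<in> M" and c0: "A$2$1 \<noteq> 0"
  shows "1 \<le> \<bar>A$2$1\<bar>"
proof (rule ccontr)
  assume "\<not> ?thesis"
  then have c1: "\<bar>A$2$1\<bar> < 1" by simp
  define f where "f = (\<lambda>B. B ** transl 1 ** inv2 B)"
  define B where "B n = (f ^^ n) A" for n
  have BM: "B n \<in> M" for n
    by (induction n) (auto simp: B_def A f_def intro!: M_mult M_transl M_inv)
  have step: "B (Suc n) $1$1 = 1 - B n $1$1 * B n $2$1" "B (Suc n) $1$2 = (B n $1$1)\<^sup>2"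
    "B (Suc n) $2$1 = - (B n $2$1)\<^sup>2" "B (Suc n) $2$2 = 1 + B n $1$1 * B n $2$1" for n
    using det_M[OF BM[of n]]
    by (auto simp: B_def f_def transl_def algebra_simps power2_eq_square)
  define c where "c = (\<lambda>n. B n $2$1)"
  define a where "a = (\<lambda>n. B n $1$1)"
  define r where "r = \<bar>A$2$1\<bar>"
  have r: "0 < r" "r < 1" using c0 c1 by (auto simp: r_def)
  have c: "c n \<noteq> 0 \<and> \<bar>c n\<bar> \<le> r ^ (n + 1)" for n
  proof (induction n)
    case 0
    then show ?case using c0 by (simp add: c_def B_def r_def)
  next
    case (Suc n)
    have "\<bar>c (Suc n)\<bar> = \<bar>c n\<bar> * \<bar>c n\<bar>"
      by (simp add: c_def step power2_eq_square abs_mult)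
    also have "\<dots> \<le> r ^ (n + 1) * r ^ (n + 1)"
      using Suc by (intro mult_mono) auto
    also have "\<dots> \<le> r ^ (n + 1) * r ^ 1"
      using r by (intro mult_left_mono power_decreasing) auto
    finally show ?case
      using Suc by (simp add: c_def step mult_ac)
  qed
  \<comment> \<open>The recursion \<open>\<bar>a (n + 1)\<bar> \<le> 1 + r \<bar>a n\<bar>\<close> preserves any bound that is at least \<open>1 / (1 - r)\<close>.\<close>
  define K where "K = max \<bar>a 0\<bar> (1 / (1 - r))"
  have a: "\<bar>a n\<bar> \<le> K" for n
  proof (induction n)
    case 0
    then show ?case by (simp add: K_def)
  next
    case (Suc n)
    have rn: "\<bar>c n\<bar> \<le> r"
      using c[of n] r power_decreasing[of 1 "n+1" r] by (smt (verit) le_add2 power_one_right)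
    have K0: "0 \<le> K" by (simp add: K_def)
    have "1 / (1 - r) \<le> K" by (simp add: K_def)
    then have "1 \<le> K * (1 - r)"
      using r by (simp add: divide_simps)
    then have "1 + K * r \<le> K" by (simp add: algebra_simps)
    moreover have "\<bar>a (Suc n)\<bar> \<le> 1 + \<bar>a n\<bar> * \<bar>c n\<bar>"
      unfolding abs_mult[symmetric] by (simp add: a_def c_def step)
    moreover have "\<bar>a n\<bar> * \<bar>c n\<bar> \<le> K * r"
      using Suc rn K0 by (intro mult_mono) auto
    ultimately show ?case by linarith
  qed
  have "(\<lambda>n. r ^ (n + 1)) \<longlonglongrightarrow> 0"
    using r LIMSEQ_power_zero[of r] by (subst LIMSEQ_ignore_initial_segment) auto
  then have clim: "c \<longlonglongrightarrow> 0"
    by (rule Lim_null_comparison[rotated]) (use c in auto)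
  have acl: "(\<lambda>n. a n * c n) \<longlonglongrightarrow> 0"
  proof (rule Lim_null_comparison)
    show "\<forall>\<^sub>F n in sequentially. norm (a n * c n) \<le> K * \<bar>c n\<bar>"
      using a by (auto simp: abs_mult intro!: always_eventually mult_right_mono)
    show "(\<lambda>n. K * \<bar>c n\<bar>) \<longlonglongrightarrow> 0"
      using tendsto_mult[OF tendsto_const tendsto_rabs[OF clim], of K] by simp
  qed
  have alim1: "(\<lambda>n. a (Suc n)) \<longlonglongrightarrow> 1"
    using tendsto_diff[OF tendsto_const acl, of 1] by (simp add: a_def c_def step)
  have lim11: "(\<lambda>n. B (Suc (Suc n)) $1$1) \<longlonglongrightarrow> 1"
    using LIMSEQ_ignore_initial_segment[OF alim1, of 1] by (simp add: a_def)
  have lim12: "(\<lambda>n. B (Suc (Suc n)) $1$2) \<longlonglongrightarrow> 1"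
    using tendsto_power[OF alim1, of 2] by (simp add: step a_def)
  have lim21: "(\<lambda>n. B (Suc (Suc n)) $2$1) \<longlonglongrightarrow> 0"
    using LIMSEQ_ignore_initial_segment[OF clim, of 2] by (simp add: c_def)
  have lim22: "(\<lambda>n. B (Suc (Suc n)) $2$2) \<longlonglongrightarrow> 1"
    using LIMSEQ_ignore_initial_segment[OF tendsto_add[OF tendsto_const acl, of 1], of 1]
    by (simp add: a_def c_def step)
  have "(\<lambda>n. B (Suc (Suc n))) \<longlonglongrightarrow> transl 1"
  proof (intro vec_tendstoI)
    fix i j :: 2
    show "(\<lambda>n. B (Suc (Suc n)) $ i $ j) \<longlonglongrightarrow> transl 1 $ i $ j"
      using exhaust_2[of i] exhaust_2[of j] lim11 lim12 lim21 lim22 by (auto simp: transl_def)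
  qed
  moreover have "B (Suc (Suc n)) \<noteq> transl 1" for n
    using c[of "Suc (Suc n)"] by (auto simp: c_def transl_def)
  ultimately have "filterlim (\<lambda>n. B (Suc (Suc n))) (at (transl 1)) sequentially"
    by (auto simp: filterlim_at)
  moreover have "eventually (\<lambda>y. y \<notin> M) (at (transl 1))"
    using discrete_M M_transl by (auto simp: discrete_altdef)
  ultimately have "eventually (\<lambda>n. B (Suc (Suc n)) \<notin> M) sequentially"
    by (rule filterlim_iff[THEN iffD1, rule_format])
  then show False
    using BM by simp
qed

text \<open>
  A discrete set in a space with a countable basis is countable: each point is cut out by a basic
  open set.
\<close>
lemma countable_M: "countable M"
proof -
  obtain B :: "(real^2^2) set set" where B: "countable B" "topological_basis B"
    using ex_countable_basis by blast
  have "\<exists>b\<in>B. b \<inter> M = {A}" if AM: "A \<in> M" for A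
  proof -
    obtain U where U: "open U" "U \<inter> M = {A}"
      using discreteD[OF discrete_M AM] by (auto simp: isolated_in_def)
    then obtain b where "b \<in> B" "A \<in> b" "b \<subseteq> U"
      using B(2) by (metis topological_basisE insertI1 IntD1)
    with U AM show ?thesis by blast
  qed
  then have "M \<subseteq> (\<lambda>b. the_elem (b \<inter> M)) ` B"
    by (metis (no_types, lifting) image_eqI subsetI the_elem_eq)
  with B(1) show ?thesis
    by (meson countable_image countable_subset)
qed

end

section \<open>Sets of fractions with determinants at least one\<close>
text \<open>
  Points at distance at least \<open>s\<close> lie in different cells of length \<open>s\<close>.
\<close>
lemma spaced_card:
  fixes f :: "'a \<Rightarrow> real"
  assumes s: "0 < s" and ab: "a \<le> b"
    and sp: "\<And>u v. u \<in> S \<Longrightarrow> v \<in> S \<Longrightarrow> u \<noteq> v \<Longrightarrow> s \<le> \<bar>f u - f v\<bar>"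
    and im: "\<And>u. u \<in> S \<Longrightarrow> a \<le> f u \<and> f u \<le> b"
  shows "finite S" "real (card S) \<le> (b - a) / s + 1"
proof -
  define g where "g u = \<lfloor>(f u - a) / s\<rfloor>" for u
  have inj: "inj_on g S"
  proof (rule inj_onI, rule ccontr)
    fix u v assume uv: "u \<in> S" "v \<in> S" "g u = g v" "u \<noteq> v"
    have "\<bar>(f u - a) / s - (f v - a) / s\<bar> < 1"
      using uv(3) unfolding g_def by linarith
    moreover have "(f u - a) / s - (f v - a) / s = (f u - f v) / s"
      by (simp add: diff_divide_distrib)
    ultimately have "\<bar>f u - f v\<bar> < s"
      using s by (simp add: divide_simps)
    with sp[OF uv(1,2,4)] show False by simp
  qed
  have sub: "g ` S \<subseteq> {0..\<lfloor>(b - a) / s\<rfloor>}"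
    using im s by (auto simp: g_def intro!: floor_mono divide_right_mono)
  show fin: "finite S"
    using finite_imageD[OF finite_subset[OF sub] inj] by simp
  have "card S = card (g ` S)"
    using inj by (simp add: card_image)
  also have "\<dots> \<le> card {0..\<lfloor>(b - a) / s\<rfloor>}"
    using sub by (intro card_mono) auto
  finally have "card S \<le> nat (\<lfloor>(b - a) / s\<rfloor> + 1)" by simp
  moreover have "0 \<le> (b - a) / s" using s ab by simp
  ultimately show "real (card S) \<le> (b - a) / s + 1"
    by linarith
qed

text \<open>
  Allows summing measures over finite index sets only: the index set is exhausted by finite ones.
\<close>
lemma emeasure_UN_le_finite:
  assumes I: "countable I" and A: "\<And>i. i \<in> I \<Longrightarrow> A i \<in> sets N"
    and fin: "\<And>J. finite J \<Longrightarrow> J \<subseteq> I \<Longrightarrow> emeasure N (\<Union>i\<in>J. A i) \<le> c"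
  shows "emeasure N (\<Union>i\<in>I. A i) \<le> c"
proof (cases "I = {}")
  case True
  then show ?thesis by simp
next
  case False
  define B where "B n = (\<Union>k\<le>n. A (from_nat_into I k))" for n :: nat
  have mem: "from_nat_into I k \<in> I" for k
    using False by (rule from_nat_into)
  have "(\<Union>i\<in>I. A i) = (\<Union>k. A (from_nat_into I k))"
    using range_from_nat_into[OF False I] by (metis image_image)
  also have "\<dots> = (\<Union>n. B n)"
    by (auto simp: B_def)
  finally have "(\<Union>i\<in>I. A i) = (\<Union>n. B n)" .
  moreover have "(SUP n. emeasure N (B n)) = emeasure N (\<Union>n. B n)"
    by (rule SUP_emeasure_incseq) (auto simp: B_def incseq_def intro!: A mem intro: order_trans)
  moreover have "emeasure N (B n) \<le> c" for n
    using fin[of "from_nat_into I ` {..n}"] mem by (auto simp: B_def)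
  ultimately show ?thesis
    by (metis SUP_least)
qed

definition val :: "real \<times> real \<Rightarrow> real" where
  "val b = fst b / snd b"

text \<open>
  The quantity \<open>\<theta>\<close> of the fraction \<open>b\<close> as an approximation of \<open>x\<close>.
\<close>
definition approx :: "real \<Rightarrow> real \<times> real \<Rightarrow> real" where
  "approx x b = snd b * \<bar>snd b * x - fst b\<bar>"

text \<open>
  Numerators and denominators are real numbers; the determinant condition takes the place of
  integrality.
\<close>
locale fractions =
  fixes L :: "(real \<times> real) set"
  assumes den_ge_1: "b \<in> L \<Longrightarrow> 1 \<le> snd b"
    and det_ge_1: "a \<in> L \<Longrightarrow> b \<in> L \<Longrightarrow> a \<noteq> b \<Longrightarrow> 1 \<le> \<bar>fst a * snd b - fst b * snd a\<bar>"
begin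

lemma den_pos: "b \<in> L \<Longrightarrow> 0 < snd b"
  by (frule den_ge_1) linarith

lemma approx_eq: "b \<in> L \<Longrightarrow> approx x b = (snd b)\<^sup>2 * \<bar>x - val b\<bar>"
proof -
  assume "b \<in> L"
  then have q: "0 < snd b" by (rule den_pos)
  have "snd b * x - fst b = snd b * (x - val b)"
    using q by (simp add: val_def field_simps)
  then show ?thesis
    using q by (simp add: approx_def abs_mult power2_eq_square)
qed

lemma separation:
  assumes "a \<in> L" "b \<in> L" "a \<noteq> b"
  shows "1 / (snd a * snd b) \<le> \<bar>val a - val b\<bar>"
proof -
  have q: "0 < snd a" "0 < snd b" using assms den_pos by auto
  have "val a - val b = (fst a * snd b - fst b * snd a) / (snd a * snd b)"
    using q by (simp add: val_def field_simps)
  then show ?thesis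
    using det_ge_1[OF assms] q by (simp add: abs_mult divide_right_mono)
qed

lemma card_window:
  assumes Q: "1 \<le> Q" and r: "0 \<le> r"
    and S: "\<And>b. b \<in> S \<Longrightarrow> b \<in> L \<and> snd b \<le> Q \<and> \<bar>val b - x\<bar> \<le> r"
  shows "finite S" "real (card S) \<le> 2 * r * Q\<^sup>2 + 1"
proof -
  have sp: "1 / Q\<^sup>2 \<le> \<bar>val a - val b\<bar>" if "a \<in> S" "b \<in> S" "a \<noteq> b" for a b
  proof -
    have ab: "0 < snd a" "0 < snd b" "snd a \<le> Q" "snd b \<le> Q" "a \<in> L" "b \<in> L"
      using that S den_pos by auto
    have "1 / Q\<^sup>2 \<le> 1 / (snd a * snd b)"
      unfolding power2_eq_square using ab Q by (intro divide_left_mono mult_mono) auto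
    also have "\<dots> \<le> \<bar>val a - val b\<bar>"
      using separation ab that by blast
    finally show ?thesis .
  qed
  have im: "x - r \<le> val b \<and> val b \<le> x + r" if "b \<in> S" for b
    using S[OF that] by (auto simp: abs_le_iff)
  have Q2: "0 < 1 / Q\<^sup>2" using Q by simp
  show "finite S" by (rule spaced_card(1)[OF Q2 _ sp im]) (use r in auto)
  have "real (card S) \<le> (x + r - (x - r)) / (1 / Q\<^sup>2) + 1"
    by (rule spaced_card(2)[OF Q2 _ sp im]) (use r in auto)
  then show "real (card S) \<le> 2 * r * Q\<^sup>2 + 1" by simp
qed

lemma countable_L: "countable L"
proof -
  have "L \<subseteq> (\<Union>n::nat. {b \<in> L. snd b \<le> 1 + real n \<and> \<bar>val b - 0\<bar> \<le> real n})"
  proof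
    fix b assume b: "b \<in> L"
    obtain n :: nat where "max (snd b) \<bar>val b\<bar> \<le> real n"
      using real_arch_simple by blast
    with b show "b \<in> (\<Union>n::nat. {b \<in> L. snd b \<le> 1 + real n \<and> \<bar>val b - 0\<bar> \<le> real n})"
      by (auto intro!: exI[of _ n])
  qed
  moreover have "finite {b \<in> L. snd b \<le> 1 + real n \<and> \<bar>val b - 0\<bar> \<le> real n}" for n
    by (rule card_window(1)[of "1 + real n" "real n" _ 0]) auto
  ultimately show ?thesis
    by (meson countable_UN countable_finite countable_subset countableI_type)
qed

text \<open>
  Fractions with \<open>\<theta> \<le> 1\<close> and denominator between \<open>Q\<close> and \<open>2 Q\<close> lie within \<open>1/Q\<^sup>2\<close> of \<open>x\<close>, and
  the distance of any two of them is at least \<open>1 / (4 Q\<^sup>2)\<close>; so there are at most nine of them.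
\<close>
lemma card_dyadic:
  assumes S: "\<And>b. b \<in> S \<Longrightarrow> b \<in> L \<and> snd b \<le> 2 ^ k \<and> approx x b \<le> 1"
  shows "finite S \<and> card S \<le> 9 * (k + 1)"
  using S
proof (induction k arbitrary: S)
  case 0
  have win: "b \<in> L \<and> snd b \<le> 1 \<and> \<bar>val b - x\<bar> \<le> 1" if "b \<in> S" for b
  proof -
    have b: "b \<in> L" "snd b = 1" "approx x b \<le> 1"
      using 0[OF that] den_ge_1[of b] by auto
    then show ?thesis by (simp add: approx_eq abs_minus_commute)
  qed
  have "finite S" "real (card S) \<le> 2 * 1 * 1\<^sup>2 + 1"
    by (rule card_window[OF _ _ win]; simp)+
  then show ?case by auto
next
  case (Suc k)
  define S' where "S' = {b \<in> S. snd b > 2 ^ k}"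
  have "\<bar>val b - x\<bar> \<le> 1 / (2^k)\<^sup>2" if "b \<in> S'" for b
  proof -
    have b: "b \<in> L" "2 ^ k < snd b" "approx x b \<le> 1"
      using Suc(2) that by (auto simp: S'_def)
    have "(2^k)\<^sup>2 \<le> (snd b)\<^sup>2"
      using b by (intro power_mono) auto
    then have "(2^k)\<^sup>2 * \<bar>x - val b\<bar> \<le> (snd b)\<^sup>2 * \<bar>x - val b\<bar>"
      by (intro mult_right_mono) auto
    also have "\<dots> \<le> 1" using b by (simp add: approx_eq)
    finally show ?thesis
      by (simp add: pos_le_divide_eq abs_minus_commute mult.commute)
  qed
  then have win: "b \<in> L \<and> snd b \<le> 2 ^ Suc k \<and> \<bar>val b - x\<bar> \<le> 1 / (2^k)\<^sup>2" if "b \<in> S'" for b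
    using Suc(2)[of b] that by (simp add: S'_def)
  have one: "(1::real) \<le> 2 ^ Suc k" by (rule one_le_power) simp
  have S': "finite S'" "real (card S') \<le> 2 * (1 / (2^k)\<^sup>2) * (2 ^ Suc k)\<^sup>2 + 1"
    by (rule card_window[OF one _ win]; simp)+
  have "2 * (1 / (2^k)\<^sup>2) * (2 ^ Suc k)\<^sup>2 + 1 = (9::real)"
    by (simp add: power_mult_distrib)
  then have "real (card S') \<le> 9"
    using S'(2) by simp
  then have c9: "card S' \<le> 9" by linarith
  have IH: "finite (S - S') \<and> card (S - S') \<le> 9 * (k + 1)"
    by (rule Suc.IH) (use Suc(2) in \<open>auto simp: S'_def not_less\<close>)
  have eq: "S' \<union> (S - S') = S" by (auto simp: S'_def)
  have "finite S" using S' IH by simp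
  moreover have "card S \<le> card S' + card (S - S')"
    using card_Un_le[of S' "S - S'"] unfolding eq .
  ultimately show ?case using c9 IH by simp
qed

section \<open>Chains of approximations\<close>

text \<open>
  The constant \<open>8\<close> forces the denominators along a chain to grow by the factor \<open>8\<close>, so that
  errors accumulated along a chain stay comparable to the last one.
\<close>
definition precedes :: "real \<times> real \<Rightarrow> real \<times> real \<Rightarrow> bool" where
  "precedes a b \<longleftrightarrow> snd a < snd b \<and> \<bar>val a - val b\<bar> \<le> 1 / (8 * (snd a)\<^sup>2)"

inductive chain :: "nat \<Rightarrow> real \<times> real \<Rightarrow> bool" where
  single: "b \<in> L \<Longrightarrow> chain 1 b"
| extend: "chain n a \<Longrightarrow> precedes a b \<Longrightarrow> b \<in> L \<Longrightarrow> chain (Suc n) b"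

lemma chain_in_L: "chain n b \<Longrightarrow> b \<in> L"
  by (erule chain.cases) auto

lemma precedes_den:
  assumes "a \<in> L" "b \<in> L" "precedes a b"
  shows "8 * snd a \<le> snd b"
proof -
  have q: "0 < snd a" "0 < snd b" using assms den_pos by auto
  have "a \<noteq> b" using assms by (auto simp: precedes_def)
  then have "1 / (snd a * snd b) \<le> 1 / (8 * (snd a)\<^sup>2)"
    using separation[OF assms(1,2)] assms(3) by (auto simp: precedes_def)
  then have "8 * (snd a)\<^sup>2 \<le> snd a * snd b"
    using q by (simp add: divide_simps mult_ac split: if_splits)
  then show ?thesis
    using q by (simp add: power2_eq_square)
qed

lemma chain_length: "chain n b \<Longrightarrow> real n \<le> snd b"
proof (induction rule: chain.induct)
  case (single b)
  then show ?case using den_ge_1 by simp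
next
  case (extend n a b)
  then have "8 * snd a \<le> snd b" "1 \<le> snd a"
    using precedes_den chain_in_L den_ge_1 by blast+
  then show ?case using extend by simp
qed

text \<open>
  Errors along a chain add up like a geometric series, so all its elements are good approximations
  of \<open>x\<close> if the last one is. Consecutive elements are at least \<open>1 / (q q')\<close> apart, which exceeds
  twice the error of the later one; so the earlier one is farther from \<open>x\<close>.
\<close>
lemma chain_approx:
  assumes "chain n b" "\<bar>x - val b\<bar> \<le> 1 / (7 * (snd b)\<^sup>2)"
  shows "\<exists>C. finite C \<and> card C = n \<and> C \<subseteq> L \<and>
    (\<forall>a\<in>C. \<bar>x - val a\<bar> \<le> 1 / (7 * (snd a)\<^sup>2) \<and> \<bar>x - val b\<bar> \<le> \<bar>x - val a\<bar>)"
  using assms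
proof (induction rule: chain.induct)
  case (single b)
  then show ?case by (intro exI[of _ "{b}"]) auto
next
  case (extend n a b)
  have aL: "a \<in> L" using extend chain_in_L by blast
  have q: "0 < snd a" "0 < snd b" "8 * snd a \<le> snd b"
    using extend aL den_pos precedes_den by auto
  have "(8 * snd a)\<^sup>2 \<le> (snd b)\<^sup>2"
    using q by (intro power_mono) auto
  then have q2: "64 * (snd a)\<^sup>2 \<le> (snd b)\<^sup>2"
    by (simp add: power_mult_distrib)
  have near: "\<bar>x - val a\<bar> \<le> 1 / (7 * (snd a)\<^sup>2)"
  proof -
    have "\<bar>x - val a\<bar> \<le> 1 / (7 * (snd b)\<^sup>2) + 1 / (8 * (snd a)\<^sup>2)"
      using extend by (auto simp: precedes_def)
    also have "1 / (7 * (snd b)\<^sup>2) \<le> 1 / (7 * (64 * (snd a)\<^sup>2))"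
      using q q2 by (intro divide_left_mono mult_left_mono) auto
    \<comment> \<open>The constant \<open>7\<close> reproduces itself: \<open>1/448 + 1/8 \<le> 1/7\<close>.\<close>
    also have "1 / (7 * (64 * (snd a)\<^sup>2)) + 1 / (8 * (snd a)\<^sup>2) \<le> 1 / (7 * (snd a)\<^sup>2)"
      using q by (simp add: divide_simps)
    finally show ?thesis by simp
  qed
  obtain C where C: "finite C" "card C = n" "C \<subseteq> L"
    "\<forall>c\<in>C. \<bar>x - val c\<bar> \<le> 1 / (7 * (snd c)\<^sup>2) \<and> \<bar>x - val a\<bar> \<le> \<bar>x - val c\<bar>"
    using extend.IH[OF near] by auto
  have less: "\<bar>x - val b\<bar> < \<bar>x - val a\<bar>"
  proof -
    have "a \<noteq> b" using extend by (auto simp: precedes_def)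
    then have "1 / (snd a * snd b) \<le> \<bar>val a - val b\<bar>"
      using separation aL extend by blast
    moreover have "8 / (snd b)\<^sup>2 \<le> 1 / (snd a * snd b)"
      using q by (simp add: divide_simps power2_eq_square)
    moreover have "1 / (7 * (snd b)\<^sup>2) + 1 / (7 * (snd b)\<^sup>2) < 8 / (snd b)\<^sup>2"
      using q by (simp add: divide_simps)
    ultimately show ?thesis
      using extend.prems by linarith
  qed
  then have "b \<notin> C" using C(4) by fastforce
  then show ?case
    using C less extend by (intro exI[of _ "insert b C"]) force
qed

text \<open>
  The longest chain has finite length, since its length is bounded by the last denominator.
\<close>
definition rank :: "real \<times> real \<Rightarrow> nat" where
  "rank b = (GREATEST n. chain n b)"

lemma chain_bound: "chain n b \<Longrightarrow> n \<le> nat \<lceil>snd b\<rceil>"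
  using chain_length[of n b] by linarith

lemma chain_rank: "b \<in> L \<Longrightarrow> chain (rank b) b"
  unfolding rank_def by (rule GreatestI_nat[where P = "\<lambda>n. chain n b", OF single]) (auto dest: chain_bound)

lemma rank_greatest: "chain n b \<Longrightarrow> n \<le> rank b"
  unfolding rank_def by (rule Greatest_le_nat) (auto dest: chain_bound)

text \<open>
  Otherwise one of the two fractions would precede the other, and a longest chain ending in the
  first could be prolonged to the second.
\<close>
lemma rank_antichain:
  assumes "a \<in> L" "b \<in> L" "a \<noteq> b" "rank a = rank b"
  shows "1 / (16 * (snd a)\<^sup>2) + 1 / (16 * (snd b)\<^sup>2) < \<bar>val a - val b\<bar>"
proof -
  have *: "1 / (16 * (snd a)\<^sup>2) + 1 / (16 * (snd b)\<^sup>2) < \<bar>val a - val b\<bar>"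
    if ab: "a \<in> L" "b \<in> L" "a \<noteq> b" "rank a = rank b" "snd a \<le> snd b" for a b
  proof -
    have q: "0 < snd a" "0 < snd b" using ab den_pos by auto
    have "\<not> precedes a b"
      using chain.extend[OF chain_rank[OF ab(1)] _ ab(2)] rank_greatest ab(4) by fastforce
    then have lt: "1 / (8 * (snd a)\<^sup>2) < \<bar>val a - val b\<bar>"
    proof (cases "snd a < snd b")
      case False
      then have "snd a = snd b" using ab by simp
      then have "1 / (snd a)\<^sup>2 \<le> \<bar>val a - val b\<bar>"
        using separation[OF ab(1-3)] by (simp add: power2_eq_square)
      moreover have "1 / (8 * (snd a)\<^sup>2) < 1 / (snd a)\<^sup>2"
        using q by (simp add: divide_simps)
      ultimately show ?thesis by simp
    qed (auto simp: precedes_def)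
    have "1 / (16 * (snd b)\<^sup>2) \<le> 1 / (16 * (snd a)\<^sup>2)"
      using q ab by (intro divide_left_mono mult_left_mono power_mono) auto
    then have le: "1 / (16 * (snd a)\<^sup>2) + 1 / (16 * (snd b)\<^sup>2)
        \<le> 1 / (16 * (snd a)\<^sup>2) + 1 / (16 * (snd a)\<^sup>2)"
      by (rule add_left_mono)
    have eq: "1 / (16 * (snd a)\<^sup>2) + 1 / (16 * (snd a)\<^sup>2) = 1 / (8 * (snd a)\<^sup>2)"
      using q by (simp add: divide_simps)
    show ?thesis
      by (rule order.strict_trans1[OF le[unfolded eq] lt])
  qed
  show ?thesis
    using *[of a b] *[of b a] assms by (cases "snd a \<le> snd b") (auto simp: abs_minus_commute)
qed

text \<open>
  The intervals of radius \<open>1 / (16 q\<^sup>2)\<close> around the fractions of a given rank are disjoint, so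
  their total length is bounded by that of a slightly larger interval.
\<close>
lemma rank_sum:
  assumes fin: "finite A" and A: "\<And>b. b \<in> A \<Longrightarrow> b \<in> L \<and> rank b = m \<and> -1 \<le> val b \<and> val b \<le> 2"
  shows "(\<Sum>b\<in>A. 1 / (snd b)\<^sup>2) \<le> 40"
proof -
  define I where "I b = cball (val b) (1 / (16 * (snd b)\<^sup>2))" for b
  have d: "disjoint_family_on I A"
    unfolding disjoint_family_on_def
  proof (intro ballI impI)
    fix a b assume "a \<in> A" "b \<in> A" "a \<noteq> b"
    then have "1 / (16 * (snd a)\<^sup>2) + 1 / (16 * (snd b)\<^sup>2) < \<bar>val a - val b\<bar>"
      using rank_antichain A by blast
    then show "I a \<inter> I b = {}"
      by (auto simp: I_def dist_real_def)
  qed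
  have sub: "(\<Union>b\<in>A. I b) \<subseteq> {-2..3}"
  proof -
    have "1 / (16 * (snd b)\<^sup>2) \<le> 1" if "b \<in> A" for b
    proof -
      have "1 \<le> (snd b)\<^sup>2" using den_ge_1 A[OF that] by (simp add: one_le_power)
      then show ?thesis by (simp add: divide_simps)
    qed
    then show ?thesis using A by (fastforce simp: I_def dist_real_def)
  qed
  have "(\<Sum>b\<in>A. 1 / (8 * (snd b)\<^sup>2)) = (\<Sum>b\<in>A. measure lborel (I b))"
    by (intro sum.cong) (auto simp: I_def cball_eq_atLeastAtMost)
  also have "\<dots> = measure lborel (\<Union>b\<in>A. I b)"
    by (intro measure_finite_Union[symmetric] fin d) (auto simp: I_def cball_eq_atLeastAtMost)
  also have "\<dots> \<le> measure lborel {-2..3::real}"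
    using sub by (intro measure_mono_fmeasurable) (auto simp: I_def fmeasurable_def fin)
  finally have "(\<Sum>b\<in>A. 1 / (8 * (snd b)\<^sup>2)) \<le> 5"
    by simp
  moreover have "(\<Sum>b\<in>A. 1 / (8 * (snd b)\<^sup>2)) = (1 / 8) * (\<Sum>b\<in>A. 1 / (snd b)\<^sup>2)"
    unfolding sum_distrib_left by (rule sum.cong) simp_all
  ultimately show ?thesis by linarith
qed

text \<open>
  The convergence part of the Borel--Cantelli lemma, with one event per rank. It leaves finitely
  many ranks, and within one rank disjointness leaves at most one fraction.
\<close>
lemma AE_finite_small_approx:
  assumes \<delta>: "summable \<delta>" "\<And>m. 0 \<le> \<delta> m" "\<And>m. \<delta> m \<le> 1 / 16"
  shows "AE x in lborel. 0 < x \<and> x < 1 \<longrightarrow> finite {b \<in> L. approx x b \<le> \<delta> (rank b)}"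
proof -
  define I where "I m = {b \<in> L. rank b = m \<and> -1 \<le> val b \<and> val b \<le> 2}" for m
  define E where "E m = (\<Union>b\<in>I m. cball (val b) (\<delta> m / (snd b)\<^sup>2))" for m
  have cI: "countable (I m)" for m
    by (rule countable_subset[OF _ countable_L]) (auto simp: I_def)
  have bound: "emeasure lborel (E m) \<le> ennreal (80 * \<delta> m)" for m
    unfolding E_def
  proof (rule emeasure_UN_le_finite[OF cI])
    fix J assume J: "finite J" "J \<subseteq> I m"
    have "emeasure lborel (\<Union>b\<in>J. cball (val b) (\<delta> m / (snd b)\<^sup>2))
      \<le> (\<Sum>b\<in>J. emeasure lborel (cball (val b) (\<delta> m / (snd b)\<^sup>2)))"
      using J by (intro emeasure_subadditive_finite) auto
    also have "\<dots> = (\<Sum>b\<in>J. ennreal (2 * \<delta> m * (1 / (snd b)\<^sup>2)))"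
      using \<delta>(2)[of m] by (intro sum.cong) (auto simp: cball_eq_atLeastAtMost)
    also have "\<dots> = ennreal (2 * \<delta> m * (\<Sum>b\<in>J. 1 / (snd b)\<^sup>2))"
      using \<delta>(2)[of m] by (subst sum_ennreal) (auto simp: sum_distrib_left)
    also have "\<dots> \<le> ennreal (2 * \<delta> m * 40)"
      using J \<delta>(2)[of m] rank_sum[of J m]
      by (intro ennreal_leI mult_left_mono) (auto simp: I_def)
    finally show "emeasure lborel (\<Union>b\<in>J. cball (val b) (\<delta> m / (snd b)\<^sup>2)) \<le> ennreal (80 * \<delta> m)"
      by simp
  qed auto
  have Eset: "E m \<in> sets lborel" for m
    unfolding E_def using cI by (intro sets.countable_UN') auto
  have "AE x in lborel. eventually (\<lambda>m. x \<in> space lborel - E m) sequentially"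
  proof (rule borel_cantelli_AE1)
    show "emeasure lborel (E m) < \<infinity>" for m
      using bound[of m] by (simp add: le_less_trans)
    show "summable (\<lambda>m. measure lborel (E m))"
    proof (rule summable_comparison_test)
      show "summable (\<lambda>m. 80 * \<delta> m)" using \<delta> by (simp add: summable_mult)
      have "measure lborel (E m) \<le> 80 * \<delta> m" for m
        using bound[of m] \<delta>(2)[of m] by (simp add: measure_def enn2real_leI)
      then show "\<exists>N. \<forall>n\<ge>N. norm (measure lborel (E n)) \<le> 80 * \<delta> n" by simp
    qed
  qed (rule Eset)
  then show ?thesis
  proof eventually_elim
    case (elim x)
    then obtain m0 where m0: "\<And>m. m \<ge> m0 \<Longrightarrow> x \<notin> E m"
      by (auto simp: eventually_sequentially)
    show ?case
    proof
      assume x: "0 < x \<and> x < 1"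
      define B where "B = {b \<in> L. approx x b \<le> \<delta> (rank b)}"
      have near: "\<bar>x - val b\<bar> \<le> \<delta> (rank b) / (snd b)\<^sup>2 \<and> \<bar>x - val b\<bar> \<le> 1 / (16 * (snd b)\<^sup>2)
        \<and> \<bar>x - val b\<bar> \<le> 1" if "b \<in> B" for b
      proof -
        have b: "b \<in> L" "approx x b \<le> \<delta> (rank b)" using that by (auto simp: B_def)
        have q: "1 \<le> (snd b)\<^sup>2" using den_ge_1[OF b(1)] by (simp add: one_le_power)
        have sm: "(snd b)\<^sup>2 * \<bar>x - val b\<bar> \<le> \<delta> (rank b)"
          using b by (simp add: approx_eq)
        have "\<bar>x - val b\<bar> \<le> (snd b)\<^sup>2 * \<bar>x - val b\<bar>"
          using mult_right_mono[OF q, of "\<bar>x - val b\<bar>"] by simp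
        with sm \<delta>(3)[of "rank b"] have "\<bar>x - val b\<bar> \<le> 1" by linarith
        moreover have "\<bar>x - val b\<bar> * (snd b)\<^sup>2 \<le> \<delta> (rank b)"
          using sm by (simp add: mult.commute)
        moreover have "\<bar>x - val b\<bar> * (16 * (snd b)\<^sup>2) \<le> 1"
          using sm \<delta>(3)[of "rank b"] by (simp add: mult.commute)
        moreover have "0 < (snd b)\<^sup>2" "0 < 16 * (snd b)\<^sup>2" using q by linarith+
        ultimately show ?thesis
          by (simp only: pos_le_divide_eq)
      qed
      have "rank b < m0" if "b \<in> B" for b
      proof (rule ccontr)
        assume "\<not> ?thesis"
        then have "x \<notin> E (rank b)" using m0 by simp
        moreover have "b \<in> I (rank b)"
          using near[OF that] that x by (auto simp: I_def B_def)
        moreover have "x \<in> cball (val b) (\<delta> (rank b) / (snd b)\<^sup>2)"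
          using near[OF that] by (simp add: dist_real_def abs_minus_commute)
        ultimately show False unfolding E_def by blast
      qed
      then have rng: "rank ` B \<subseteq> {..<m0}" by auto
      have inj: "inj_on rank B"
      proof (rule inj_onI, rule ccontr)
        fix a b assume ab: "a \<in> B" "b \<in> B" "rank a = rank b" "a \<noteq> b"
        then have "1 / (16 * (snd a)\<^sup>2) + 1 / (16 * (snd b)\<^sup>2) < \<bar>val a - val b\<bar>"
          using rank_antichain by (auto simp: B_def)
        with near[OF ab(1)] near[OF ab(2)] show False by linarith
      qed
      have "finite (rank ` B)"
        using rng by (rule finite_subset) simp
      then have "finite B"
        using inj by (rule finite_imageD)
      then show "finite {b \<in> L. approx x b \<le> \<delta> (rank b)}"
        by (simp add: B_def)
    qed
  qed
qed

end

section \<open>Enumeration by decreasing distance\<close>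

lemma nth_elem_props:
  assumes inf: "infinite T" and lf: "\<And>t. finite {s \<in> T. s \<le> t}" and n: "1 \<le> n"
  shows "nth_elem T n \<in> T \<and> card {s \<in> T. s \<le> nth_elem T n} = n"
proof -
  define c where "c t = card {s \<in> T. s \<le> t}" for t
  have less: "c t < c u" if "t < u" "u \<in> T" for t u
  proof -
    have "u \<in> {s \<in> T. s \<le> u}" "u \<notin> {s \<in> T. s \<le> t}" using that by auto
    then have "{s \<in> T. s \<le> t} \<subset> {s \<in> T. s \<le> u}" using that by fastforce
    then show ?thesis unfolding c_def by (intro psubset_card_mono lf)
  qed
  have mono: "c t \<le> c u" if "t \<le> u" for t u
    unfolding c_def using that by (intro card_mono lf) auto
  obtain t0 where t0: "t0 \<in> T" "n \<le> c t0"
  proof -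
    obtain A where A: "A \<subseteq> T" "finite A" "card A = n"
      using infinite_arbitrarily_large[OF inf] by blast
    have ne: "A \<noteq> {}" using A n by auto
    then have "Max A \<in> T" using A Max_in by blast
    moreover have "card A \<le> c (Max A)"
      unfolding c_def using A by (intro card_mono lf) auto
    ultimately show ?thesis using that A by blast
  qed
  define D where "D = {s \<in> T. s \<le> t0 \<and> n \<le> c s}"
  have D: "finite D" "t0 \<in> D"
    using lf[of t0] t0 by (auto simp: D_def elim: finite_subset[rotated])
  define t where "t = Min D"
  have t: "t \<in> T" "n \<le> c t" "t \<le> t0"
    using Min_in[OF D(1)] D(2) by (auto simp: t_def D_def)
  have "c t = n"
  proof (rule ccontr)
    assume "c t \<noteq> n"
    then have gt: "n < c t" using t by simp
    define B where "B = {s \<in> T. s < t}"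
    have fB: "finite B" using lf[of t] by (rule finite_subset[rotated]) (auto simp: B_def)
    have "{s \<in> T. s \<le> t} = insert t B" using t by (auto simp: B_def)
    then have cB: "c t = Suc (card B)" using fB by (simp add: c_def B_def)
    then have "B \<noteq> {}" using gt n by auto
    then have m: "Max B \<in> B" using fB by simp
    have "card B \<le> c (Max B)"
      unfolding c_def using fB by (intro card_mono lf) (auto simp: B_def)
    then have "Max B \<in> D" using m cB gt t by (auto simp: D_def B_def)
    then have "t \<le> Max B" using D(1) by (simp add: t_def)
    with m show False by (simp add: B_def)
  qed
  have "nth_elem T n = t"
    unfolding nth_elem_def
  proof (rule the_equality)
    show "t \<in> T \<and> finite {s \<in> T. s \<le> t} \<and> card {s \<in> T. s \<le> t} = n"
      using t lf \<open>c t = n\<close> by (auto simp: c_def)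
    show "s = t" if "s \<in> T \<and> finite {r \<in> T. r \<le> s} \<and> card {r \<in> T. r \<le> s} = n" for s
      using that less[of s t] less[of t s] t \<open>c t = n\<close> by (cases s t rule: linorder_cases) (auto simp: c_def)
  qed
  then show ?thesis using t \<open>c t = n\<close> by (simp add: c_def)
qed

text \<open>
  The parameter at which the vertical geodesic over \<open>x\<close> is at height \<open>\<bar>x - val b\<bar>\<close>, the foot
  of the perpendicular from \<open>val b\<close>.
\<close>
definition time :: "real \<Rightarrow> real \<times> real \<Rightarrow> real" where
  "time x b = ln (2 / \<bar>x - val b\<bar>)"

abbreviation (input) log_rate :: "(nat \<Rightarrow> real) \<Rightarrow> ereal" where
  "log_rate \<theta> \<equiv> limsup (\<lambda>n. ereal (- (ln (\<theta> n) / ln (real n))))"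

text \<open>
  Summable in \<open>m\<close>, and almost of order \<open>1/m\<close> when \<open>j\<close> is large. The factor \<open>1/16\<close> keeps all its
  values in the range for which fractions of equal rank exclude each other.
\<close>
definition null_seq :: "nat \<Rightarrow> nat \<Rightarrow> real" where
  "null_seq j m = (1 / 16) * (real m + 1) powr (- (1 + 1 / (real j + 1)))"

lemma null_seq_pos: "0 < null_seq j m"
  by (simp add: null_seq_def)

lemma null_seq_antimono: "m \<le> n \<Longrightarrow> null_seq j n \<le> null_seq j m"
proof -
  have "0 \<le> 1 / (real j + 1)" by simp
  then have "- (1 + 1 / (real j + 1)) \<le> 0" by linarith
  then show "m \<le> n \<Longrightarrow> null_seq j n \<le> null_seq j m"
    unfolding null_seq_def by (intro mult_left_mono powr_mono2') auto
qed

lemma null_seq_le: "null_seq j m \<le> 1 / 16"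
  using null_seq_antimono[of 0 m j] by (simp add: null_seq_def)

lemma null_seq_summable: "summable (null_seq j)"
proof -
  have "summable (\<lambda>m. real m powr (- (1 + 1 / (real j + 1))))"
    by (subst summable_real_powr_iff) simp
  then have "summable (\<lambda>m. real (m + 1) powr (- (1 + 1 / (real j + 1))))"
    by (subst summable_iff_shift)
  then show ?thesis
    unfolding null_seq_def by (intro summable_mult) (simp add: add.commute)
qed

context fractions
begin

text \<open>
  Leaving the constant \<open>C\<close> in \<open>\<theta> \<le> C / log q\<close> free makes the property invariant under the group.
  Both \<open>C\<close> and \<open>N\<close> range over the natural numbers so that measurability is evident.
\<close>
definition well_approx :: "real \<Rightarrow> bool" where
  "well_approx x \<longleftrightarrow> (\<exists>C::nat. \<forall>N::nat. \<exists>b\<in>L. real N \<le> snd b \<and> approx x b * ln (snd b) \<le> real C)"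

definition finite_small :: "real \<Rightarrow> bool" where
  "finite_small x \<longleftrightarrow> (\<forall>j. finite {b \<in> L. approx x b \<le> null_seq j (rank b)})"

lemma AE_finite_small: "AE x in lborel. 0 < x \<and> x < 1 \<longrightarrow> finite_small x"
proof -
  have "AE x in lborel. \<forall>j. 0 < x \<and> x < 1 \<longrightarrow> finite {b \<in> L. approx x b \<le> null_seq j (rank b)}"
    unfolding AE_all_countable
    by (intro allI AE_finite_small_approx null_seq_summable null_seq_le less_imp_le[OF null_seq_pos])
  then show ?thesis
    by eventually_elim (auto simp: finite_small_def)
qed

context
  fixes x :: real and P :: "(real \<times> real) set"
  assumes irr: "\<And>b. b \<in> L \<Longrightarrow> x \<noteq> val b"
    and P: "P \<subseteq> L" "\<And>b. b \<in> L \<Longrightarrow> approx x b < 1 / 2 \<Longrightarrow> b \<in> P" "\<And>b. b \<in> P \<Longrightarrow> approx x b < 1"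
    and inj: "inj_on (\<lambda>b. \<bar>x - val b\<bar>) P"
begin

lemma approx_pos: "b \<in> L \<Longrightarrow> 0 < approx x b"
  using irr[of b] den_pos[of b] by (simp add: approx_eq)

text \<open>
  The fractions enumerated up to \<open>b\<close>; the index of \<open>b\<close> is the cardinality of this set.
\<close>
definition before :: "real \<times> real \<Rightarrow> (real \<times> real) set" where
  "before b = {a \<in> P. \<bar>x - val b\<bar> \<le> \<bar>x - val a\<bar>}"

text \<open>
  All these fractions have denominator at most \<open>q / sqrt \<theta>\<close>, so their number is logarithmic.
\<close>
lemma card_before:
  assumes b: "b \<in> P"
  shows "finite (before b)"
    "real (card (before b)) \<le> 9 * (2 * ln (snd b) + ln (1 / approx x b) + 2)"
proof -
  define \<theta> where "\<theta> = approx x b"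
  have bL: "b \<in> L" using b P by auto
  have \<theta>: "0 < \<theta>" "\<theta> < 1" using approx_pos[OF bL] P(3)[OF b] by (auto simp: \<theta>_def)
  have q: "1 \<le> snd b" using den_ge_1 bL by simp
  define Q where "Q = snd b / sqrt \<theta>"
  have Q1: "1 \<le> Q"
    using \<theta> q by (simp add: Q_def le_divide_eq order_trans[of "sqrt \<theta>" 1 "snd b"])
  define k where "k = nat \<lceil>log 2 Q\<rceil>"
  have lQ: "0 \<le> log 2 Q" using Q1 by simp
  have "Q = 2 powr log 2 Q" using Q1 by simp
  also have "\<dots> \<le> 2 powr real k" using lQ by (intro powr_mono) (auto simp: k_def)
  finally have Qk: "Q \<le> 2 ^ k" by (simp add: powr_realpow)
  have xb: "\<bar>x - val b\<bar> = \<theta> / (snd b)\<^sup>2" "0 < \<bar>x - val b\<bar>"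
    using q irr[OF bL] by (auto simp: \<theta>_def approx_eq[OF bL])
  have "a \<in> L \<and> snd a \<le> 2 ^ k \<and> approx x a \<le> 1" if "a \<in> before b" for a
  proof -
    have a: "a \<in> L" "approx x a < 1" "\<bar>x - val b\<bar> \<le> \<bar>x - val a\<bar>"
      using that P by (auto simp: before_def)
    have "(snd a)\<^sup>2 * (\<theta> / (snd b)\<^sup>2) \<le> (snd a)\<^sup>2 * \<bar>x - val a\<bar>"
      using a(3) unfolding xb by (rule mult_left_mono) simp
    also have "\<dots> \<le> 1" using a by (simp add: approx_eq)
    finally have "(snd a)\<^sup>2 \<le> (snd b)\<^sup>2 / \<theta>"
      using \<theta> q by (simp add: field_simps)
    also have "\<dots> = Q\<^sup>2" using \<theta> by (simp add: Q_def power_divide)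
    finally have "snd a \<le> Q" by (rule power2_le_imp_le) (use Q1 in simp)
    from this Qk have "snd a \<le> 2 ^ k" by (rule order_trans)
    with a(1,2) show ?thesis by simp
  qed
  from card_dyadic[OF this] have fc: "finite (before b)" "card (before b) \<le> 9 * (k + 1)"
    by auto
  show "finite (before b)" by fact
  have k1: "real k \<le> log 2 Q + 1" using lQ by (simp add: k_def)
  have k2: "log 2 Q \<le> 2 * ln Q"
  proof -
    have "1 / 2 \<le> ln (2::real)" using ln_le_minus_one[of "1 / 2"] by (simp add: ln_div)
    then have "1 / ln 2 \<le> (2::real)" by (simp add: divide_simps)
    then have "(1 / ln 2) * ln Q \<le> 2 * ln Q"
      using Q1 by (intro mult_right_mono) auto
    then show ?thesis by (simp add: log_def)
  qed
  have k3: "2 * ln Q = 2 * ln (snd b) + ln (1 / \<theta>)"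
    using \<theta> q by (simp add: Q_def ln_div ln_sqrt)
  have k0: "real (card (before b)) \<le> 9 * (real k + 1)"
    using of_nat_mono[OF fc(2), where 'a = real] by simp
  show "real (card (before b)) \<le> 9 * (2 * ln (snd b) + ln (1 / approx x b) + 2)"
    using k0 k1 k2 k3 unfolding \<theta>_def distrib_left by linarith
qed

text \<open>
  A longest chain ending in \<open>b\<close> consists of fractions that come no later than \<open>b\<close>.
\<close>
lemma rank_le_card_before:
  assumes b: "b \<in> P" and sm: "approx x b \<le> 1 / 7"
  shows "rank b \<le> card (before b)"
proof -
  have bL: "b \<in> L" using b P by auto
  have q: "0 < snd b" using den_pos bL by simp
  have "(snd b)\<^sup>2 * \<bar>x - val b\<bar> \<le> 1 / 7"
    using sm by (simp add: approx_eq bL)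
  then have "\<bar>x - val b\<bar> * (7 * (snd b)\<^sup>2) \<le> 1"
    by (simp add: mult.commute)
  then have near: "\<bar>x - val b\<bar> \<le> 1 / (7 * (snd b)\<^sup>2)"
    using q by (simp add: pos_le_divide_eq)
  obtain C where C: "finite C" "card C = rank b" "C \<subseteq> L"
    "\<forall>a\<in>C. \<bar>x - val a\<bar> \<le> 1 / (7 * (snd a)\<^sup>2) \<and> \<bar>x - val b\<bar> \<le> \<bar>x - val a\<bar>"
    using chain_approx[OF chain_rank[OF bL] near] by auto
  have "C \<subseteq> before b"
  proof
    fix a assume a: "a \<in> C"
    then have aL: "a \<in> L" using C by auto
    then have qa: "0 < snd a" using den_pos by simp
    have "\<bar>x - val a\<bar> \<le> 1 / (7 * (snd a)\<^sup>2)" using C(4) a by blast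
    then have "\<bar>x - val a\<bar> * (7 * (snd a)\<^sup>2) \<le> 1"
      using qa by (simp add: pos_le_divide_eq)
    then have "approx x a < 1 / 2"
      by (simp add: approx_eq[OF aL] mult.commute)
    with C(4) a P(2)[OF aL] show "a \<in> before b" by (simp add: before_def)
  qed
  then show ?thesis using card_mono[OF card_before(1)[OF b]] C(2) by metis
qed

text \<open>
  In terms of the index \<open>n\<close> of \<open>b\<close>, good approximability means \<open>\<theta>_n \<le> C / n\<close> infinitely often:
  \<open>n\<close> is of the order of \<open>log q + log (1/\<theta>)\<close>, and both terms are \<open>O(1/\<theta>)\<close>.
\<close>
lemma well_approx_infinite:
  assumes "well_approx x"
  obtains C where "0 < C" "\<And>N. \<exists>b\<in>P. N \<le> snd b \<and> real (card (before b)) * approx x b \<le> C"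
proof -
  obtain C :: nat where C: "\<And>N::nat. \<exists>b\<in>L. real N \<le> snd b \<and> approx x b * ln (snd b) \<le> real C"
    using assms by (auto simp: well_approx_def)
  have "\<exists>b\<in>P. N \<le> snd b \<and> real (card (before b)) * approx x b \<le> 9 * (2 * real C + 3)" for N
  proof -
    obtain N' :: nat where N': "max N (exp (2 * real C + 1)) \<le> real N'"
      using real_arch_simple by blast
    obtain b where b: "b \<in> L" "real N' \<le> snd b" "approx x b * ln (snd b) \<le> real C"
      using C by blast
    have q: "exp (2 * real C + 1) \<le> snd b" "N \<le> snd b" using N' b by auto
    have pos: "0 < approx x b" "0 < snd b" using b approx_pos den_pos by auto
    have lnq: "2 * real C + 1 \<le> ln (snd b)"
      using q pos by (simp add: ln_ge_iff)
    then have "approx x b * (2 * real C + 1) \<le> real C"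
      using b(3) pos mult_left_mono[OF lnq, of "approx x b"] by linarith
    then have "approx x b * (2 * real C + 1) < (1 / 2) * (2 * real C + 1)"
      by (simp add: field_simps)
    then have "approx x b < 1 / 2"
      by (simp add: mult_less_cancel_right)
    then have bP: "b \<in> P" using P b by auto
    have th1: "approx x b \<le> 1" using \<open>approx x b < 1 / 2\<close> by simp
    have "ln (1 / approx x b) \<le> 1 / approx x b"
      using ln_le_minus_one[of "1 / approx x b"] pos by simp
    then have l: "ln (1 / approx x b) * approx x b \<le> 1"
      using pos by (simp add: pos_le_divide_eq)
    have "real (card (before b)) * approx x b
        \<le> (9 * (2 * ln (snd b) + ln (1 / approx x b) + 2)) * approx x b"
      using card_before(2)[OF bP] pos by (intro mult_right_mono) auto
    also have "\<dots> = 9 * (2 * (approx x b * ln (snd b)) + ln (1 / approx x b) * approx x b + 2 * approx x b)"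
      by (simp add: algebra_simps)
    also have "\<dots> \<le> 9 * (2 * real C + 1 + 2 * 1)"
      using b(3) l th1 by (intro mult_left_mono add_mono) auto
    finally show ?thesis using bP q by auto
  qed
  then show ?thesis using that[of "9 * (2 * real C + 3)"] by simp
qed

text \<open>
  The index of a fraction dominates its rank, which gives the upper bound; for infinitely many
  indices \<open>\<theta>_n \<le> C / n\<close>, which gives the lower bound.
\<close>
lemma limsup_eq_1:
  assumes well_approx: "well_approx x" and fs: "finite_small x" and f: "\<And>b. b \<in> P \<Longrightarrow> f (time x b) = b"
  shows "limsup (\<lambda>n. ereal (- (ln (approx x (f (nth_elem (time x ` P) n))) / ln (real n)))) = 1"
proof -
  define T where "T = time x ` P"
  obtain C where C: "0 < C" "\<And>N. \<exists>b\<in>P. N \<le> snd b \<and> real (card (before b)) * approx x b \<le> C"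
    using well_approx_infinite[OF well_approx] by blast
  have infP: "infinite P"
  proof
    assume fin: "finite P"
    obtain b where "b \<in> P" "Max (snd ` P) + 1 \<le> snd b" using C(2) by blast
    moreover have "snd b \<le> Max (snd ` P)" using fin \<open>b \<in> P\<close> by simp
    ultimately show False by linarith
  qed
  have time_le: "time x a \<le> time x b \<longleftrightarrow> \<bar>x - val b\<bar> \<le> \<bar>x - val a\<bar>" if "a \<in> P" "b \<in> P" for a b
  proof -
    have "a \<in> L" "b \<in> L" using that P(1) by auto
    then have "x \<noteq> val a" "x \<noteq> val b" using irr by blast+
    then have "0 < \<bar>x - val a\<bar>" "0 < \<bar>x - val b\<bar>" by auto
    then show ?thesis by (simp add: time_def divide_le_eq field_simps)
  qed
  have injT: "inj_on (time x) P"
    using inj time_le unfolding inj_on_def by (metis antisym order_refl)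
  have before_time: "{s \<in> T. s \<le> time x b} = time x ` before b" if "b \<in> P" for b
  proof -
    have "before b = {a \<in> P. time x a \<le> time x b}"
      using time_le[OF _ that] unfolding before_def by blast
    then show ?thesis by (auto simp: T_def)
  qed
  have infT: "infinite T" unfolding T_def using infP injT finite_imageD by blast
  have lf: "finite {s \<in> T. s \<le> t}" for t
  proof -
    obtain b where b: "b \<in> P" "2 * exp t + 1 \<le> snd b" using C(2) by blast
    have bL: "b \<in> L" using b P by auto
    have q: "1 \<le> snd b" using den_ge_1 bL by simp
    have "(snd b)\<^sup>2 * \<bar>x - val b\<bar> < 1" using P(3)[OF b(1)] by (simp add: approx_eq bL)
    moreover have "snd b * \<bar>x - val b\<bar> \<le> (snd b)\<^sup>2 * \<bar>x - val b\<bar>"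
      using q by (intro mult_right_mono) (auto simp: power2_eq_square)
    moreover have "(2 * exp t) * \<bar>x - val b\<bar> \<le> snd b * \<bar>x - val b\<bar>"
      using b by (intro mult_right_mono) auto
    ultimately have e: "2 * exp t * \<bar>x - val b\<bar> < 1" by linarith
    have pos: "0 < \<bar>x - val b\<bar>" using irr bL by simp
    have "exp t \<le> 2 / \<bar>x - val b\<bar>" using e pos by (simp add: pos_le_divide_eq)
    then have "t \<le> time x b" unfolding time_def using pos by (simp add: ln_ge_iff)
    then have "{s \<in> T. s \<le> t} \<subseteq> {s \<in> T. s \<le> time x b}" by auto
    moreover have "finite {s \<in> T. s \<le> time x b}"
      unfolding before_time[OF b(1)] using card_before(1)[OF b(1)] by simp
    ultimately show ?thesis by (rule finite_subset)
  qed
  define c where "c n = f (nth_elem T n)" for n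
  have c: "c n \<in> P \<and> card (before (c n)) = n" if "1 \<le> n" for n
  proof -
    have n: "nth_elem T n \<in> T" "card {s \<in> T. s \<le> nth_elem T n} = n"
      using nth_elem_props[OF infT lf that] by auto
    then obtain b where b: "b \<in> P" "nth_elem T n = time x b" by (auto simp: T_def)
    then have "c n = b" using f by (simp add: c_def)
    moreover have "card (before b) = n"
      using n(2) unfolding b(2) before_time[OF b(1)]
      by (subst (asm) card_image) (auto intro: inj_on_subset[OF injT] simp: before_def)
    ultimately show ?thesis using b by simp
  qed
  have c_eq: "c (card (before b)) = b" if "b \<in> P" for b
  proof -
    have "b \<in> before b" using that by (simp add: before_def)
    then have pos: "1 \<le> card (before b)"
      using card_before(1)[OF that] by (simp add: Suc_le_eq card_gt_0_iff) blast
    define a where "a = c (card (before b))"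
    have a: "a \<in> P" "card (before a) = card (before b)" using c[OF pos] by (auto simp: a_def)
    have "before a = before b"
    proof (cases "\<bar>x - val a\<bar> \<le> \<bar>x - val b\<bar>")
      case True
      then have "before b \<subseteq> before a" by (auto simp: before_def)
      then show ?thesis using a card_before(1)[OF a(1)] by (metis card_subset_eq)
    next
      case False
      then have "before a \<subseteq> before b" by (auto simp: before_def)
      then show ?thesis using a card_before(1)[OF that] by (metis card_subset_eq)
    qed
    then have "a \<in> before b" "b \<in> before a" using a that by (auto simp: before_def)
    then have "\<bar>x - val a\<bar> = \<bar>x - val b\<bar>" by (auto simp: before_def)
    then show ?thesis using inj a that unfolding inj_on_def a_def by blast
  qed
  define X where "X n = ereal (- (ln (approx x (c n)) / ln (real n)))" for n
  have upper: "limsup X \<le> ereal (1 + 1 / (real j + 1))" for j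
  proof -
    define s where "s = 1 + 1 / (real j + 1)"
    define B where "B = {b \<in> L. approx x b \<le> null_seq j (rank b)}"
    have finB: "finite B" using fs by (simp add: finite_small_def B_def)
    have big: "null_seq j n < approx x (c n)" if n: "n \<ge> 1" "n \<notin> (\<lambda>b. card (before b)) ` B" for n
    proof (rule ccontr)
      assume "\<not> ?thesis"
      then have le: "approx x (c n) \<le> null_seq j n" by simp
      have cP: "c n \<in> P" "card (before (c n)) = n" using c n by auto
      have "approx x (c n) \<le> 1 / 7" using le null_seq_le[of j n] by linarith
      then have "rank (c n) \<le> n" using rank_le_card_before[OF cP(1)] cP(2) by simp
      then have "approx x (c n) \<le> null_seq j (rank (c n))"
        using le null_seq_antimono[of "rank (c n)" n j] by linarith
      then have "c n \<in> B" using cP P by (auto simp: B_def)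
      then show False using n(2) cP(2) by (metis imageI)
    qed
    have "finite ((\<lambda>b. card (before b)) ` B)" using finB by simp
    then have ev: "eventually (\<lambda>n. n \<notin> (\<lambda>b. card (before b)) ` B) sequentially"
      by (simp add: eventually_cofinite cofinite_eq_sequentially[symmetric])
    have "eventually (\<lambda>n. X n \<le> ereal ((ln 16 + s * ln (real n + 1)) / ln (real n))) sequentially"
      using ev eventually_ge_at_top[of 2]
    proof eventually_elim
      case (elim n)
      then have b: "null_seq j n < approx x (c n)" using big by auto
      have "ln (null_seq j n) < ln (approx x (c n))"
        using b null_seq_pos[of j n] by simp
      moreover have "ln (null_seq j n) = - ln 16 - s * ln (real n + 1)"
        by (simp add: null_seq_def s_def ln_mult ln_div ln_powr ring_distribs)
      ultimately have "- ln (approx x (c n)) \<le> ln 16 + s * ln (real n + 1)" by linarith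
      moreover have "0 < ln (real n)" using elim by simp
      ultimately have "- ln (approx x (c n)) / ln (real n) \<le> (ln 16 + s * ln (real n + 1)) / ln (real n)"
        by (intro divide_right_mono) auto
      then show ?case by (simp add: X_def)
    qed
    then have "limsup X \<le> limsup (\<lambda>n. ereal ((ln 16 + s * ln (real n + 1)) / ln (real n)))"
      by (rule Limsup_mono)
    also have "(\<lambda>n. (ln 16 + s * ln (real n + 1)) / ln (real n)) \<longlonglongrightarrow> s"
      by real_asymp
    then have "limsup (\<lambda>n. ereal ((ln 16 + s * ln (real n + 1)) / ln (real n))) = ereal s"
      by (intro lim_imp_Limsup) auto
    finally show ?thesis by (simp add: s_def)
  qed
  have "limsup X \<le> 1"
  proof (rule tendsto_lowerbound)
    show "(\<lambda>j. ereal (1 + 1 / (real j + 1))) \<longlonglongrightarrow> 1"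
      unfolding one_ereal_def by (intro tendsto_intros tendsto_ereal) real_asymp
  qed (use upper in auto)
  moreover have "1 \<le> limsup X"
  proof (rule ccontr)
    assume "\<not> ?thesis"
    then have "limsup X < 1" by simp
    then obtain r where r: "limsup X < ereal r" "ereal r < 1"
      using ereal_dense2 by blast
    have ev1: "eventually (\<lambda>n. X n < ereal r) sequentially"
      using Limsup_lessD[OF r(1)] .
    have "(\<lambda>n. (ln (real n) - ln C) / ln (real n)) \<longlonglongrightarrow> 1"
      by real_asymp
    then have ev2: "eventually (\<lambda>n. r < (ln (real n) - ln C) / ln (real n)) sequentially"
      using r(2) by (intro order_tendstoD) (auto simp: one_ereal_def)
    obtain n0 where n0: "\<And>n. n \<ge> n0 \<Longrightarrow> X n < ereal r \<and> r < (ln (real n) - ln C) / ln (real n) \<and> 2 \<le> n"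
      using eventually_conj[OF ev1 eventually_conj[OF ev2 eventually_ge_at_top[of 2]]]
      by (auto simp: eventually_sequentially)
    obtain b where b: "b \<in> P" "Max (insert 0 (snd ` c ` {..n0})) + 1 \<le> snd b"
      "real (card (before b)) * approx x b \<le> C"
      using C(2) by blast
    define n where "n = card (before b)"
    have cn: "c n = b" using c_eq[OF b(1)] by (simp add: n_def)
    have "n0 \<le> n"
    proof (rule ccontr)
      assume "\<not> ?thesis"
      then have "snd b \<in> snd ` c ` {..n0}" using cn by (intro image_eqI[of _ _ "c n"]) auto
      then have "snd b \<le> Max (insert 0 (snd ` c ` {..n0}))" by (intro Max_ge) auto
      with b(2) show False by linarith
    qed
    then have n: "X n < ereal r" "r < (ln (real n) - ln C) / ln (real n)" "2 \<le> n"
      using n0 by auto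
    have pos: "0 < approx x b" using b(1) P(1) by (intro approx_pos) auto
    have "approx x b \<le> C / real n" using b(3) n(3) by (simp add: n_def pos_le_divide_eq mult.commute)
    then have "ln (approx x b) \<le> ln (C / real n)" using pos C(1) n(3) by (intro ln_mono) auto
    also have "\<dots> = ln C - ln (real n)" using C(1) n(3) by (simp add: ln_div)
    finally have "ln (real n) - ln C \<le> - ln (approx x b)" by simp
    then have "(ln (real n) - ln C) / ln (real n) \<le> - ln (approx x b) / ln (real n)"
      using n(3) by (intro divide_right_mono) auto
    then have "ereal r < X n" using n(2) by (simp add: X_def cn)
    with n(1) show False by simp
  qed
  ultimately show ?thesis unfolding X_def c_def T_def by simp
qed

end

end

section \<open>Invariance of the hyperbolic area\<close>

lemma act_eq: "act A z = (of_real (A$1$1) * z + of_real (A$1$2)) / (of_real (A$2$1) * z + of_real (A$2$2))"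
  by (simp add: act_def moebius_def)

lemma denom_nz:
  assumes "unimodular A" "0 < Im z"
  shows "of_real (A$2$1) * z + of_real (A$2$2) \<noteq> 0"
proof
  assume "of_real (A$2$1) * z + of_real (A$2$2) = 0"
  then have "Im (of_real (A$2$1) * z + of_real (A$2$2)) = 0" "Re (of_real (A$2$1) * z + of_real (A$2$2)) = 0"
    by simp_all
  then show False using assms by auto
qed

lemma Im_act:
  assumes "unimodular A" "0 < Im z"
  shows "Im (act A z) = Im z / (cmod (of_real (A$2$1) * z + of_real (A$2$2)))\<^sup>2"
proof -
  define n w where "n = of_real (A$1$1) * z + of_real (A$1$2)" and "w = of_real (A$2$1) * z + of_real (A$2$2)"
  have "Im (act A z) = (Im n * Re w - Re n * Im w) / (cmod w)\<^sup>2"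
    unfolding act_eq n_def[symmetric] w_def[symmetric] by (simp add: Im_divide cmod_power2)
  also have "Im n * Re w - Re n * Im w = (A$1$1 * A$2$2 - A$1$2 * A$2$1) * Im z"
    by (simp add: n_def w_def algebra_simps)
  finally show ?thesis using assms by (simp add: w_def)
qed

lemma Im_act_pos:
  assumes "unimodular A" "0 < Im z"
  shows "0 < Im (act A z)"
  unfolding Im_act[OF assms] using assms denom_nz[OF assms] by simp

lemma act_mult:
  assumes "unimodular B" "0 < Im z"
  shows "act (A ** B) z = act A (act B z)"
proof -
  define w where "w = of_real (B$2$1) * z + of_real (B$2$2)"
  have w: "w \<noteq> 0" using denom_nz[OF assms] by (simp add: w_def)
  define n where "n = of_real (B$1$1) * z + of_real (B$1$2)"
  have "act A (act B z) = (of_real (A$1$1) * (n / w) + of_real (A$1$2)) / (of_real (A$2$1) * (n / w) + of_real (A$2$2))"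
    by (simp add: act_eq n_def w_def)
  also have "\<dots> = ((of_real (A$1$1) * n + of_real (A$1$2) * w) / w) / ((of_real (A$2$1) * n + of_real (A$2$2) * w) / w)"
    using w by (simp add: add_divide_distrib)
  also have "\<dots> = (of_real (A$1$1) * n + of_real (A$1$2) * w) / (of_real (A$2$1) * n + of_real (A$2$2) * w)"
    using w by simp
  also have "\<dots> = act (A ** B) z"
    by (simp add: act_eq n_def w_def algebra_simps)
  finally show ?thesis by simp
qed

lemma act_one [simp]: "act (mat 1) z = z"
  by (simp add: act_eq)

lemma act_uminus: "act (- A) z = act A z"
proof -
  have "act (- A) z = (- (of_real (A$1$1) * z + of_real (A$1$2))) / (- (of_real (A$2$1) * z + of_real (A$2$2)))"
    by (simp add: act_eq)
  also have "\<dots> = act A z" unfolding minus_divide_divide act_eq ..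
  finally show ?thesis .
qed

lemma act_inv2:
  assumes "unimodular A" "0 < Im z"
  shows "act (inv2 A) (act A z) = z" "act A (act (inv2 A) z) = z"
proof -
  have d: "det A = 1" using assms det_entries by metis
  have i: "unimodular (inv2 A)" using assms by (simp add: algebra_simps)
  show "act (inv2 A) (act A z) = z" using act_mult[OF assms, of "inv2 A"] d by (simp add: inv2_mult)
  show "act A (act (inv2 A) z) = z" using act_mult[OF i assms(2), of A] d by (simp add: inv2_mult)
qed

lemma has_field_derivative_act:
  assumes "unimodular A" "0 < Im z"
  shows "(act A has_field_derivative 1 / (of_real (A$2$1) * z + of_real (A$2$2))\<^sup>2) (at z)"
proof -
  define w where "w = of_real (A$2$1) * z + of_real (A$2$2)"
  have w: "of_real (A$2$1) * z + of_real (A$2$2) \<noteq> 0" using denom_nz[OF assms] .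
  have c: "complex_of_real (A$1$1) * of_real (A$2$2) - of_real (A$1$2) * of_real (A$2$1) = 1"
    using assms(1) by (metis of_real_1 of_real_diff of_real_mult)
  have "((\<lambda>z. (of_real (A$1$1) * z + of_real (A$1$2)) / (of_real (A$2$1) * z + of_real (A$2$2)))
    has_field_derivative (of_real (A$1$1) * (of_real (A$2$1) * z + of_real (A$2$2)) -
      (of_real (A$1$1) * z + of_real (A$1$2)) * of_real (A$2$1)) /
      ((of_real (A$2$1) * z + of_real (A$2$2)) * (of_real (A$2$1) * z + of_real (A$2$2)))) (at z)"
    using w by (auto intro!: derivative_eq_intros)
  also have "of_real (A$1$1) * (of_real (A$2$1) * z + of_real (A$2$2)) -
      (of_real (A$1$1) * z + of_real (A$1$2)) * of_real (A$2$1) = (1::complex)"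
    using c by (simp add: algebra_simps)
  finally show ?thesis by (simp add: act_eq[abs_def] power2_eq_square)
qed

text \<open>
  The change of variables theorem for integrals concerns \<open>real^2\<close>; these two maps carry it over
  to the complex plane.
\<close>
definition to_c :: "real^2 \<Rightarrow> complex" where
  "to_c v = Complex (v$1) (v$2)"

definition of_c :: "complex \<Rightarrow> real^2" where
  "of_c z = vector [Re z, Im z]"

lemma of_c_entries [simp]: "of_c z $ 1 = Re z" "of_c z $ 2 = Im z"
  by (simp_all add: of_c_def)

lemma to_of_c [simp]: "to_c (of_c z) = z" "of_c (to_c v) = v"
  by (simp_all add: to_c_def vec_eq_iff forall_2)

lemma Re_to_c [simp]: "Re (to_c v) = v$1" "Im (to_c v) = v$2"
  by (simp_all add: to_c_def)

lemma linear_to_c: "bounded_linear to_c"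
  by (rule linear_conv_bounded_linear[THEN iffD1], rule linearI) (auto simp: to_c_def complex_eq_iff)

lemma linear_of_c: "bounded_linear of_c"
  by (rule linear_conv_bounded_linear[THEN iffD1], rule linearI) (auto simp: vec_eq_iff forall_2)

lemma to_c_measurable [measurable]: "to_c \<in> borel_measurable borel"
  by (intro borel_measurable_continuous_onI linear_continuous_on linear_to_c)

lemma lborel_to_c: "(lborel :: complex measure) = distr lborel borel to_c"
proof (rule lborel_eqI)
  fix l u :: complex assume le: "\<And>b. b \<in> Basis \<Longrightarrow> l \<bullet> b \<le> u \<bullet> b"
  have "to_c -` box l u = box (of_c l) (of_c u)"
    by (auto simp: box_def Basis_complex_def inner_complex_def Basis_vec_def inner_axis UNIV_2 forall_2)
  then have "emeasure (distr lborel borel to_c) (box l u) = emeasure lborel (box (of_c l) (of_c u))"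
    by (simp add: emeasure_distr)
  also have "\<dots> = (\<Prod>b\<in>Basis. (of_c u - of_c l) \<bullet> b)"
    using le[of 1] le[of \<i>]
    by (intro emeasure_lborel_box) (auto simp: Basis_complex_def inner_complex_def Basis_vec_def inner_axis UNIV_2)
  also have "(\<Prod>b\<in>Basis. (of_c u - of_c l) \<bullet> b) = (\<Prod>b\<in>Basis. (u - l) \<bullet> b)"
    by (simp add: Basis_complex_def inner_complex_def Basis_vec_def inner_axis UNIV_2 axis_eq_axis)
  finally show "emeasure (distr lborel borel to_c) (box l u) = (\<Prod>b\<in>Basis. (u - l) \<bullet> b)" by simp
qed simp

lemma emeasure_harea:
  assumes S: "S \<in> sets borel" "S \<subseteq> halfplane"
  shows "emeasure harea S = (\<integral>\<^sup>+v. ennreal (indicator (to_c -` S) v / (v$2)\<^sup>2) \<partial>lborel)"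
proof -
  have hp [measurable]: "halfplane \<in> sets borel"
    unfolding halfplane_def by measurable
  have "emeasure harea S = (\<integral>\<^sup>+z. ennreal (indicator halfplane z / (Im z)\<^sup>2) * indicator S z \<partial>lborel)"
    unfolding harea_def by (rule emeasure_density) (use S in auto)
  also have "\<dots> = (\<integral>\<^sup>+z. ennreal (indicator S z / (Im z)\<^sup>2) \<partial>lborel)"
    using S(2) by (intro nn_integral_cong) (auto split: split_indicator)
  also have "\<dots> = (\<integral>\<^sup>+v. ennreal (indicator S (to_c v) / (Im (to_c v))\<^sup>2) \<partial>lborel)"
    unfolding lborel_to_c using S by (subst nn_integral_distr) auto
  finally show ?thesis by (simp add: indicator_def)
qed

lemma act_measurable [measurable]: "act A \<in> borel_measurable borel"
  unfolding act_eq[abs_def] by measurable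

lemma act_image_eq:
  assumes "unimodular A" "S \<subseteq> halfplane"
  shows "act A ` S = halfplane \<inter> act (inv2 A) -` S"
  using act_inv2[OF assms(1)] Im_act_pos[OF assms(1)] assms(2)
  by (auto simp: halfplane_def image_iff) (metis subsetD mem_Collect_eq)

text \<open>
  The Jacobian of the Moebius transformation is \<open>1 / \<bar>c z + d\<bar>\<^sup>4\<close>, and \<open>(Im z)\<^sup>2\<close> changes by the
  same factor.
\<close>
lemma harea_act:
  assumes A: "unimodular A" and S: "S \<in> sets borel" "S \<subseteq> halfplane"
    and fin: "emeasure harea S < \<infinity>"
  shows "act A ` S \<in> sets borel" "emeasure harea (act A ` S) = emeasure harea S"
proof -
  have hp: "halfplane \<in> sets borel"
    unfolding halfplane_def by measurable
  show bor: "act A ` S \<in> sets borel"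
    unfolding act_image_eq[OF A S(2)] using hp S(1) measurable_sets_borel[OF act_measurable S(1)] by auto
  have sub: "act A ` S \<subseteq> halfplane"
    unfolding act_image_eq[OF A S(2)] by auto
  define S' where "S' = to_c -` S"
  have S'[measurable]: "S' \<in> sets borel" unfolding S'_def by (rule measurable_sets_borel[OF to_c_measurable S(1)])
  have pos: "0 < v$2" if "v \<in> S'" for v
    using that S(2) by (auto simp: S'_def halfplane_def)
  define g where "g v = of_c (act A (to_c v))" for v
  have img: "to_c -` (act A ` S) = g ` S'"
  proof (intro subset_antisym subsetI)
    fix v assume "v \<in> to_c -` (act A ` S)"
    then obtain z where z: "z \<in> S" "to_c v = act A z" by auto
    then have "v = g (of_c z)" unfolding g_def by (metis to_of_c)
    moreover have "of_c z \<in> S'" using z by (simp add: S'_def)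
    ultimately show "v \<in> g ` S'" by blast
  qed (auto simp: g_def S'_def)
  define D where "D v = 1 / (of_real (A$2$1) * to_c v + of_real (A$2$2))\<^sup>2" for v
  define g' where "g' v h = of_c (D v * to_c h)" for v h
  have der: "(g has_derivative g' v) (at v within S')" if "v \<in> S'" for v
  proof -
    have p: "0 < Im (to_c v)" using pos[OF that] by simp
    have "(act A has_derivative (\<lambda>h. D v * h)) (at (to_c v))"
      using has_field_derivative_act[OF A p] unfolding has_field_derivative_def D_def .
    then have "((\<lambda>v. act A (to_c v)) has_derivative (\<lambda>h. D v * to_c h)) (at v)"
      by (rule has_derivative_compose[rotated]) (rule bounded_linear_imp_has_derivative[OF linear_to_c])
    then have "((\<lambda>v. of_c (act A (to_c v))) has_derivative (\<lambda>h. of_c (D v * to_c h))) (at v)"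
      by (rule bounded_linear.has_derivative[OF linear_of_c])
    then show ?thesis unfolding g_def g'_def by (rule has_derivative_at_withinI)
  qed
  have inj: "inj_on g S'"
  proof (rule inj_onI)
    fix v w assume vw: "v \<in> S'" "w \<in> S'" "g v = g w"
    then have "act A (to_c v) = act A (to_c w)" unfolding g_def by (metis to_of_c(1))
    then have "to_c v = to_c w"
      using act_inv2(1)[OF A, of "to_c v"] act_inv2(1)[OF A, of "to_c w"] pos vw by (metis Re_to_c(2))
    then show "v = w" by (metis to_of_c(2))
  qed
  have det: "\<bar>det (matrix (g' v))\<bar> = (cmod (D v))\<^sup>2" for v
    by (simp add: det_2 matrix_def g'_def cmod_power2 to_c_def axis_def power2_eq_square[symmetric])
  define f :: "real^2 \<Rightarrow> real^1" where "f v = vec (1 / (v$2)\<^sup>2)" for v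
  have Im_g: "(cmod (D v))\<^sup>2 / (g v $ 2)\<^sup>2 = 1 / (v$2)\<^sup>2" if "v \<in> S'" for v
  proof -
    have p: "0 < Im (to_c v)" using pos[OF that] by simp
    show ?thesis
      using denom_nz[OF A p] pos[OF that] unfolding g_def D_def
      by (simp add: Im_act[OF A p] norm_divide norm_power field_simps)
  qed
  define h :: "real^2 \<Rightarrow> real" where "h v = 1 / (v$2)\<^sup>2" for v
  define c where "c = integral S' h"
  have S'_eq: "emeasure harea S = (\<integral>\<^sup>+v. ennreal (indicator S' v * h v) \<partial>lborel)"
    unfolding emeasure_harea[OF S] S'_def[symmetric] by (simp add: h_def)
  have hm [measurable]: "h \<in> borel_measurable borel"
    unfolding h_def by measurable
  have int: "integrable lborel (\<lambda>v. indicator S' v * h v)"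
    by (rule integrableI_nonneg) (use fin S'_eq in \<open>auto simp: h_def\<close>)
  have abs: "h absolutely_integrable_on S'"
    unfolding set_integrable_def using integrable_completion[of "\<lambda>v. indicator S' v * h v" lborel] int by simp
  have c: "emeasure harea S = ennreal c"
    unfolding S'_eq c_def
    using nn_integral_has_integral_lebesgue[OF _ integrable_integral, of S' h] abs
    by (auto simp: h_def set_lebesgue_integral_eq_integral(1))
  have cov: "(\<lambda>x. \<bar>det (matrix (g' x))\<bar> *\<^sub>R f (g x)) absolutely_integrable_on S' \<and>
           integral S' (\<lambda>x. \<bar>det (matrix (g' x))\<bar> *\<^sub>R f(g x)) = vec c
     \<longleftrightarrow> f absolutely_integrable_on (g ` S') \<and> integral (g ` S') f = vec c"
    by (rule has_absolute_integral_change_of_variables) (use der inj in auto)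
  have eq: "(\<bar>det (matrix (g' v))\<bar> *\<^sub>R f (g v)) $ 1 = h v" if "v \<in> S'" for v
    using Im_g[OF that] by (simp add: det f_def h_def)
  have "(\<lambda>v. (\<bar>det (matrix (g' v))\<bar> *\<^sub>R f (g v)) $ 1) absolutely_integrable_on S'"
    using abs eq by (subst set_integrable_cong[OF refl refl eq]) auto
  moreover have "integral S' (\<lambda>v. (\<bar>det (matrix (g' v))\<bar> *\<^sub>R f (g v)) $ 1) = c"
    unfolding c_def using eq by (rule Henstock_Kurzweil_Integration.integral_cong)
  ultimately have "f absolutely_integrable_on (g ` S') \<and> integral (g ` S') f = vec c"
    by (intro iffD1[OF cov] conjI) (simp_all only: absolutely_integrable_on_1_iff integral_on_1_eq)
  moreover have "(\<lambda>v. f v $ 1) = h" by (simp add: f_def h_def fun_eq_iff)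
  ultimately have fin2: "h absolutely_integrable_on (g ` S')" "integral (g ` S') h = c"
    unfolding absolutely_integrable_on_1_iff integral_on_1_eq by (simp_all add: vec_eq_iff)
  have "emeasure harea (act A ` S) = (\<integral>\<^sup>+v. ennreal (indicator (g ` S') v * h v) \<partial>lborel)"
    unfolding emeasure_harea[OF bor sub] img by (simp add: h_def)
  also have "\<dots> = ennreal c"
    using nn_integral_has_integral_lebesgue[OF _ integrable_integral, of "g ` S'" h] fin2
    by (auto simp: h_def set_lebesgue_integral_eq_integral(1))
  finally show "emeasure harea (act A ` S) = emeasure harea S"
    using c by simp
qed

section \<open>Columns of matrices as fractions\<close>

text \<open>
  Vectors in a disc of area proportional to \<open>R\<close> with pairwise determinants at least \<open>1\<close> have
  directions separated by \<open>1/R\<close>. The slopes \<open>f/g\<close> and \<open>g/f\<close> serve as coordinates on the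
  directions closer to one axis and to the other.
\<close>
lemma card_pairwise_det:
  fixes f g :: "'a \<Rightarrow> real"
  assumes R: "0 < R"
    and S: "\<And>u. u \<in> S \<Longrightarrow> (f u)\<^sup>2 + (g u)\<^sup>2 \<le> R \<and> (f u \<noteq> 0 \<or> g u \<noteq> 0)"
    and det: "\<And>u v. u \<in> S \<Longrightarrow> v \<in> S \<Longrightarrow> u \<noteq> v \<Longrightarrow> 1 \<le> \<bar>f u * g v - f v * g u\<bar>"
  shows "finite S" "real (card S) \<le> 4 * R + 2"
proof -
  have half: "finite S' \<and> real (card S') \<le> 2 * R + 1"
    if S': "\<And>u. u \<in> S' \<Longrightarrow> (f u)\<^sup>2 + (g u)\<^sup>2 \<le> R \<and> g u \<noteq> 0 \<and> \<bar>f u\<bar> \<le> \<bar>g u\<bar>"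
      and d: "\<And>u v. u \<in> S' \<Longrightarrow> v \<in> S' \<Longrightarrow> u \<noteq> v \<Longrightarrow> 1 \<le> \<bar>f u * g v - f v * g u\<bar>"
    for S' and f g :: "'a \<Rightarrow> real"
  proof -
    have sp: "1 / R \<le> \<bar>f u / g u - f v / g v\<bar>" if uv: "u \<in> S'" "v \<in> S'" "u \<noteq> v" for u v
    proof -
      have nz: "g u \<noteq> 0" "g v \<noteq> 0" using S' uv by auto
      have "(g u)\<^sup>2 \<le> R" "(g v)\<^sup>2 \<le> R"
        using S'[OF uv(1)] S'[OF uv(2)] zero_le_power2[of "f u"] zero_le_power2[of "f v"] by linarith+
      moreover have "2 * (\<bar>g u\<bar> * \<bar>g v\<bar>) \<le> (g u)\<^sup>2 + (g v)\<^sup>2"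
        using zero_le_power2[of "\<bar>g u\<bar> - \<bar>g v\<bar>"] by (simp add: power2_diff)
      ultimately have gg: "\<bar>g u\<bar> * \<bar>g v\<bar> \<le> R" by linarith
      have "1 / R \<le> 1 / (\<bar>g u\<bar> * \<bar>g v\<bar>)"
        using gg nz R by (intro divide_left_mono) auto
      also have "\<dots> \<le> \<bar>f u * g v - f v * g u\<bar> / (\<bar>g u\<bar> * \<bar>g v\<bar>)"
        using d[OF uv] by (intro divide_right_mono) auto
      also have "\<dots> = \<bar>f u / g u - f v / g v\<bar>"
        using nz by (simp add: diff_frac_eq abs_divide abs_mult)
      finally show ?thesis .
    qed
    have im: "-1 \<le> f u / g u \<and> f u / g u \<le> 1" if "u \<in> S'" for u
    proof -
      have "\<bar>f u / g u\<bar> \<le> 1" using S'[OF that] by (simp add: abs_divide)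
      then show ?thesis by linarith
    qed
    have R': "0 < 1 / R" using R by simp
    have "finite S'" by (rule spaced_card(1)[OF R' _ sp im]) auto
    moreover have "real (card S') \<le> (1 - (-1)) / (1 / R) + 1"
      by (rule spaced_card(2)[OF R' _ sp im]) auto
    ultimately show ?thesis by simp
  qed
  define S1 where "S1 = {u \<in> S. \<bar>f u\<bar> \<le> \<bar>g u\<bar>}"
  define S2 where "S2 = {u \<in> S. \<bar>g u\<bar> < \<bar>f u\<bar>}"
  have 1: "finite S1 \<and> real (card S1) \<le> 2 * R + 1"
  proof (rule half[of S1 f g])
    show "(f u)\<^sup>2 + (g u)\<^sup>2 \<le> R \<and> g u \<noteq> 0 \<and> \<bar>f u\<bar> \<le> \<bar>g u\<bar>" if "u \<in> S1" for u
      using S[of u] that by (auto simp: S1_def)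
  qed (use det in \<open>auto simp: S1_def\<close>)
  have 2: "finite S2 \<and> real (card S2) \<le> 2 * R + 1"
  proof (rule half[of S2 g f])
    show "(g u)\<^sup>2 + (f u)\<^sup>2 \<le> R \<and> f u \<noteq> 0 \<and> \<bar>g u\<bar> \<le> \<bar>f u\<bar>" if "u \<in> S2" for u
      using S[of u] that by (auto simp: S2_def add.commute)
    show "1 \<le> \<bar>g u * f v - g v * f u\<bar>" if "u \<in> S2" "v \<in> S2" "u \<noteq> v" for u v
      using det[of v u] that by (auto simp: S2_def mult.commute)
  qed
  have eq: "S = S1 \<union> S2" by (auto simp: S1_def S2_def)
  show "finite S" unfolding eq using 1 2 by simp
  have "card S \<le> card S1 + card S2" unfolding eq by (rule card_Un_le)
  then have "real (card S) \<le> real (card S1) + real (card S2)" by linarith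
  then show "real (card S) \<le> 4 * R + 2" using 1 2 by linarith
qed

context zonal
begin

definition L :: "(real \<times> real) set" where
  "L = {(A$1$1, A$2$1) | A. A \<in> M \<and> 0 < A$2$1}"

lemma L_iff: "b \<in> L \<longleftrightarrow> (\<exists>A\<in>M. A$1$1 = fst b \<and> A$2$1 = snd b) \<and> 0 < snd b"
  by (force simp: L_def prod_eq_iff)

text \<open>
  Matrices with parallel first columns send infinity to the same point; so they differ by an element
  of the stabiliser of infinity.
\<close>
lemma same_column:
  assumes A: "A \<in> M" and B: "B \<in> M" and 0: "A$1$1 * B$2$1 - B$1$1 * A$2$1 = 0"
  shows "\<exists>n. B = A ** transl n \<or> B = - (A ** transl n)"
proof -
  define U where "U = inv2 A ** B"
  have "U \<in> M" unfolding U_def by (intro M_mult M_inv A B)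
  moreover have "U$2$1 = 0" using 0 by (simp add: U_def algebra_simps)
  ultimately obtain n where "U = transl n \<or> U = - transl n" using M_upper_triangular by blast
  moreover have "B = A ** U"
    using A by (simp add: U_def matrix_mul_assoc inv2_mult M_iff)
  ultimately show ?thesis by (auto simp: minus_mult_mat)
qed

sublocale fractions L
proof
  fix b assume "b \<in> L"
  then show "1 \<le> snd b"
    using shimizu by (fastforce simp: L_iff)
next
  fix a b assume a: "a \<in> L" and b: "b \<in> L" and ne: "a \<noteq> b"
  obtain A B where A: "A \<in> M" "A$1$1 = fst a" "A$2$1 = snd a"
    and B: "B \<in> M" "B$1$1 = fst b" "B$2$1 = snd b"
    using a b by (auto simp: L_iff)
  have "fst a * snd b - fst b * snd a \<noteq> 0"
  proof
    assume "fst a * snd b - fst b * snd a = 0"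
    then obtain n where n: "B = A ** transl n \<or> B = - (A ** transl n)"
      using same_column[OF A(1) B(1)] A B by auto
    then have "(fst b = fst a \<and> snd b = snd a) \<or> (fst b = - fst a \<and> snd b = - snd a)"
      unfolding A(2,3)[symmetric] B(2,3)[symmetric] by (auto simp: transl_def)
    with a b ne show False by (auto simp: L_iff prod_eq_iff)
  qed
  moreover have "(inv2 A ** B) $2$1 = fst a * snd b - fst b * snd a"
    by (simp add: A B algebra_simps)
  ultimately show "1 \<le> \<bar>fst a * snd b - fst b * snd a\<bar>"
    using shimizu[of "inv2 A ** B"] M_mult[OF M_inv[OF A(1)] B(1)] by simp
qed

lemma L_shift: "b \<in> L \<Longrightarrow> (fst b + of_int n * snd b, snd b) \<in> L"
proof -
  assume "b \<in> L"
  then obtain A where A: "A \<in> M" "A$1$1 = fst b" "A$2$1 = snd b" "0 < snd b"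
    by (auto simp: L_iff)
  have "transl n ** A \<in> M" by (intro M_mult M_transl A)
  then show ?thesis
    using A unfolding L_iff by (intro conjI bexI[of _ "transl n ** A"]) (auto simp: transl_def)
qed

text \<open>
  The fractions \<open>(p, q)\<close> for which the matrix with bottom row \<open>(-q, p)\<close> moves \<open>z\<close> to height at
  least \<open>1/R\<close>.
\<close>
definition near :: "complex \<Rightarrow> real \<Rightarrow> (real \<times> real) set" where
  "near z R = {b \<in> L. (cmod (of_real (fst b) - of_real (snd b) * z))\<^sup>2 \<le> R * Im z}"

text \<open>
  The bound is uniform in \<open>z\<close>, because the linear change of coordinates attached to \<open>z\<close> preserves
  determinants. This uniformity is what prevents the counting function from concentrating
  near the cusps of the surface.
\<close>
lemma card_near_point:
  assumes z: "0 < Im z" and R: "0 < R"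
  shows "finite (near z R)" "real (card (near z R)) \<le> 4 * R + 2"
proof -
  define s where "s = sqrt (Im z)"
  have s: "0 < s" "s * s = Im z" using z by (auto simp: s_def)
  define f where "f b = (fst b - snd b * Re z) / s" for b :: "real \<times> real"
  define g where "g b = snd b * s" for b :: "real \<times> real"
  have fg: "(f b)\<^sup>2 + (g b)\<^sup>2 \<le> R \<and> (f b \<noteq> 0 \<or> g b \<noteq> 0)" if "b \<in> near z R" for b
  proof -
    have b: "b \<in> L" "(cmod (of_real (fst b) - of_real (snd b) * z))\<^sup>2 \<le> R * Im z" using that by (auto simp: near_def)
    have "(cmod (of_real (fst b) - of_real (snd b) * z))\<^sup>2 = (f b * s)\<^sup>2 + (g b * s)\<^sup>2"
    proof -
      have "f b * s = fst b - snd b * Re z" "g b * s = snd b * Im z"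
        using s by (auto simp: f_def g_def)
      then show ?thesis by (simp add: cmod_power2)
    qed
    also have "\<dots> = ((f b)\<^sup>2 + (g b)\<^sup>2) * Im z"
      unfolding s(2)[symmetric] by (simp add: power2_eq_square algebra_simps)
    finally have "(f b)\<^sup>2 + (g b)\<^sup>2 \<le> R" using b(2) z by simp
    moreover have "g b \<noteq> 0" using den_pos[OF b(1)] s by (simp add: g_def)
    ultimately show ?thesis by simp
  qed
  have det: "1 \<le> \<bar>f u * g v - f v * g u\<bar>" if "u \<in> near z R" "v \<in> near z R" "u \<noteq> v" for u v
  proof -
    have "f u * g v - f v * g u = fst u * snd v - fst v * snd u"
      using s by (simp add: f_def g_def field_simps)
    then show ?thesis using det_ge_1[of u v] that by (simp add: near_def)
  qed
  show "finite (near z R)" "real (card (near z R)) \<le> 4 * R + 2"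
    by (rule card_pairwise_det[OF R fg det]; assumption)+
qed

section \<open>Unfolding over a fundamental set\<close>

text \<open>
  One of the two matrices \<open>A\<close> and \<open>- A\<close> for each element of the group, chosen such that
  \<open>(A$2$2, - A$2$1)\<close> is in \<open>L\<close> or \<open>A\<close> is a translation.
\<close>
definition reps :: "(real^2^2) set" where
  "reps = {A \<in> M. A$2$1 < 0 \<or> (A$2$1 = 0 \<and> A$1$1 = 1)}"

definition strip :: "real \<Rightarrow> complex set" where
  "strip R = {z. 0 \<le> Re z \<and> Re z < 1 \<and> 1 / R < Im z \<and> Im z < 2 / R}"

lemma act_transl: "act (transl n) z = z + of_int n"
  by (simp add: act_eq transl_def)

lemma act_transl_mult: "A \<in> M \<Longrightarrow> 0 < Im z \<Longrightarrow> act (transl n ** A) z = act A z + of_int n"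
  using det_M by (simp add: act_mult act_transl)

definition visits :: "complex \<Rightarrow> real \<Rightarrow> (real^2^2) set" where
  "visits w R = {A \<in> reps. act A w \<in> strip R}"

text \<open>
  Matrices with the same bottom row differ by an integer translation, and only one of them moves
  \<open>w\<close> into the strip of width \<open>1\<close>. The summand \<open>1\<close> accounts for the translations.
\<close>
lemma card_strip:
  assumes w: "0 < Im w" and R: "1 \<le> R"
  defines "S \<equiv> visits w R"
    and "W \<equiv> near w R"
  shows "finite S" "card S \<le> card W + 1"
proof -
  define S1 S2 where "S1 = {A \<in> S. A$2$1 < 0}" and "S2 = {A \<in> S. A$2$1 = 0}"
  have eq: "S = S1 \<union> S2" by (auto simp: S_def visits_def S1_def S2_def reps_def)
  define k where "k A = (A$2$2, - A$2$1)" for A :: "real^2^2"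
  have finW: "finite W"
    unfolding W_def by (rule card_near_point(1)[OF w]) (use R in simp)
  have same: "n = 0" if "act A w + of_int n \<in> strip R" "act A w \<in> strip R" for A n
    using that by (auto simp: strip_def)
  have inj: "inj_on k S1"
  proof (rule inj_onI)
    fix A B assume AB: "A \<in> S1" "B \<in> S1" "k A = k B"
    have m: "A \<in> M" "B \<in> M" "act A w \<in> strip R" "act B w \<in> strip R"
      using AB by (auto simp: S1_def S_def visits_def reps_def)
    have e: "A$2$2 = B$2$2" "A$2$1 = B$2$1" using AB by (auto simp: k_def)
    obtain n where B: "B = transl n ** A" using same_bottom_row[OF m(1,2) e(2,1)] by blast
    then have "n = 0" using same[of A n] m act_transl_mult[OF m(1) w] by simp
    then show "A = B" using B by (auto intro!: mat2_eqI simp: transl_def)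
  qed
  have "k ` S1 \<subseteq> W"
  proof
    fix b assume "b \<in> k ` S1"
    then obtain A where A: "A \<in> M" "A$2$1 < 0" "act A w \<in> strip R" "b = k A"
      by (auto simp: S1_def S_def visits_def reps_def)
    have bL: "b \<in> L"
      unfolding L_iff using A by (intro conjI bexI[of _ "inv2 A"] M_inv) (auto simp: k_def)
    have nz: "of_real (A$2$1) * w + of_real (A$2$2) \<noteq> 0" using denom_nz[OF det_M[OF A(1)] w] .
    have "1 / R < Im w / (cmod (of_real (A$2$1) * w + of_real (A$2$2)))\<^sup>2"
      using A(3) Im_act[OF det_M[OF A(1)] w] by (simp add: strip_def)
    then have "(cmod (of_real (A$2$1) * w + of_real (A$2$2)))\<^sup>2 < R * Im w"
      using nz R by (simp add: field_simps)
    then show "b \<in> W"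
      using bL A by (simp add: W_def near_def k_def add.commute)
  qed
  then have "card (k ` S1) \<le> card W" "finite (k ` S1)"
    using finW by (auto intro: card_mono finite_subset)
  then have S1: "card S1 \<le> card W" "finite S1"
    using inj by (auto simp: card_image dest: finite_imageD)
  have tr: "\<exists>n. A = transl n" if "A \<in> S2" for A
    using M_upper_triangular[of A] that by (auto simp: S2_def S_def visits_def reps_def transl_def)
  have S2_eq: "A = B" if AB: "A \<in> S2" "B \<in> S2" for A B
  proof -
    obtain n m where nm: "A = transl n" "B = transl m" using tr AB by blast
    have "w + of_int n \<in> strip R" "w + of_int m \<in> strip R"
      using AB nm by (auto simp: S2_def S_def visits_def act_transl)
    then have "n = m" by (auto simp: strip_def)
    then show ?thesis using nm by simp
  qed
  have S2: "finite S2 \<and> card S2 \<le> 1"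
  proof (cases "S2 = {}")
    case False
    then obtain A where "A \<in> S2" by auto
    then have "S2 = {A}" using S2_eq by blast
    then show ?thesis by simp
  qed simp
  show "finite S" unfolding eq using S1 S2 by simp
  have "card S \<le> card S1 + card S2" unfolding eq by (rule card_Un_le)
  then show "card S \<le> card W + 1" using S1 S2 by linarith
qed

lemma reps_cover:
  assumes "B \<in> M" "0 < Im w"
  shows "\<exists>A\<in>reps. act A w = act B w"
proof -
  consider "B$2$1 < 0" | "B$2$1 > 0" | "B$2$1 = 0" by linarith
  then show ?thesis
  proof cases
    case 1
    then show ?thesis using assms by (auto simp: reps_def)
  next
    case 2
    then show ?thesis using assms M_uminus[of B]
      by (intro bexI[of _ "- B"]) (auto simp: reps_def act_uminus)
  next
    case 3
    then obtain n where "B = transl n \<or> B = - transl n" using M_upper_triangular assms by blast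
    moreover have "transl n \<in> reps" using M_transl by (auto simp: reps_def transl_def)
    ultimately show ?thesis by (auto simp: act_uminus)
  qed
qed

lemma infinite_reps: "infinite reps"
proof
  assume "finite reps"
  moreover have "range transl \<subseteq> reps" using M_transl by (auto simp: reps_def transl_def)
  moreover have "inj transl"
    by (rule injI) (metis mat2_entries(2) of_int_eq_iff transl_def)
  ultimately show False using finite_imageD finite_subset infinite_UNIV_int by blast
qed

lemma strip_area:
  assumes R: "0 < R"
  shows "strip R \<in> sets borel" "strip R \<subseteq> halfplane" "ennreal (R / 4) \<le> emeasure harea (strip R)"
proof -
  show m: "strip R \<in> sets borel" unfolding strip_def by measurable
  have "0 < 1 / R" using R by simp
  then show sub: "strip R \<subseteq> halfplane" by (auto simp: strip_def halfplane_def dest: order.strict_trans)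
  define Bx where "Bx = box (Complex 0 (1 / R)) (Complex 1 (2 / R))"
  have Bx: "Bx \<subseteq> strip R" by (auto simp: Bx_def strip_def box_def Basis_complex_def)
  have split: "R / 4 = (R\<^sup>2 / 4) * (1 / R)" using R by (simp add: power2_eq_square)
  have "ennreal (R / 4) = ennreal (R\<^sup>2 / 4) * ennreal (1 / R)"
    unfolding split by (rule ennreal_mult) (use R in auto)
  also have "ennreal (1 / R) = emeasure lborel Bx"
    using R unfolding Bx_def
    by (subst emeasure_lborel_box) (auto simp: Basis_complex_def divide_right_mono divide_simps)
  also have "ennreal (R\<^sup>2 / 4) * emeasure lborel Bx = (\<integral>\<^sup>+z. ennreal (R\<^sup>2 / 4) * indicator Bx z \<partial>lborel)"
    by (rule nn_integral_cmult_indicator[symmetric]) (simp add: Bx_def)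
  also have "\<dots> \<le> (\<integral>\<^sup>+z. ennreal (indicator halfplane z / (Im z)\<^sup>2) * indicator (strip R) z \<partial>lborel)"
  proof (rule nn_integral_mono)
    fix z :: complex
    show "ennreal (R\<^sup>2 / 4) * indicator Bx z \<le> ennreal (indicator halfplane z / (Im z)\<^sup>2) * indicator (strip R) z"
    proof (cases "z \<in> Bx")
      case True
      then have z: "z \<in> strip R" "z \<in> halfplane" "0 < Im z" "Im z < 2 / R"
        using Bx sub by (auto simp: halfplane_def strip_def)
      have "(Im z)\<^sup>2 \<le> (2 / R)\<^sup>2" using z by (intro power_mono) auto
      then have "1 / (2 / R)\<^sup>2 \<le> 1 / (Im z)\<^sup>2" using z R by (intro divide_left_mono) auto
      then have "R\<^sup>2 / 4 \<le> 1 / (Im z)\<^sup>2" by (simp add: power_divide)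
      then show ?thesis using z True by (simp add: ennreal_leI)
    qed simp
  qed
  also have "\<dots> = emeasure harea (strip R)"
    unfolding harea_def using m
    by (subst emeasure_density) (auto simp: halfplane_def)
  finally show "ennreal (R / 4) \<le> emeasure harea (strip R)" .
qed

lemma fundamental_set_cover:
  assumes F: "F \<subseteq> halfplane" "\<forall>X \<in> surface \<Gamma>. \<exists>!z. z \<in> F \<inter> X"
    and z: "z \<in> halfplane"
  shows "\<exists>A\<in>reps. z \<in> act A ` F"
proof -
  have "proj \<Gamma> z \<in> surface \<Gamma>" using z by (simp add: surface_def)
  then obtain w where w: "w \<in> F" "w \<in> proj \<Gamma> z" using F by blast
  then obtain A where A: "A \<in> M" "w = act A z" by (auto simp: proj_def M_def)
  have pos: "0 < Im z" "0 < Im w" using z w F by (auto simp: halfplane_def)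
  have "z = act (inv2 A) w" using act_inv2(1)[OF det_M[OF A(1)] pos(1)] A by simp
  then show ?thesis using reps_cover[OF M_inv[OF A(1)] pos(2)] w by (metis imageI)
qed

text \<open>
  The strip is covered by the images of a fundamental set under the group. By invariance of the
  area, its area is at most the integral over the fundamental set of the number of matrices that
  move a point into the strip.
\<close>
lemma strip_unfolding:
  assumes F: "F \<in> sets borel" "F \<subseteq> halfplane" "\<forall>X \<in> surface \<Gamma>. \<exists>!z. z \<in> F \<inter> X"
    and fin: "emeasure harea F < \<infinity>" and R: "1 \<le> R" and K: "K \<in> sets borel" "K \<subseteq> F"
    and a: "0 \<le> a" "\<And>w. w \<in> K \<Longrightarrow> real (card (visits w R)) \<le> a"
    and b: "0 \<le> b" "\<And>w. w \<in> F - K \<Longrightarrow> real (card (visits w R)) \<le> b"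
  shows "R / 4 \<le> a * measure harea K + b * measure harea (F - K)"
proof -
  have cM: "countable reps" by (rule countable_subset[OF _ countable_M]) (auto simp: reps_def)
  define e where "e = from_nat_into reps"
  have e: "bij_betw e UNIV reps"
    unfolding e_def by (rule bij_betw_from_nat_into[OF cM infinite_reps])
  have eM: "e n \<in> M" for n using bij_betwE[OF e] by (auto simp: reps_def)
  have sets_h: "sets harea = sets borel" by (simp add: harea_def)
  define G where "G n = F \<inter> act (e n) -` strip R" for n
  have st: "strip R \<in> sets borel" using strip_area R by simp
  have G: "G n \<in> sets borel" "G n \<subseteq> halfplane" for n
    unfolding G_def using F(1,2) measurable_sets_borel[OF act_measurable st] by auto
  have finG: "emeasure harea (G n) < \<infinity>" for n
    using emeasure_mono[of "G n" F harea] F(1) fin by (auto simp: G_def sets_h)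
  have img: "act (e n) ` G n \<in> sets borel" "emeasure harea (act (e n) ` G n) = emeasure harea (G n)" for n
    using harea_act[OF det_M[OF eM] G finG] by auto
  have sub: "strip R \<subseteq> (\<Union>n. act (e n) ` G n)"
  proof
    fix z assume z: "z \<in> strip R"
    then have "z \<in> halfplane" using strip_area(2)[of R] R by auto
    then obtain A w where A: "A \<in> reps" "w \<in> F" "z = act A w"
      using fundamental_set_cover[OF F(2,3)] by blast
    then obtain n where "A = e n" using e by (metis bij_betw_imp_surj_on imageE)
    then show "z \<in> (\<Union>n. act (e n) ` G n)" using A z by (auto simp: G_def)
  qed
  have cnt: "(\<Sum>n. indicator (G n) w) = ennreal (real (card (visits w R))) * indicator F w" for w
  proof (cases "w \<in> F")
    case True
    define N where "N = {n. act (e n) w \<in> strip R}"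
    have w: "0 < Im w" using True F by (auto simp: halfplane_def)
    have bij: "bij_betw e N (visits w R)"
      by (rule bij_betw_subset[OF e]) (use e in \<open>auto simp: N_def visits_def bij_betw_def image_iff\<close>)
    have finN: "finite N" using card_strip(1)[OF w R] bij_betw_finite[OF bij] by simp
    have "(\<Sum>n. indicator (G n) w) = (\<Sum>n\<in>N. indicator (G n) w :: ennreal)"
      by (rule suminf_finite[OF finN]) (auto simp: G_def N_def)
    also have "\<dots> = (\<Sum>n\<in>N. 1)"
      using True by (intro sum.cong) (auto simp: G_def N_def)
    also have "\<dots> = ennreal (real (card N))" by (simp add: ennreal_of_nat_eq_real_of_nat)
    finally show ?thesis using True bij_betw_same_card[OF bij] by simp
  next
    case False
    then have "indicator (G n) w = (0::ennreal)" for n by (simp add: G_def)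
    then show ?thesis using False by simp
  qed
  have "ennreal (R / 4) \<le> emeasure harea (strip R)" using strip_area R by simp
  also have "\<dots> \<le> emeasure harea (\<Union>n. act (e n) ` G n)"
    by (rule emeasure_mono[OF sub]) (use img in \<open>auto simp: sets_h\<close>)
  also have "\<dots> \<le> (\<Sum>n. emeasure harea (act (e n) ` G n))"
    by (rule emeasure_subadditive_countably) (use img in \<open>auto simp: sets_h\<close>)
  also have "\<dots> = (\<Sum>n. \<integral>\<^sup>+w. indicator (G n) w \<partial>harea)"
    using G by (simp add: img sets_h)
  also have "\<dots> = (\<integral>\<^sup>+w. (\<Sum>n. indicator (G n) w) \<partial>harea)"
    by (rule nn_integral_suminf[symmetric]) (use G in \<open>auto simp: sets_h intro!: borel_measurable_indicator\<close>)
  also have "\<dots> \<le> (\<integral>\<^sup>+w. ennreal a * indicator K w + ennreal b * indicator (F - K) w \<partial>harea)"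
  proof (rule nn_integral_mono)
    fix w
    show "(\<Sum>n. indicator (G n) w) \<le> ennreal a * indicator K w + ennreal b * indicator (F - K) w"
      unfolding cnt using a(2)[of w] b(2)[of w] K(2) by (auto split: split_indicator intro!: ennreal_leI)
  qed
  also have "\<dots> = ennreal a * emeasure harea K + ennreal b * emeasure harea (F - K)"
    using K F by (subst nn_integral_add) (auto simp: sets_h nn_integral_cmult_indicator intro!: borel_measurable_times_ennreal borel_measurable_indicator)
  also have "\<dots> = ennreal (a * measure harea K + b * measure harea (F - K))"
  proof -
    have "emeasure harea K < \<infinity>" "emeasure harea (F - K) < \<infinity>"
      using emeasure_mono[of K F harea] emeasure_mono[of "F - K" F harea] F(1) fin K(2) by (auto simp: sets_h)
    then show ?thesis
      using a(1) b(1) by (subst ennreal_plus) (auto simp: emeasure_eq_ennreal_measure ennreal_mult)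
  qed
  finally show ?thesis
    using a(1) b(1) by (subst (asm) ennreal_le_iff) (auto intro!: add_nonneg_nonneg mult_nonneg_nonneg)
qed

text \<open>
  Outside a large compact set the fundamental set has so small an area that, by the uniform upper
  bound for the number of visits, it accounts for at most half of the area of the strip.
\<close>
lemma exists_crowded_point:
  "\<exists>m::nat. \<exists>\<kappa>>0. 1 \<le> m \<and> (\<forall>R\<ge>1. \<exists>w. 1 / real m \<le> Im w \<and> Im w \<le> real m \<and> \<bar>Re w\<bar> \<le> real m \<and>
    \<kappa> * R - 1 \<le> real (card (near w R)))"
proof -
  obtain F where F: "F \<in> sets borel" "F \<subseteq> halfplane" "\<forall>X \<in> surface \<Gamma>. \<exists>!z. z \<in> F \<inter> X"
    and fin: "emeasure harea F < \<infinity>"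
    using zonal by (auto simp: zonal_fuchsian_def finite_area_def)
  have sets_h: "sets harea = sets borel" by (simp add: harea_def)
  define B where "B j = {w. 1 / (real j + 1) \<le> Im w \<and> Im w \<le> real j + 1 \<and> \<bar>Re w\<bar> \<le> real j + 1}" for j
  have Bm: "B j \<in> sets borel" for j unfolding B_def by measurable
  have Bmono: "B i \<subseteq> B j" if "i \<le> j" for i j
  proof -
    have "1 / (real j + 1) \<le> 1 / (real i + 1)" using that by (intro divide_left_mono) auto
    with that show ?thesis by (auto simp: B_def)
  qed
  have out: "(\<Inter>j. F - B j) = {}"
  proof (rule ccontr)
    assume "\<not> ?thesis"
    then obtain w where w: "w \<in> F" "\<And>j. w \<notin> B j" by auto
    have p: "0 < Im w" using w F by (auto simp: halfplane_def)
    obtain j :: nat where j: "max (1 / Im w) (max (Im w) \<bar>Re w\<bar>) \<le> real j"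
      using real_arch_simple by blast
    have "1 / Im w \<le> real j + 1" using j by simp
    then have "1 \<le> (real j + 1) * Im w" using p by (simp add: pos_divide_le_eq)
    then have "1 / (real j + 1) \<le> Im w" by (simp add: pos_divide_le_eq mult.commute)
    then have "w \<in> B j" using j by (simp add: B_def)
    with w show False by simp
  qed
  have "(\<lambda>j. emeasure harea (F - B j)) \<longlonglongrightarrow> emeasure harea (\<Inter>j. F - B j)"
  proof (rule Lim_emeasure_decseq)
    show "range (\<lambda>j. F - B j) \<subseteq> sets harea" using F Bm by (auto simp: sets_h)
    show "decseq (\<lambda>j. F - B j)" using Bmono by (auto simp: decseq_def)
    show "emeasure harea (F - B j) \<noteq> \<infinity>" for j
      using emeasure_mono[of "F - B j" F harea] F(1) fin by (auto simp: sets_h top_unique)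
  qed
  then have lim: "(\<lambda>j. emeasure harea (F - B j)) \<longlonglongrightarrow> 0" unfolding out by simp
  \<comment> \<open>The number of visits is at most \<open>7 R\<close>, so the part outside \<open>B j\<close> contributes at most \<open>R/8\<close> to \<open>R/4\<close>.\<close>
  obtain j where j: "emeasure harea (F - B j) < ennreal (1 / 56)"
    using order_tendstoD(2)[OF lim, of "ennreal (1 / 56)"] by (auto simp: eventually_sequentially)
  define K where "K = F \<inter> B j"
  define V where "V = measure harea K"
  have FK: "F - K = F - B j" by (auto simp: K_def)
  have small: "measure harea (F - K) \<le> 1 / 56"
    unfolding FK measure_def using j by (intro enn2real_leI) auto
  define \<kappa> where "\<kappa> = 1 / (8 * (V + 1))"
  have V: "0 \<le> V" by (simp add: V_def)
  then have \<kappa>: "0 < \<kappa>" by (simp add: \<kappa>_def)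
  have "\<exists>w\<in>K. \<kappa> * R \<le> real (card (near w R)) + 1" if R: "1 \<le> R" for R
  proof (rule ccontr)
    assume neg: "\<not> ?thesis"
    have cs: "real (card (visits w R)) \<le> real (card (near w R)) + 1" if "w \<in> F" for w
    proof -
      have "0 < Im w" using that F by (auto simp: halfplane_def)
      from card_strip(2)[OF this R] show ?thesis by linarith
    qed
    have "R / 4 \<le> (\<kappa> * R) * measure harea K + (7 * R) * measure harea (F - K)"
    proof (rule strip_unfolding[OF F fin R])
      show "K \<in> sets borel" "K \<subseteq> F" using F Bm by (auto simp: K_def)
      show "0 \<le> \<kappa> * R" "0 \<le> 7 * R" using \<kappa> R by auto
      show "real (card (visits w R)) \<le> \<kappa> * R" if "w \<in> K" for w
        using neg cs[of w] that by (force simp: K_def)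
      show "real (card (visits w R)) \<le> 7 * R" if "w \<in> F - K" for w
      proof -
        have p: "0 < Im w" using that F by (auto simp: halfplane_def)
        have "real (card (near w R)) \<le> 4 * R + 2"
          by (rule card_near_point(2)[OF p]) (use R in simp)
        with cs[of w] that R show ?thesis by simp
      qed
    qed
    moreover have "(7 * R) * measure harea (F - K) \<le> (7 * R) * (1 / 56)"
      using small R by (intro mult_left_mono) auto
    moreover have "(\<kappa> * R) * V < R / 8"
    proof -
      have "\<kappa> * V < 1 / 8" using V by (simp add: \<kappa>_def divide_simps)
      then have "R * (\<kappa> * V) < R * (1 / 8)" using R by (intro mult_strict_left_mono) auto
      then show ?thesis by (simp add: mult_ac)
    qed
    ultimately show False using R unfolding V_def by linarith
  qed
  then have "\<forall>R\<ge>1. \<exists>w. 1 / real (j + 1) \<le> Im w \<and> Im w \<le> real (j + 1) \<and> \<bar>Re w\<bar> \<le> real (j + 1) \<and>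
    \<kappa> * R - 1 \<le> real (card (near w R))"
    by (force simp: K_def B_def add.commute diff_le_eq)
  then show ?thesis using \<kappa> by (intro exI[of _ "j + 1"] exI[of _ \<kappa>]) auto
qed

lemma card_box:
  assumes a: "0 < a" and c: "0 < c"
    and S: "\<And>b. b \<in> S \<Longrightarrow> b \<in> L \<and> snd b \<le> a \<and> \<bar>fst b\<bar> \<le> c"
  shows "finite S" "real (card S) \<le> 8 * (a * c) + 2"
proof -
  define s where "s = sqrt (a / c)"
  have s: "0 < s" "s\<^sup>2 = a / c" using a c by (auto simp: s_def)
  have R: "0 < 2 * (a * c)" using a c by simp
  have fg: "(fst b * s)\<^sup>2 + (snd b / s)\<^sup>2 \<le> 2 * (a * c) \<and> (fst b * s \<noteq> 0 \<or> snd b / s \<noteq> 0)" if "b \<in> S" for b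
  proof -
    have b: "0 < snd b" "snd b \<le> a" "\<bar>fst b\<bar> \<le> c" using S[OF that] den_pos by auto
    have "(fst b)\<^sup>2 \<le> c\<^sup>2" using b(3) c abs_le_square_iff[of "fst b" c] by simp
    then have "(fst b * s)\<^sup>2 \<le> c\<^sup>2 * (a / c)"
      using a c by (simp only: power_mult_distrib s) (intro mult_right_mono, auto)
    also have "\<dots> = a * c" using c by (simp add: power2_eq_square)
    finally have 1: "(fst b * s)\<^sup>2 \<le> a * c" .
    have "(snd b)\<^sup>2 \<le> a\<^sup>2" using b by (intro power_mono) auto
    then have "(snd b / s)\<^sup>2 \<le> a\<^sup>2 / (a / c)"
      using a c by (simp only: power_divide s) (intro divide_right_mono, auto)
    also have "\<dots> = a * c" using a by (simp add: power2_eq_square)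
    finally have "(snd b / s)\<^sup>2 \<le> a * c" .
    with 1 b s show ?thesis by simp
  qed
  have det: "1 \<le> \<bar>fst u * s * (snd v / s) - fst v * s * (snd u / s)\<bar>"
    if "u \<in> S" "v \<in> S" "u \<noteq> v" for u v
    using s det_ge_1[of u v] S that by simp
  have "finite S \<and> real (card S) \<le> 4 * (2 * (a * c)) + 2"
    by (intro conjI card_pairwise_det[where f = "\<lambda>b. fst b * s" and g = "\<lambda>b. snd b / s", OF R fg det])
  then show "finite S" "real (card S) \<le> 8 * (a * c) + 2" by auto
qed

text \<open>
  A crowded point in a fixed compact set yields of the order of \<open>H\<^sup>2\<close> fractions with \<open>q \<le> H\<close> and
  \<open>\<bar>p\<bar> = O(H)\<close>. By \<open>card_box\<close> those with \<open>q \<le> \<delta> H\<close> are a small part of them when \<open>\<delta>\<close> is small; the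
  others have bounded value and are distributed over boundedly many unit intervals, which are all
  alike by periodicity.
\<close>
lemma card_unit_interval:
  "\<exists>\<delta> \<kappa> H0. 0 < \<delta> \<and> \<delta> < 1 \<and> 0 < \<kappa> \<and> (\<forall>H\<ge>H0.
    \<kappa> * H\<^sup>2 \<le> real (card {b \<in> L. \<delta> * H < snd b \<and> snd b \<le> H \<and> 0 \<le> val b \<and> val b < 1}))"
proof -
  obtain m :: nat and \<kappa> where m: "0 < \<kappa>" "1 \<le> m"
    and K: "\<forall>R\<ge>1. \<exists>w. 1 / real m \<le> Im w \<and> Im w \<le> real m \<and> \<bar>Re w\<bar> \<le> real m \<and>
      \<kappa> * R - 1 \<le> real (card (near w R))"
    using exists_crowded_point by (elim exE conjE) (rule that)
  define n where "n = real m + 1"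
  have n: "2 \<le> n" using m by (simp add: n_def)
  have big: "\<kappa> / m * H\<^sup>2 - 1 \<le> real (card {b \<in> L. snd b \<le> H \<and> \<bar>fst b\<bar> \<le> n * H})"
    if H: "real m \<le> H" for H
  proof -
    define R where "R = H\<^sup>2 / m"
    have H1: "1 \<le> H" using H m by linarith
    have "1 * real m \<le> H * H" using H H1 by (intro mult_mono) auto
    then have R1: "1 \<le> R" using m by (simp add: R_def power2_eq_square pos_le_divide_eq)
    obtain w where w: "1 / real m \<le> Im w" "Im w \<le> real m" "\<bar>Re w\<bar> \<le> real m"
      "\<kappa> * R - 1 \<le> real (card (near w R))"
      using K[rule_format, OF R1] by blast
    have "0 < 1 / real m" using m by simp
    then have p: "0 < Im w" using w(1) by linarith
    have sub: "near w R
        \<subseteq> {b \<in> L. snd b \<le> H \<and> \<bar>fst b\<bar> \<le> n * H}"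
    unfolding near_def
    proof safe
      fix p q assume b: "(p, q) \<in> L" "(cmod (of_real (fst (p, q)) - of_real (snd (p, q)) * w))\<^sup>2 \<le> R * Im w"
      have q0: "0 < q" using den_pos[OF b(1)] by simp
      have e: "(p - q * Re w)\<^sup>2 + (q * Im w)\<^sup>2 \<le> R * Im w"
        using b(2) by (simp add: cmod_power2)
      have "(q * Im w)\<^sup>2 \<le> R * Im w" using e zero_le_power2[of "p - q * Re w"] by linarith
      then have "(q\<^sup>2 * Im w) * Im w \<le> R * Im w" by (simp add: power2_eq_square mult_ac)
      then have q1: "q\<^sup>2 * Im w \<le> R" using p by simp
      have "q\<^sup>2 * (1 / m) \<le> q\<^sup>2 * Im w" using w(1) by (intro mult_left_mono) auto
      also note q1
      finally have "q\<^sup>2 \<le> H\<^sup>2" using m by (simp add: R_def divide_simps)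
      then have qH: "q \<le> H" by (rule power2_le_imp_le) (use H1 in simp)
      then show "snd (p, q) \<le> H" by simp
      have "(p - q * Re w)\<^sup>2 \<le> R * Im w" using e zero_le_power2[of "q * Im w"] by linarith
      also have "\<dots> \<le> R * m" using w(2) R1 by (intro mult_left_mono) auto
      also have "\<dots> = H\<^sup>2" using m by (simp add: R_def)
      finally have "\<bar>p - q * Re w\<bar> \<le> H" using H1 abs_le_square_iff[of "p - q * Re w" H] by simp
      moreover have "\<bar>q * Re w\<bar> \<le> H * m"
        unfolding abs_mult using qH q0 w(3) H1 by (intro mult_mono) auto
      ultimately have "\<bar>p\<bar> \<le> H + H * m" by linarith
      then show "\<bar>fst (p, q)\<bar> \<le> n * H" by (simp add: n_def algebra_simps)
    qed
    have "finite {b \<in> L. snd b \<le> H \<and> \<bar>fst b\<bar> \<le> n * H}"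
      by (rule card_box(1)[of H "n * H"]) (use H1 n in auto)
    from card_mono[OF this sub] w(4) show ?thesis by (simp add: R_def)
  qed
  \<comment> \<open>This makes the upper bound \<open>8 \<delta> n H\<^sup>2\<close> for the fractions with \<open>q \<le> \<delta> H\<close> at most half of \<open>\<kappa> H\<^sup>2 / m\<close>.\<close>
  define \<delta> where "\<delta> = min (1 / 2) (\<kappa> / (16 * m * n))"
  have \<delta>: "0 < \<delta>" "\<delta> < 1" "\<delta> \<le> \<kappa> / (16 * m * n)" using m n by (auto simp: \<delta>_def)
  define t where "t = \<lceil>n / \<delta>\<rceil>"
  have "0 \<le> n / \<delta>" using n \<delta> by simp
  then have t: "0 \<le> t" "n / \<delta> \<le> of_int t" unfolding t_def by linarith+
  define \<kappa>' where "\<kappa>' = \<kappa> / (4 * m) / of_int (2 * t + 1)"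
  define H0 where "H0 = max (real m) (12 * m / \<kappa>)"
  have "\<kappa>' * H\<^sup>2 \<le> real (card {b \<in> L. \<delta> * H < snd b \<and> snd b \<le> H \<and> 0 \<le> val b \<and> val b < 1})"
    if H: "H0 \<le> H" for H
  proof -
    define A where "A = {b \<in> L. snd b \<le> H \<and> \<bar>fst b\<bar> \<le> n * H}"
    define B where "B = {b \<in> L. snd b \<le> \<delta> * H \<and> \<bar>fst b\<bar> \<le> n * H}"
    define C where "C = {b \<in> L. \<delta> * H < snd b \<and> snd b \<le> H \<and> \<bar>fst b\<bar> \<le> n * H}"
    define W where "W = {b \<in> L. \<delta> * H < snd b \<and> snd b \<le> H \<and> 0 \<le> val b \<and> val b < 1}"
    have H1: "1 \<le> H" "real m \<le> H" "12 * m / \<kappa> \<le> H" using H m by (auto simp: H0_def)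
    have finA: "finite A" unfolding A_def
      by (rule card_box(1)[of H "n * H"]) (use H1 n in auto)
    have B: "finite B" "real (card B) \<le> 8 * (\<delta> * H * (n * H)) + 2"
      unfolding B_def by (rule card_box[of "\<delta> * H" "n * H"]; use H1 n \<delta> in auto)+
    have finC: "finite C" by (rule finite_subset[OF _ finA]) (auto simp: A_def C_def)
    define Y where "Y = \<kappa> / m * H\<^sup>2"
    define X where "X = \<delta> * H * (n * H)"
    have "X \<le> \<kappa> / (16 * m * n) * H * (n * H)"
      unfolding X_def using \<delta> H1 n by (intro mult_right_mono) auto
    also have "\<dots> = Y / 16" using n m by (simp add: Y_def power2_eq_square)
    finally have B': "real (card B) \<le> Y / 2 + 2" using B(2) unfolding X_def[symmetric] by linarith
    have "12 \<le> \<kappa> / m * H" using H1(3) m by (simp add: divide_simps mult_ac)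
    also have "\<dots> \<le> \<kappa> / m * H\<^sup>2" using H1 m by (intro mult_left_mono) (auto simp: power2_eq_square)
    finally have 12: "12 \<le> Y" unfolding Y_def .
    have "A \<subseteq> B \<union> C" using \<delta> H1 by (auto simp: A_def B_def C_def)
    then have "card A \<le> card (B \<union> C)" using B finC by (intro card_mono) auto
    then have "card A \<le> card B + card C" using card_Un_le[of B C] by linarith
    then have "real (card A) \<le> real (card B) + real (card C)" by linarith
    moreover have "Y - 1 \<le> real (card A)" unfolding A_def Y_def by (rule big[OF H1(2)])
    ultimately have C: "Y / 4 \<le> real (card C)" using B' 12 by linarith
    have finW: "finite W" unfolding W_def
      by (rule card_window(1)[of H 1 _ 0]) (use H1 in auto)
    define sh where "sh i b = (fst b + of_int i * snd b, snd b)" for i :: int and b :: "real \<times> real"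
    have "C \<subseteq> (\<Union>i\<in>{-t..t}. sh i ` W)"
    proof
      fix b assume b: "b \<in> C"
      then have bL: "b \<in> L" "\<delta> * H < snd b" "snd b \<le> H" "\<bar>fst b\<bar> \<le> n * H" by (auto simp: C_def)
      have q: "0 < snd b" using den_pos bL by simp
      define i where "i = \<lfloor>val b\<rfloor>"
      define a where "a = sh (- i) b"
      have va: "val a = val b - of_int i" using q by (simp add: a_def sh_def val_def field_simps)
      have "a \<in> L" using L_shift[OF bL(1), of "- i"] by (simp add: a_def sh_def)
      moreover have "0 \<le> val a" "val a < 1" unfolding va i_def by linarith+
      ultimately have "a \<in> W" using bL by (auto simp: W_def a_def sh_def)
      moreover have "b = sh i a" by (simp add: a_def sh_def prod_eq_iff)
      moreover have "i \<in> {-t..t}"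
      proof -
        have "\<bar>val b\<bar> = \<bar>fst b\<bar> / snd b" using q by (simp add: val_def)
        also have "\<dots> \<le> (n * H) / (\<delta> * H)"
          using bL q \<delta> H1 n by (intro frac_le) auto
        also have "\<dots> = n / \<delta>" using H1 by simp
        also have "\<dots> \<le> of_int t" by (rule t)
        finally have "\<bar>val b\<bar> \<le> of_int t" .
        then show ?thesis unfolding i_def by (simp add: le_floor_iff floor_le_iff abs_le_iff)
      qed
      ultimately show "b \<in> (\<Union>i\<in>{-t..t}. sh i ` W)" by blast
    qed
    then have "card C \<le> card (\<Union>i\<in>{-t..t}. sh i ` W)" using finW by (intro card_mono) auto
    also have "\<dots> \<le> (\<Sum>i\<in>{-t..t}. card (sh i ` W))" by (rule card_UN_le) simp
    also have "\<dots> \<le> (\<Sum>i\<in>{-t..t}. card W)" by (intro sum_mono card_image_le finW)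
    also have "\<dots> = nat (2 * t + 1) * card W" by simp
    finally have "real (card C) \<le> real (nat (2 * t + 1)) * real (card W)"
      by (metis of_nat_le_iff of_nat_mult)
    also have "real (nat (2 * t + 1)) = of_int (2 * t + 1)" using t by simp
    finally have "Y / 4 \<le> of_int (2 * t + 1) * real (card W)" using C by linarith
    moreover have "0 < real_of_int (2 * t + 1)" using t by simp
    ultimately have "Y / 4 / of_int (2 * t + 1) \<le> real (card W)"
      by (simp only: pos_divide_le_eq mult.commute)
    then show ?thesis unfolding W_def[symmetric] \<kappa>'_def Y_def by (simp add: mult_ac)
  qed
  moreover have "0 < \<kappa>'" using m t by (simp add: \<kappa>'_def)
  ultimately show ?thesis using \<delta> by blast
qed

end

section \<open>Invariance of approximation properties under the group\<close>
definition real_act :: "real^2^2 \<Rightarrow> real \<Rightarrow> real" where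
  "real_act A w = (A$1$1 * w + A$1$2) / (A$2$1 * w + A$2$2)"

context zonal
begin

lemma L_mult:
  assumes g: "g \<in> M" and b: "b \<in> L" and nz: "g$2$1 * fst b + g$2$2 * snd b \<noteq> 0"
  shows "\<exists>c\<in>L. \<exists>s\<in>{1, -1}. fst c = s * (g$1$1 * fst b + g$1$2 * snd b) \<and>
    snd c = s * (g$2$1 * fst b + g$2$2 * snd b)"
proof -
  obtain A where A: "A \<in> M" "A$1$1 = fst b" "A$2$1 = snd b" using b by (auto simp: L_iff)
  define B where "B = g ** A"
  have B: "B \<in> M" "B$1$1 = g$1$1 * fst b + g$1$2 * snd b" "B$2$1 = g$2$1 * fst b + g$2$2 * snd b"
    using M_mult[OF g A(1)] by (auto simp: B_def A)
  show ?thesis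
  proof (cases "0 < B$2$1")
    case True
    have "(B$1$1, B$2$1) \<in> L" unfolding L_iff using True B(1) by auto
    then show ?thesis using B by (intro bexI[of _ "(B$1$1, B$2$1)"] bexI[of _ 1]) auto
  next
    case False
    then have "(- B$1$1, - B$2$1) \<in> L"
      unfolding L_iff using M_uminus[OF B(1)] nz B by (intro conjI bexI[of _ "- B"]) auto
    then show ?thesis using B by (intro bexI[of _ "(- B$1$1, - B$2$1)"] bexI[of _ "-1"]) auto
  qed
qed

text \<open>
  For \<open>p/q\<close> close to \<open>x\<close>, applying the matrix to both multiplies \<open>q\<close> by about \<open>\<bar>c x + d\<bar>\<close>, and
  \<open>\<theta>\<close> by a factor tending to \<open>1\<close>.
\<close>
lemma well_approx_real_act:
  assumes g: "g \<in> M" and x: "well_approx x" and nz: "g$2$1 * x + g$2$2 \<noteq> 0"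
  shows "well_approx (real_act g x)"
proof -
  obtain C :: nat where C: "\<And>N::nat. \<exists>b\<in>L. real N \<le> snd b \<and> approx x b * ln (snd b) \<le> real C"
    using x by (auto simp: well_approx_def)
  define j where "j = \<bar>g$2$1 * x + g$2$2\<bar>"
  have j: "0 < j" using nz by (simp add: j_def)
  have "\<exists>c\<in>L. real N \<le> snd c \<and> approx (real_act g x) c * ln (snd c) \<le> real (4 * C)" for N :: nat
  proof -
    obtain N' :: nat where N': "max (max (exp 1) (2 * j)) (max (2 * real N / j) (2 * real C * \<bar>g$2$1\<bar> / j)) \<le> real N'"
      using real_arch_simple by blast
    obtain b where b: "b \<in> L" "real N' \<le> snd b" "approx x b * ln (snd b) \<le> real C"
      using C by blast
    define q where "q = snd b"
    define \<theta> where "\<theta> = approx x b"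
    have q: "exp 1 \<le> q" "2 * j \<le> q" "2 * real N / j \<le> q" "2 * real C * \<bar>g$2$1\<bar> / j \<le> q" "1 \<le> q"
      using N' b den_ge_1[OF b(1)] by (auto simp: q_def)
    have lnq: "1 \<le> ln q" using q by (simp add: ln_ge_iff)
    have \<theta>0: "0 \<le> \<theta>" using den_pos[OF b(1)] by (simp add: \<theta>_def approx_def)
    have "\<theta> * 1 \<le> \<theta> * ln q" using lnq \<theta>0 by (rule mult_left_mono)
    then have \<theta>C: "\<theta> \<le> real C" using b(3) by (simp add: \<theta>_def q_def)
    have qx: "\<bar>q * x - fst b\<bar> = \<theta> / q" using q by (simp add: \<theta>_def approx_def q_def)
    define d where "d = g$2$1 * fst b + g$2$2 * q"
    have "d = q * (g$2$1 * x + g$2$2) - g$2$1 * (q * x - fst b)"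
      by (simp add: d_def algebra_simps)
    then have dd: "\<bar>\<bar>d\<bar> - q * j\<bar> \<le> \<bar>g$2$1\<bar> * (\<theta> / q)"
      using abs_triangle_ineq3[of d "q * (g$2$1 * x + g$2$2)"] q
      by (simp add: j_def abs_mult qx)
    have "\<bar>g$2$1\<bar> * (\<theta> / q) \<le> \<bar>g$2$1\<bar> * real C"
    proof (intro mult_left_mono)
      have "\<theta> / q \<le> \<theta> / 1" using q \<theta>0 by (intro divide_left_mono) auto
      then show "\<theta> / q \<le> real C" using \<theta>C by simp
    qed simp
    also have "\<dots> \<le> q * j / 2"
      using q(4) j by (simp add: field_simps)
    finally have small: "\<bar>g$2$1\<bar> * (\<theta> / q) \<le> q * j / 2" .
    have d: "q * j / 2 \<le> \<bar>d\<bar>" "\<bar>d\<bar> \<le> 2 * (q * j)"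
      using dd small j q mult_pos_pos[of q j] by linarith+
    have qj: "0 < q * j" using q j by simp
    have "g$2$1 * fst b + g$2$2 * snd b \<noteq> 0" using d qj by (auto simp: d_def q_def)
    then obtain c s where c: "c \<in> L" "s \<in> {1, -1}" "fst c = s * (g$1$1 * fst b + g$1$2 * snd b)"
      "snd c = s * (g$2$1 * fst b + g$2$2 * snd b)"
      using L_mult[OF g b(1)] by blast
    have sc: "snd c = \<bar>d\<bar>" using den_pos[OF c(1)] c(2,4) by (auto simp: d_def q_def)
    have "snd c * real_act g x - fst c = s * (snd b * x - fst b) / (g$2$1 * x + g$2$2)"
    proof -
      have "(snd c * real_act g x - fst c) * (g$2$1 * x + g$2$2)
        = s * ((g$2$1 * fst b + g$2$2 * snd b) * (g$1$1 * x + g$1$2) - (g$1$1 * fst b + g$1$2 * snd b) * (g$2$1 * x + g$2$2))"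
        using nz unfolding real_act_def c(3,4) by (simp add: field_simps)
      also have "\<dots> = s * ((g$1$1 * g$2$2 - g$1$2 * g$2$1) * (snd b * x - fst b))"
        by (simp add: algebra_simps)
      finally show ?thesis using nz det_M[OF g] by (simp add: eq_divide_eq)
    qed
    then have "\<bar>snd c * real_act g x - fst c\<bar> = (\<theta> / q) / j"
      using c(2) qx by (auto simp: abs_mult abs_divide j_def q_def)
    then have th: "approx (real_act g x) c = \<bar>d\<bar> * ((\<theta> / q) / j)"
      by (simp add: approx_def sc)
    have "\<bar>d\<bar> * ((\<theta> / q) / j) \<le> (2 * (q * j)) * ((\<theta> / q) / j)"
      using d \<theta>0 q j by (intro mult_right_mono) auto
    also have "\<dots> = 2 * \<theta>" using q j by simp
    finally have th2: "approx (real_act g x) c \<le> 2 * \<theta>" using th by simp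
    have th0: "0 \<le> approx (real_act g x) c" using den_pos[OF c(1)] by (simp add: approx_def)
    have "snd c \<le> 2 * (q * j)" using d sc by simp
    also have "\<dots> \<le> q * q" using q by (simp add: mult.left_commute)
    finally have "ln (snd c) \<le> ln (q * q)" using den_pos[OF c(1)] by (intro ln_mono) auto
    then have ln2: "ln (snd c) \<le> 2 * ln q" using q by (simp add: ln_mult)
    have "approx (real_act g x) c * ln (snd c) \<le> approx (real_act g x) c * (2 * ln q)"
      using ln2 th0 by (rule mult_left_mono)
    also have "\<dots> \<le> (2 * \<theta>) * (2 * ln q)" using th2 lnq by (intro mult_right_mono) auto
    also have "\<dots> = 4 * (\<theta> * ln q)" by simp
    also have "\<dots> \<le> 4 * real C" using b(3) by (simp add: \<theta>_def q_def)
    finally have "approx (real_act g x) c * ln (snd c) \<le> real (4 * C)" by simp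
    moreover have "real N \<le> snd c"
    proof -
      have "2 * real N \<le> q * j" using q(3) j by (simp add: pos_divide_le_eq)
      then show ?thesis using d sc by linarith
    qed
    ultimately show ?thesis using c(1) by blast
  qed
  then show ?thesis unfolding well_approx_def by blast
qed

lemma well_approx_real_act_iff:
  assumes g: "g \<in> M" and nz: "g$2$1 * x + g$2$2 \<noteq> 0"
  shows "well_approx (real_act g x) \<longleftrightarrow> well_approx x"
proof
  assume gx: "well_approx (real_act g x)"
  have e: "(inv2 g)$2$1 * real_act g x + (inv2 g)$2$2 = 1 / (g$2$1 * x + g$2$2)"
    using nz det_M[OF g] by (simp add: real_act_def field_simps)
  moreover note e
  moreover have "(inv2 g)$1$1 * real_act g x + (inv2 g)$1$2 = x / (g$2$1 * x + g$2$2)"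
  proof -
    have "(g$2$2 * (g$1$1 * x + g$1$2) - g$1$2 * (g$2$1 * x + g$2$2)) = (g$1$1 * g$2$2 - g$1$2 * g$2$1) * x"
      by (simp add: algebra_simps)
    then show ?thesis using nz det_M[OF g] by (simp add: real_act_def field_simps)
  qed
  ultimately have "real_act (inv2 g) (real_act g x) = x"
    unfolding real_act_def[of "inv2 g" "real_act g x"] using nz by simp
  moreover have "well_approx (real_act (inv2 g) (real_act g x))"
    by (rule well_approx_real_act[OF M_inv[OF g] gx]) (unfold e, use nz in simp)
  ultimately show "well_approx x" by simp
qed (rule well_approx_real_act[OF g _ nz])

definition ill_approx :: "real set" where
  "ill_approx = {x. \<not> well_approx x}"

lemma ill_approx_measurable [measurable]: "ill_approx \<in> sets borel"
proof -
  define X where "X b N C = {x. real N \<le> snd b \<and> approx x b * ln (snd b) \<le> real C}" for b and N C :: nat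
  have "X b N C \<in> sets borel" for b N C
    unfolding X_def approx_def by measurable
  then have "(\<Union>b\<in>L. X b N C) \<in> sets borel" for N C
    by (intro sets.countable_UN'[OF countable_L]) auto
  then have "(\<Inter>N. \<Union>b\<in>L. X b N C) \<in> sets borel" for C
    by (intro sets.countable_INT) auto
  then have "(\<Union>C. \<Inter>N. \<Union>b\<in>L. X b N C) \<in> sets borel"
    by (intro sets.countable_UN) auto
  then have "- (\<Union>C. \<Inter>N. \<Union>b\<in>L. X b N C) \<in> sets borel"
    by (rule borel_comp)
  moreover have "ill_approx = - (\<Union>C. \<Inter>N. \<Union>b\<in>L. X b N C)"
    by (auto simp: ill_approx_def well_approx_def X_def)
  ultimately show ?thesis by simp
qed

lemma ill_approx_shift: "x + of_int n \<in> ill_approx \<longleftrightarrow> x \<in> ill_approx"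
  using well_approx_real_act_iff[OF M_transl[of n], of x] by (simp add: ill_approx_def real_act_def transl_def)

lemma emeasure_ill_approx_interval:
  "emeasure lborel (ill_approx \<inter> {of_int k..<of_int k + real N}) = of_nat N * emeasure lborel (ill_approx \<inter> {0..<1})"
proof (induction N)
  case (Suc N)
  have unit: "emeasure lborel (ill_approx \<inter> {of_int i..<of_int i + 1}) = emeasure lborel (ill_approx \<inter> {0..<1})" for i :: int
  proof -
    have "emeasure lborel (ill_approx \<inter> {of_int i..<of_int i + 1}) =
      emeasure (distr lborel borel ((+) (real_of_int i))) (ill_approx \<inter> {of_int i..<of_int i + 1})"
      by (simp add: lborel_distr_plus)
    also have "\<dots> = emeasure lborel ((+) (real_of_int i) -` (ill_approx \<inter> {of_int i..<of_int i + 1}))"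
      by (subst emeasure_distr) auto
    also have "(+) (real_of_int i) -` (ill_approx \<inter> {of_int i..<of_int i + 1}) = ill_approx \<inter> {0..<1}"
      using ill_approx_shift by (auto simp: add.commute)
    finally show ?thesis .
  qed
  have "ill_approx \<inter> {of_int k..<of_int k + real (Suc N)} =
    (ill_approx \<inter> {of_int k..<of_int k + real N}) \<union> (ill_approx \<inter> {of_int (k + int N)..<of_int (k + int N) + 1})"
    by auto
  then have "emeasure lborel (ill_approx \<inter> {of_int k..<of_int k + real (Suc N)}) =
    emeasure lborel (ill_approx \<inter> {of_int k..<of_int k + real N}) + emeasure lborel (ill_approx \<inter> {of_int (k + int N)..<of_int (k + int N) + 1})"
    by (simp only:) (rule plus_emeasure[symmetric], auto)
  then show ?case unfolding unit Suc by (simp add: distrib_right add.commute)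
qed simp

text \<open>
  Blowing up a small one-sided neighbourhood of a fraction by the matrix that sends infinity
  to it shows that the invariant set fills a fixed proportion of that neighbourhood.
\<close>
lemma ill_approx_near_fraction:
  assumes b: "b \<in> L" and r: "0 < r" "r \<le> 1 / (snd b)\<^sup>2"
  shows "measure lborel (ill_approx \<inter> {0..<1}) * r / 18 \<le> measure lborel (ill_approx \<inter> {val b - r..val b})"
proof -
  define \<beta> where "\<beta> = measure lborel (ill_approx \<inter> {0..<1})"
  have fin: "emeasure lborel (ill_approx \<inter> {c..d}) < \<infinity>" for c d :: real
    using emeasure_mono[of "ill_approx \<inter> {c..d}" "{c..d}" lborel] by (auto simp: emeasure_lborel_Icc_eq le_less_trans)
  have fin1: "emeasure lborel (ill_approx \<inter> {0..<1}) \<noteq> \<infinity>"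
    using emeasure_mono[of "ill_approx \<inter> {0..<1}" "{0..<1}" lborel] by (auto simp: top_unique)
  obtain A where A: "A \<in> M" "A$1$1 = fst b" "A$2$1 = snd b" using b by (auto simp: L_iff)
  define q s where "q = snd b" and "s = A$2$2"
  have q: "0 < q" using den_pos[OF b] by (simp add: q_def)
  \<comment> \<open>Points at distance \<open>u\<close> to the right of the pole \<open>- s/q\<close> are mapped to \<open>val b - 1 / (q\<^sup>2 u)\<close>; so the interval of the \<open>N\<close> unit cells starting at the integer \<open>k\<close>, where \<open>u\<close> is between \<open>N\<close> and \<open>3 N\<close>, is mapped into the neighbourhood.\<close>
  define N where "N = nat \<lceil>1 / (q\<^sup>2 * r)\<rceil>"
  have q2r: "0 < q\<^sup>2 * r" "q\<^sup>2 * r \<le> 1" using q r by (auto simp: q_def pos_le_divide_eq mult.commute)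
  have N: "1 / (q\<^sup>2 * r) \<le> real N" "real N \<le> 1 / (q\<^sup>2 * r) + 1" "1 \<le> real N"
  proof -
    have "1 \<le> 1 / (q\<^sup>2 * r)" using q2r by (simp add: pos_le_divide_eq)
    then show "1 / (q\<^sup>2 * r) \<le> real N" "real N \<le> 1 / (q\<^sup>2 * r) + 1" "1 \<le> real N"
      unfolding N_def by linarith+
  qed
  define k where "k = \<lceil>- (s / q)\<rceil> + int N"
  have k: "real N \<le> of_int k + s / q" "of_int k + s / q \<le> real N + 1"
    unfolding k_def by linarith+
  define l u where "l = real_of_int k" and "u = real_of_int k + real N"
  have lu: "l \<le> u" by (simp add: l_def u_def)
  define \<phi> where "\<phi> = real_act A"
  define \<phi>' where "\<phi>' w = 1 / (q * w + s)\<^sup>2" for w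
  have rng: "q * real N \<le> q * w + s" "q * w + s \<le> q * (3 * real N)" if "w \<in> {l..u}" for w
  proof -
    have "real N \<le> w + s / q" "w + s / q \<le> 3 * real N"
      using that k N(3) by (auto simp: l_def u_def)
    then have "q * real N \<le> q * (w + s / q)" "q * (w + s / q) \<le> q * (3 * real N)"
      using q by auto
    then show "q * real N \<le> q * w + s" "q * w + s \<le> q * (3 * real N)"
      using q by (auto simp: distrib_left)
  qed
  have qN: "0 < q * real N" using q N by simp
  have pos: "0 < q * w + s" if "w \<in> {l..u}" for w using rng(1)[OF that] qN by linarith
  have \<phi>_eq: "\<phi> w = val b - 1 / (q * (q * w + s))" if "w \<in> {l..u}" for w
  proof -
    have e: "fst b * s - A$1$2 * q = 1" using det_M[OF A(1)] A by (simp add: s_def q_def)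
    have "val b - 1 / (q * (q * w + s)) = (fst b * (q * w + s) - 1) / (q * (q * w + s))"
      using pos[OF that] q by (simp add: val_def q_def[symmetric] diff_divide_distrib)
    also have "fst b * (q * w + s) - 1 = q * (fst b * w + A$1$2)"
      using e by (simp add: algebra_simps)
    also have "q * (fst b * w + A$1$2) / (q * (q * w + s)) = \<phi> w"
      using q by (simp add: \<phi>_def real_act_def A s_def q_def)
    finally show ?thesis by simp
  qed
  have der: "(\<phi> has_real_derivative \<phi>' w) (at w)" if "w \<in> {l..u}" for w
  proof -
    have p: "A$2$1 * w + A$2$2 \<noteq> 0" using pos[OF that] by (simp add: A q_def s_def)
    have "((\<lambda>w. (A$1$1 * w + A$1$2) / (A$2$1 * w + A$2$2)) has_real_derivative
      (A$1$1 * (A$2$1 * w + A$2$2) - (A$1$1 * w + A$1$2) * A$2$1) / ((A$2$1 * w + A$2$2) * (A$2$1 * w + A$2$2))) (at w)"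
      using p by (auto intro!: derivative_eq_intros)
    also have "A$1$1 * (A$2$1 * w + A$2$2) - (A$1$1 * w + A$1$2) * A$2$1 = 1"
      using det_M[OF A(1)] by (simp add: algebra_simps)
    finally show ?thesis by (simp add: \<phi>_def \<phi>'_def real_act_def[abs_def] A q_def s_def power2_eq_square)
  qed
  have cont: "continuous_on {l..u} \<phi>'"
    unfolding \<phi>'_def using pos by (intro continuous_intros) (auto simp: less_imp_neq[symmetric])
  have low: "1 / (q * (3 * real N))\<^sup>2 \<le> \<phi>' w" if "w \<in> {l..u}" for w
  proof -
    have A: "0 < q * (3 * real N)" using q N by simp
    have "0 < (q * (3 * real N))\<^sup>2 * (q * w + s)\<^sup>2"
      by (rule mult_pos_pos[OF zero_less_power[OF A] zero_less_power[OF pos[OF that]]])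
    then show ?thesis
      unfolding \<phi>'_def using rng[OF that] pos[OF that] by (intro divide_left_mono power_mono) auto
  qed
  have inv: "indicator ill_approx (\<phi> w) = (indicator ill_approx w :: real)" if "w \<in> {l..u}" for w
    using well_approx_real_act_iff[OF A(1), of w] pos[OF that]
    by (auto simp: indicator_def ill_approx_def \<phi>_def A q_def s_def)
  have ends: "{\<phi> l..\<phi> u} \<subseteq> {val b - r..val b}"
  proof -
    have lI: "l \<in> {l..u}" "u \<in> {l..u}" using lu by auto
    have "1 \<le> q\<^sup>2 * r * real N" using N(1) q2r by (simp add: pos_divide_le_eq mult.commute)
    then have "1 \<le> r * (q * (q * real N))" by (simp add: power2_eq_square mult_ac)
    also have "\<dots> \<le> r * (q * (q * l + s))" using r q rng(1)[OF lI(1)] by (intro mult_left_mono) auto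
    finally have "1 / (q * (q * l + s)) \<le> r" using q pos[OF lI(1)] by (simp add: pos_divide_le_eq mult.commute)
    then have 1: "val b - r \<le> \<phi> l" using \<phi>_eq[OF lI(1)] by simp
    have "0 < 1 / (q * (q * u + s))" using q pos[OF lI(2)] by simp
    then have "\<phi> u \<le> val b" using \<phi>_eq[OF lI(2)] by simp
    with 1 show ?thesis by auto
  qed
  define e where "e = 1 / (q * (3 * real N))\<^sup>2"
  have e0: "0 < e" using qN q N by (simp add: e_def)
  have "ennreal (e * (real N * \<beta>)) = ennreal e * (of_nat N * emeasure lborel (ill_approx \<inter> {0..<1}))"
    using e0 fin1 by (simp add: \<beta>_def emeasure_eq_ennreal_measure ennreal_mult ennreal_of_nat_eq_real_of_nat)
  also have "of_nat N * emeasure lborel (ill_approx \<inter> {0..<1}) = emeasure lborel (ill_approx \<inter> {l..<u})"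
    unfolding l_def u_def by (rule emeasure_ill_approx_interval[symmetric])
  also have "ennreal e * emeasure lborel (ill_approx \<inter> {l..<u}) = (\<integral>\<^sup>+w. ennreal e * indicator (ill_approx \<inter> {l..<u}) w \<partial>lborel)"
    by (rule nn_integral_cmult_indicator[symmetric]) simp
  also have "\<dots> \<le> (\<integral>\<^sup>+w. ennreal (indicator ill_approx (\<phi> w) * \<phi>' w * indicator {l..u} w) \<partial>lborel)"
  proof (rule nn_integral_mono)
    fix w
    show "ennreal e * indicator (ill_approx \<inter> {l..<u}) w \<le> ennreal (indicator ill_approx (\<phi> w) * \<phi>' w * indicator {l..u} w)"
      using low[of w] inv[of w] by (auto simp: e_def split: split_indicator intro!: ennreal_leI)
  qed
  also have "\<dots> = (\<integral>\<^sup>+x. ennreal (indicator ill_approx x * indicator {\<phi> l..\<phi> u} x) \<partial>lborel)"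
    by (rule nn_integral_substitution[symmetric, OF _ der cont])
      (use lu in \<open>auto simp: set_borel_measurable_def \<phi>'_def\<close>)
  also have "\<dots> \<le> (\<integral>\<^sup>+x. indicator (ill_approx \<inter> {val b - r..val b}) x \<partial>lborel)"
    by (rule nn_integral_mono) (use ends in \<open>auto split: split_indicator\<close>)
  also have "\<dots> = emeasure lborel (ill_approx \<inter> {val b - r..val b})" by simp
  also have "\<dots> = ennreal (measure lborel (ill_approx \<inter> {val b - r..val b}))"
    using fin[of "val b - r" "val b"] by (simp add: emeasure_eq_ennreal_measure)
  finally have "e * (real N * \<beta>) \<le> measure lborel (ill_approx \<inter> {val b - r..val b})" by simp
  moreover have "\<beta> * r / 18 \<le> e * (real N * \<beta>)"
  proof -
    have "real N \<le> 2 / (q\<^sup>2 * r)"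
    proof -
      have "1 \<le> 1 / (q\<^sup>2 * r)" using q2r by (simp add: pos_le_divide_eq)
      with N(2) have "real N \<le> 1 / (q\<^sup>2 * r) + 1 / (q\<^sup>2 * r)" by linarith
      then show ?thesis by (simp add: mult.commute)
    qed
    then have "real N * (q\<^sup>2 * r) \<le> 2" using q2r(1) by (simp only: pos_le_divide_eq)
    then have "r / 18 \<le> e * real N"
      using q N by (simp add: e_def field_simps power2_eq_square)
    then have "\<beta> * (r / 18) \<le> \<beta> * (e * real N)" by (intro mult_left_mono) (simp_all add: \<beta>_def)
    then show ?thesis by (simp add: mult_ac)
  qed
  ultimately show ?thesis by (simp add: \<beta>_def)
qed

end

section \<open>A divergence Borel--Cantelli argument\<close>

text \<open>
  The function \<open>f n = \<Sum> indicator (J i)\<close> has integral at least \<open>c S_n\<close> over \<open>E\<close>, and its square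
  has integral \<open>O(S_n\<^sup>2)\<close>. If \<open>f n\<close> were bounded in \<open>n\<close> at every point of \<open>E\<close>, it would be uniformly
  bounded outside a set of small measure, and on a set of small measure the second moment
  prevents it from having most of its mass there.
\<close>
lemma second_moment:
  fixes J :: "'i \<Rightarrow> real set" and P :: "nat \<Rightarrow> 'i set" and E :: "real set" and S :: "nat \<Rightarrow> real"
  assumes P: "\<And>n. finite (P n)" and J: "\<And>i. J i \<in> sets borel" "\<And>i n. i \<in> P n \<Longrightarrow> J i \<subseteq> {-1..1}"
    and E: "E \<in> sets borel" and c: "0 < c" "0 < C" and S: "filterlim S at_top sequentially"
    and first: "\<And>n. c * S n \<le> (\<Sum>i\<in>P n. measure lborel (E \<inter> J i))"
    and second: "\<And>n. (\<Sum>i\<in>P n. \<Sum>j\<in>P n. measure lborel (J i \<inter> J j)) \<le> C * (S n)\<^sup>2 + C * S n"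
    and bounded: "\<And>x. x \<in> E \<Longrightarrow> \<exists>B::nat. \<forall>n. (\<Sum>i\<in>P n. indicator (J i) x) \<le> real B"
  shows False
proof -
  define f where "f n x = (\<Sum>i\<in>P n. indicator (J i) x :: real)" for n x
  have fm [measurable]: "f n \<in> borel_measurable borel" for n
    unfolding f_def using J(1) by (intro borel_measurable_sum borel_measurable_indicator) auto
  have f0: "0 \<le> f n x" for n x unfolding f_def by (intro sum_nonneg) auto
  define E' where "E' = E \<inter> {-1..1}"
  have E'm [measurable]: "E' \<in> sets borel" unfolding E'_def using E by auto
  define Z where "Z B = {x \<in> E'. \<forall>n. f n x \<le> real B}" for B :: nat
  have Zm [measurable]: "Z B \<in> sets borel" for B
  proof -
    have "{x \<in> space borel. \<forall>n. f n x \<le> real B} \<in> sets borel" by measurable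
    moreover have "Z B = E' \<inter> {x \<in> space borel. \<forall>n. f n x \<le> real B}" by (auto simp: Z_def)
    ultimately show ?thesis by simp
  qed
  have fin: "emeasure lborel X < \<infinity>" if "X \<subseteq> {-1..1}" for X :: "real set"
    using emeasure_mono[OF that, of lborel] by (auto simp: le_less_trans)
  have lim: "(\<lambda>B. emeasure lborel (E' - Z B)) \<longlonglongrightarrow> 0"
  proof -
    have out: "(\<Inter>B. E' - Z B) = {}"
      using bounded by (fastforce simp: E'_def Z_def f_def)
    have "(\<lambda>B. emeasure lborel (E' - Z B)) \<longlonglongrightarrow> emeasure lborel (\<Inter>B. E' - Z B)"
    proof (rule Lim_emeasure_decseq)
      show "decseq (\<lambda>B. E' - Z B)"
      proof -
        have "Z B \<subseteq> Z B'" if "B \<le> B'" for B B'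
        proof
          fix x assume x: "x \<in> Z B"
          have "f n x \<le> real B'" for n
          proof -
            have "f n x \<le> real B" using x by (simp add: Z_def)
            also have "\<dots> \<le> real B'" using that by simp
            finally show ?thesis .
          qed
          then show "x \<in> Z B'" using x by (simp add: Z_def)
        qed
        then show ?thesis unfolding decseq_def by blast
      qed
      show "emeasure lborel (E' - Z B) \<noteq> \<infinity>" for B
      proof -
        have "E' - Z B \<subseteq> {-1..1}" by (auto simp: E'_def)
        from fin[OF this] show ?thesis by simp
      qed
    qed auto
    then show ?thesis unfolding out emeasure_empty .
  qed
  define \<tau> where "\<tau> = 6 * C / c"
  have \<tau>: "0 < \<tau>" using c by (simp add: \<tau>_def)
  define \<eta> where "\<eta> = c / (3 * \<tau>)"
  have \<eta>: "0 < \<eta>" using c \<tau> by (simp add: \<eta>_def)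
  obtain B where B: "emeasure lborel (E' - Z B) < ennreal \<eta>"
    using order_tendstoD(2)[OF lim, of "ennreal \<eta>"] \<eta> by (auto simp: eventually_sequentially)
  have small: "measure lborel (E' - Z B) \<le> \<eta>"
    unfolding measure_def using B \<eta> by (intro enn2real_leI) auto
  have "eventually (\<lambda>n. max 1 (6 * real B / c + 1) \<le> S n) sequentially"
    using S unfolding filterlim_at_top by blast
  then obtain n where n: "1 \<le> S n" "6 * real B / c + 1 \<le> S n"
    by (auto simp: eventually_sequentially)
  define t where "t = \<tau> * S n"
  have t: "0 < t" using \<tau> n by (simp add: t_def)
  have ind_int: "integrable lborel (indicator X :: real \<Rightarrow> real)" if "X \<in> sets borel" "X \<subseteq> {-1..1}" for X
    using that fin[of X] by (intro integrable_real_indicator) auto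
  have sq: "(f n x)\<^sup>2 = (\<Sum>i\<in>P n. \<Sum>j\<in>P n. indicator (J i \<inter> J j) x)" for x
    by (simp add: f_def power2_eq_square sum_product indicator_inter_arith)
  have JJ: "integrable lborel (indicator (J i \<inter> J j) :: real \<Rightarrow> real)" if "i \<in> P n" for i j
    using J that by (intro ind_int) auto
  have sq_int: "integrable lborel (\<lambda>x. (f n x)\<^sup>2)"
    unfolding sq using JJ by (intro Bochner_Integration.integrable_sum) auto
  have int_sq: "(\<integral>x. (f n x)\<^sup>2 \<partial>lborel) = (\<Sum>i\<in>P n. \<Sum>j\<in>P n. measure lborel (J i \<inter> J j))"
    unfolding sq using JJ J(1) by (subst Bochner_Integration.integral_sum; intro sum.cong Bochner_Integration.integrable_sum refl; simp?)
  have left: "(\<Sum>i\<in>P n. indicator (E \<inter> J i) x) = indicator E' x * f n x" for x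
    unfolding f_def sum_distrib_left
  proof (rule sum.cong[OF refl])
    fix i assume "i \<in> P n"
    then have "J i \<subseteq> {-1..1}" by (rule J(2))
    then have "E \<inter> J i = E' \<inter> J i" by (auto simp: E'_def)
    then show "indicator (E \<inter> J i) x = indicator E' x * (indicator (J i) x :: real)"
      by (simp add: indicator_inter_arith)
  qed
  have EJ: "integrable lborel (indicator (E \<inter> J i) :: real \<Rightarrow> real)" if "i \<in> P n" for i
    using J E that by (intro ind_int) auto
  have left_int: "integrable lborel (\<lambda>x. indicator E' x * f n x)"
    unfolding left[symmetric] using EJ by (intro Bochner_Integration.integrable_sum) auto
  have int_left: "(\<integral>x. indicator E' x * f n x \<partial>lborel) = (\<Sum>i\<in>P n. measure lborel (E \<inter> J i))"
    unfolding left[symmetric] using EJ E J(1) by (subst Bochner_Integration.integral_sum) auto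
  have i1: "integrable lborel (\<lambda>x. real B * indicator {-1..1::real} x)"
    by (intro integrable_mult_right ind_int) auto
  have i2: "integrable lborel (\<lambda>x. (f n x)\<^sup>2 / t)" using sq_int by simp
  have i3: "integrable lborel (\<lambda>x. t * indicator (E' - Z B) x)"
  proof (intro integrable_mult_right ind_int)
    show "E' - Z B \<in> sets borel" by simp
    show "E' - Z B \<subseteq> {-1..1}" by (auto simp: E'_def)
  qed
  have "c * S n \<le> (\<integral>x. indicator E' x * f n x \<partial>lborel)" using first[of n] int_left by simp
  also have "\<dots> \<le> (\<integral>x. real B * indicator {-1..1::real} x + (f n x)\<^sup>2 / t + t * indicator (E' - Z B) x \<partial>lborel)"
  proof (rule integral_mono[OF left_int])
    show "integrable lborel (\<lambda>x. real B * indicator {-1..1::real} x + (f n x)\<^sup>2 / t + t * indicator (E' - Z B) x)"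
      using i1 i2 i3 by (intro Bochner_Integration.integrable_add)
    fix x :: real
    have q0: "0 \<le> (f n x)\<^sup>2 / t" using t by simp
    show "indicator E' x * f n x \<le> real B * indicator {-1..1::real} x + (f n x)\<^sup>2 / t + t * indicator (E' - Z B) x"
    proof (cases "x \<in> E'")
      case False
      then show ?thesis using q0 by simp
    next
      case True
      then have x1: "x \<in> {-1..1}" by (simp add: E'_def)
      show ?thesis
      proof (cases "x \<in> Z B")
        case True
        then have "f n x \<le> real B" by (simp add: Z_def)
        then show ?thesis using True x1 \<open>x \<in> E'\<close> q0 by simp
      next
        case False
        \<comment> \<open>The elementary form of the Cauchy--Schwarz inequality: \<open>f \<le> f\<^sup>2/t + t\<close>.\<close>
        have "0 \<le> (f n x - t)\<^sup>2 + f n x * t" using f0 t by simp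
        then have "f n x * t \<le> (f n x)\<^sup>2 + t * t" by (simp add: power2_eq_square algebra_simps)
        then have "f n x \<le> (f n x)\<^sup>2 / t + t"
          using t by (simp add: field_simps)
        then show ?thesis using False x1 \<open>x \<in> E'\<close> by simp
      qed
    qed
  qed
  also have "\<dots> = real B * 2 + (\<integral>x. (f n x)\<^sup>2 \<partial>lborel) / t + t * measure lborel (E' - Z B)"
    using i1 i2 i3 by simp
  also have "\<dots> \<le> real B * 2 + c / 3 * S n + c / 3 * S n"
  proof (intro add_mono)
    have "(\<integral>x. (f n x)\<^sup>2 \<partial>lborel) \<le> C * (S n)\<^sup>2 + C * S n" using second[of n] int_sq by simp
    also have "\<dots> \<le> C * (S n)\<^sup>2 + C * (S n)\<^sup>2"
      using n c by (intro add_mono mult_left_mono) (auto simp: power2_eq_square)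
    also have "\<dots> = c / 3 * S n * t" using c by (simp add: t_def \<tau>_def power2_eq_square)
    finally show "(\<integral>x. (f n x)\<^sup>2 \<partial>lborel) / t \<le> c / 3 * S n" using t by (simp add: pos_divide_le_eq)
    have "t * measure lborel (E' - Z B) \<le> t * \<eta>" using small t by (intro mult_left_mono) auto
    also have "\<dots> = c / 3 * S n" using \<tau> by (simp add: t_def \<eta>_def)
    finally show "t * measure lborel (E' - Z B) \<le> c / 3 * S n" .
  qed simp
  finally have "c * S n / 3 \<le> 2 * real B" by simp
  moreover have "2 * real B < c * S n / 3" using n(2) c by (simp add: field_simps)
  ultimately show False by simp
qed

context zonal
begin

text \<open>
  Around each fraction with denominator between \<open>H / K\<close> and \<open>H = K\<close> to the power \<open>k + 1\<close> take a
  one-sided neighbourhood of length \<open>1 / ((k + 1) H\<^sup>2)\<close>. The total length at level \<open>k\<close> is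
  comparable to \<open>1 / (k + 1)\<close>, the terms of a divergent series. Neighbourhoods of
  two distinct fractions meet only if the second denominator is large compared with the first, and
  then the spacing of the fractions bounds the number of such pairs by the value that independence
  would predict.
\<close>
lemma AE_well_approx: "AE x in lborel. 0 < x \<and> x < 1 \<longrightarrow> well_approx x"
proof -
  define \<beta> where "\<beta> = measure lborel (ill_approx \<inter> {0..<1})"
  have "\<beta> = 0"
  proof (rule ccontr)
    assume "\<beta> \<noteq> 0"
    then have \<beta>: "0 < \<beta>" by (simp add: \<beta>_def zero_less_measure_iff)
    obtain \<delta> \<kappa> H0 where \<delta>: "0 < \<delta>" "\<delta> < 1" and \<kappa>: "0 < \<kappa>"
      and cnt: "\<forall>H\<ge>H0. \<kappa> * H\<^sup>2 \<le> real (card {b \<in> L. \<delta> * H < snd b \<and> snd b \<le> H \<and> 0 \<le> val b \<and> val b < 1})"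
      using card_unit_interval by (elim exE conjE) (rule that)
    define K where "K = 1 / \<delta>"
    have K: "1 < K" using \<delta> by (simp add: K_def)
    define H where "H k = K ^ (k + 1)" for k :: nat
    have H1: "1 \<le> H k" for k unfolding H_def using K by (intro one_le_power) auto
    have Hmono: "H k \<le> H k'" if "k \<le> k'" for k k' unfolding H_def using K that by (intro power_increasing) auto
    define W where "W k = {b \<in> L. K ^ k < snd b \<and> snd b \<le> H k \<and> 0 \<le> val b \<and> val b < 1}" for k
    have W_eq: "W k = {b \<in> L. \<delta> * H k < snd b \<and> snd b \<le> H k \<and> 0 \<le> val b \<and> val b < 1}" for k
      using \<delta> by (simp add: W_def H_def K_def)
    have W: "finite (W k)" "real (card (W k)) \<le> 3 * (H k)\<^sup>2" for k
    proof -
      have win: "b \<in> L \<and> snd b \<le> H k \<and> \<bar>val b - 0\<bar> \<le> 1" if "b \<in> W k" for b using that by (auto simp: W_def)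
      show "finite (W k)" by (rule card_window(1)[OF H1 _ win]) auto
      have "real (card (W k)) \<le> 2 * 1 * (H k)\<^sup>2 + 1" by (rule card_window(2)[OF H1 _ win]) auto
      moreover have "1 \<le> (H k)\<^sup>2" using H1 by (simp add: one_le_power)
      ultimately show "real (card (W k)) \<le> 3 * (H k)\<^sup>2" by simp
    qed
    obtain k0 where k0: "H0 < K ^ k0" using real_arch_pow[OF K] by blast
    have big: "\<kappa> * (H k)\<^sup>2 \<le> real (card (W k))" if "k0 \<le> k" for k
    proof -
      have "K ^ k0 \<le> H k" unfolding H_def using K that by (intro power_increasing) auto
      then show ?thesis unfolding W_eq using cnt k0 by auto
    qed
    define r where "r k = 1 / ((real k + 1) * (H k)\<^sup>2)" for k
    have H2: "0 < (H k)\<^sup>2" for k using H1[of k] by simp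
    have r: "0 < r k" for k using H2[of k] by (simp add: r_def)
    have rmono: "r k' \<le> r k" if "k \<le> k'" for k k'
      unfolding r_def using that H1 H2 Hmono[OF that] order_trans[OF zero_le_one H1]
      by (intro divide_left_mono mult_mono power_mono mult_pos_pos) auto
    have rH: "r k * (H k)\<^sup>2 = 1 / (real k + 1)" for k using H2[of k] by (simp add: r_def)
    have rH1: "r k * (H k)\<^sup>2 \<le> 1" for k unfolding rH by simp
    have r1: "r k \<le> 1" for k
    proof -
      have "1 \<le> (H k)\<^sup>2" using H1 by (simp add: one_le_power)
      then have "r k * 1 \<le> r k * (H k)\<^sup>2" using r[of k] by (intro mult_left_mono) auto
      then show ?thesis using rH1[of k] by simp
    qed
    define I where "I i = {val (snd i) - r (fst i)..val (snd i)}" for i :: "nat \<times> real \<times> real"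
    have Imeas: "measure lborel (I (k, b)) = r k" for k b using r[of k] by (simp add: I_def)
    have Ile: "measure lborel (I (k, b) \<inter> I (k', b')) \<le> r k'" for k b k' b'
      unfolding Imeas[symmetric, of k' b'] by (intro measure_mono_fmeasurable) (auto simp: I_def fmeasurable_def emeasure_lborel_Icc_eq)
    have overlap: "(\<Sum>b'\<in>W k' - {b}. measure lborel (I (k, b) \<inter> I (k', b'))) \<le> 3 * r k / (real k' + 1)"
      if kk: "k \<le> k'" and b: "b \<in> W k" for k k' b
    proof -
      define N where "N = {b' \<in> W k' - {b}. I (k, b) \<inter> I (k', b') \<noteq> {}}"
      have near: "\<bar>val b' - val b\<bar> \<le> r k" if bN: "b' \<in> N" for b'
      proof -
        obtain x where "x \<in> I (k, b)" "x \<in> I (k', b')" using bN unfolding N_def by blast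
        then show ?thesis using rmono[OF kk] by (auto simp: I_def abs_le_iff)
      qed
      have win: "b' \<in> L \<and> snd b' \<le> H k' \<and> \<bar>val b' - val b\<bar> \<le> r k" if "b' \<in> N" for b'
        using near[OF that] that by (auto simp: N_def W_def)
      have finN: "finite N" using W(1)[of k'] by (simp add: N_def)
      have cN: "real (card N) \<le> 3 * (r k * (H k')\<^sup>2)"
      proof (cases "N = {}")
        case True
        then show ?thesis using r[of k] by simp
      next
        case False
        then obtain b' where b': "b' \<in> N" by auto
        then have bb: "b' \<in> L" "b \<in> L" "b' \<noteq> b" "snd b' \<le> H k'" "snd b \<le> H k" "0 < snd b" "0 < snd b'"
          using b den_pos by (auto simp: N_def W_def)
        have "1 / (H k * H k') \<le> 1 / (snd b' * snd b)"
          using bb by (intro divide_left_mono) (auto simp: mult.commute[of "snd b'"] intro!: mult_mono mult_pos_pos less_le_trans[OF zero_less_one H1])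
        also have "\<dots> \<le> \<bar>val b' - val b\<bar>" by (rule separation[OF bb(1-3)])
        also have "\<dots> \<le> r k" by (rule near[OF b'])
        \<comment> \<open>Squaring this gives \<open>1 \<le> r k (H k')\<^sup>2\<close>, which absorbs the additive \<open>1\<close> in the spacing bound.\<close>
        finally have "1 \<le> r k * (H k * H k')" using H1[of k] H1[of k'] by (simp add: pos_divide_le_eq)
        then have "1\<^sup>2 \<le> (r k * (H k * H k'))\<^sup>2" by (intro power_mono) auto
        also have "\<dots> = (r k * (H k)\<^sup>2) * (r k * (H k')\<^sup>2)" by (simp add: power2_eq_square mult_ac)
        also have "\<dots> \<le> 1 * (r k * (H k')\<^sup>2)" using rH1[of k] r[of k] by (intro mult_right_mono) auto
        finally have "1 \<le> r k * (H k')\<^sup>2" by simp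
        moreover have "real (card N) \<le> 2 * r k * (H k')\<^sup>2 + 1"
          by (rule card_window(2)[OF H1 _ win]) (use r[of k] in auto)
        ultimately show ?thesis by simp
      qed
      have "(\<Sum>b'\<in>W k' - {b}. measure lborel (I (k, b) \<inter> I (k', b'))) = (\<Sum>b'\<in>N. measure lborel (I (k, b) \<inter> I (k', b')))"
        by (rule sum.mono_neutral_right) (use W(1)[of k'] in \<open>auto simp: N_def\<close>)
      also have "\<dots> \<le> (\<Sum>b'\<in>N. r k')" by (intro sum_mono Ile)
      also have "\<dots> = real (card N) * r k'" by simp
      also have "\<dots> \<le> 3 * (r k * (H k')\<^sup>2) * r k'" using cN r[of k'] by (intro mult_right_mono) auto
      also have "\<dots> = 3 * r k * (r k' * (H k')\<^sup>2)" by simp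
      also have "\<dots> = 3 * r k / (real k' + 1)" unfolding rH by simp
      finally show ?thesis .
    qed
    define D where "D k k' = (\<Sum>b\<in>W k. \<Sum>b'\<in>W k'. measure lborel (I (k, b) \<inter> I (k', b')))" for k k'
    have D_le: "D k k' \<le> 9 * (1 / (real k + 1)) * (1 / (real k' + 1)) + (if k = k' then 3 / (real k + 1) else 0)"
      if kk: "k \<le> k'" for k k'
    proof -
      have inner: "(\<Sum>b'\<in>W k'. measure lborel (I (k, b) \<inter> I (k', b'))) \<le> 3 * r k / (real k' + 1) + (if k = k' then r k else 0)"
        if b: "b \<in> W k" for b
      proof (cases "k = k'")
        case True
        then have "(\<Sum>b'\<in>W k'. measure lborel (I (k, b) \<inter> I (k', b'))) =
          measure lborel (I (k, b) \<inter> I (k', b)) + (\<Sum>b'\<in>W k' - {b}. measure lborel (I (k, b) \<inter> I (k', b')))"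
          using b W(1)[of k'] by (intro sum.remove) auto
        then show ?thesis using overlap[OF kk b] True by (simp add: Imeas)
      next
        case False
        then have "K ^ (k + 1) \<le> K ^ k'" using K kk by (intro power_increasing) auto
        then have "b \<notin> W k'" using b by (auto simp: W_def H_def)
        then have "W k' - {b} = W k'" by simp
        then show ?thesis using overlap[OF kk b] False by simp
      qed
      have "D k k' \<le> (\<Sum>b\<in>W k. 3 * r k / (real k' + 1) + (if k = k' then r k else 0))"
        unfolding D_def by (intro sum_mono inner)
      also have "\<dots> = real (card (W k)) * (r k * (3 / (real k' + 1) + (if k = k' then 1 else 0)))"
        by (simp add: algebra_simps)
      also have "\<dots> \<le> 3 * (H k)\<^sup>2 * (r k * (3 / (real k' + 1) + (if k = k' then 1 else 0)))"
        using W(2)[of k] r[of k] by (intro mult_right_mono mult_nonneg_nonneg add_nonneg_nonneg) auto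
      also have "\<dots> = 3 * (r k * (H k)\<^sup>2) * (3 / (real k' + 1) + (if k = k' then 1 else 0))" by simp
      also have "\<dots> = 9 * (1 / (real k + 1)) * (1 / (real k' + 1)) + (if k = k' then 3 / (real k + 1) else 0)"
        unfolding rH by (simp add: algebra_simps)
      finally show ?thesis .
    qed
    have D_sym: "D k k' = D k' k" for k k'
      unfolding D_def by (subst sum.swap) (simp add: Int_commute)
    have D: "D k k' \<le> 9 * (1 / (real k + 1)) * (1 / (real k' + 1)) + (if k = k' then 3 / (real k + 1) else 0)" for k k'
      using D_le[of k k'] D_le[of k' k] D_sym[of k k'] by (cases "k \<le> k'") (auto simp: mult_ac)
    define T where "T n = {k0..<k0 + n}" for n
    define P where "P n = Sigma (T n) W" for n
    define S where "S n = (\<Sum>k\<in>T n. 1 / (real k + 1))" for n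
    have S_harm: "S n = harm (k0 + n) - harm k0" for n
      by (induction n) (simp_all add: S_def T_def harm_def inverse_eq_divide add.commute)
    show False
    proof (rule second_moment[where P = P and J = I and S = S and E = ill_approx and c = "\<kappa> * \<beta> / 18" and C = 9])
      show "finite (P n)" for n unfolding P_def T_def using W(1) by auto
      show "I i \<in> sets borel" for i by (simp add: I_def)
      show "I i \<subseteq> {-1..1}" if "i \<in> P n" for i n
      proof -
        obtain k b where "i = (k, b)" "b \<in> W k" using \<open>i \<in> P n\<close> by (auto simp: P_def)
        then show ?thesis using r1[of k] by (auto simp: I_def W_def)
      qed
      show "ill_approx \<in> sets borel" by simp
      show "0 < \<kappa> * \<beta> / 18" "(0::real) < 9" using \<kappa> \<beta> by auto
      have "filterlim (\<lambda>n. - harm k0 + (harm (n + k0) :: real)) at_top sequentially"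
        by (intro filterlim_tendsto_add_at_top[OF tendsto_const]
            filterlim_compose[OF harm_at_top] filterlim_add_const_nat_at_top)
      then show "filterlim S at_top sequentially"
        unfolding S_harm by (simp add: add.commute)
      show "\<kappa> * \<beta> / 18 * S n \<le> (\<Sum>i\<in>P n. measure lborel (ill_approx \<inter> I i))" for n
      proof -
        have "\<kappa> * \<beta> / 18 * S n = (\<Sum>k\<in>T n. \<kappa> * (r k * (H k)\<^sup>2) * (\<beta> / 18))"
          unfolding rH S_def sum_distrib_left by (intro sum.cong) auto
        also have "\<dots> \<le> (\<Sum>k\<in>T n. \<Sum>b\<in>W k. measure lborel (ill_approx \<inter> I (k, b)))"
        proof (rule sum_mono)
          fix k assume k: "k \<in> T n"
          have "\<kappa> * (r k * (H k)\<^sup>2) * (\<beta> / 18) = (\<kappa> * (H k)\<^sup>2) * (\<beta> * r k / 18)" by simp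
          also have "\<dots> \<le> real (card (W k)) * (\<beta> * r k / 18)"
            using big[of k] k \<beta> r[of k] by (intro mult_right_mono) (auto simp: T_def)
          also have "\<dots> = (\<Sum>b\<in>W k. \<beta> * r k / 18)" by simp
          also have "\<dots> \<le> (\<Sum>b\<in>W k. measure lborel (ill_approx \<inter> I (k, b)))"
          proof (rule sum_mono)
            fix b assume b: "b \<in> W k"
            then have q: "b \<in> L" "0 < snd b" "snd b \<le> H k" using den_pos by (auto simp: W_def)
            have "(snd b)\<^sup>2 \<le> (H k)\<^sup>2" using q by (intro power_mono) auto
            then have "r k * (snd b)\<^sup>2 \<le> r k * (H k)\<^sup>2" using r[of k] by (intro mult_left_mono) auto
            then have "r k * (snd b)\<^sup>2 \<le> 1" using rH1[of k] by linarith
            then have "r k \<le> 1 / (snd b)\<^sup>2" using q by (simp add: pos_le_divide_eq)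
            from ill_approx_near_fraction[OF q(1) r this]
            show "\<beta> * r k / 18 \<le> measure lborel (ill_approx \<inter> I (k, b))" by (simp add: \<beta>_def I_def)
          qed
          finally show "\<kappa> * (r k * (H k)\<^sup>2) * (\<beta> / 18) \<le> (\<Sum>b\<in>W k. measure lborel (ill_approx \<inter> I (k, b)))" .
        qed
        also have "\<dots> = (\<Sum>i\<in>P n. measure lborel (ill_approx \<inter> I i))"
          unfolding P_def using W(1) by (subst sum.Sigma) (auto simp: T_def split_def)
        finally show ?thesis .
      qed
      show "(\<Sum>i\<in>P n. \<Sum>j\<in>P n. measure lborel (I i \<inter> I j)) \<le> 9 * (S n)\<^sup>2 + 9 * S n" for n
      proof -
        have fT: "finite (T n)" by (simp add: T_def)
        have S0: "0 \<le> S n" unfolding S_def by (intro sum_nonneg) auto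
        have sig: "(\<Sum>i\<in>P n. g i) = (\<Sum>k\<in>T n. \<Sum>b\<in>W k. g (k, b))" for g :: "nat \<times> real \<times> real \<Rightarrow> real"
          unfolding P_def using W(1) fT by (subst sum.Sigma) (auto simp: split_def)
        have "(\<Sum>i\<in>P n. \<Sum>j\<in>P n. measure lborel (I i \<inter> I j)) =
          (\<Sum>k\<in>T n. \<Sum>b\<in>W k. \<Sum>k'\<in>T n. \<Sum>b'\<in>W k'. measure lborel (I (k, b) \<inter> I (k', b')))"
          unfolding sig ..
        also have "\<dots> = (\<Sum>k\<in>T n. \<Sum>k'\<in>T n. D k k')"
          unfolding D_def by (intro sum.cong refl sum.swap)
        also have "\<dots> \<le> (\<Sum>k\<in>T n. \<Sum>k'\<in>T n. 9 * (1 / (real k + 1)) * (1 / (real k' + 1)) + (if k = k' then 3 / (real k + 1) else 0))"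
          by (intro sum_mono D)
        also have "\<dots> = (\<Sum>k\<in>T n. \<Sum>k'\<in>T n. 9 * (1 / (real k + 1)) * (1 / (real k' + 1))) + (\<Sum>k\<in>T n. 3 / (real k + 1))"
          using fT by (simp add: sum.distrib sum.delta')
        also have "(\<Sum>k\<in>T n. \<Sum>k'\<in>T n. 9 * (1 / (real k + 1)) * (1 / (real k' + 1))) = 9 * (S n)\<^sup>2"
          unfolding S_def power2_eq_square sum_product by (simp only: sum_distrib_left mult.assoc)
        also have "(\<Sum>k\<in>T n. 3 / (real k + 1)) = 3 * S n"
          unfolding S_def sum_distrib_left by simp
        finally show ?thesis using S0 by simp
      qed
      show "\<exists>B::nat. \<forall>n. (\<Sum>i\<in>P n. indicator (I i) x) \<le> real B" if x: "x \<in> ill_approx" for x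
      proof -
        obtain C :: nat where C: "ln K \<le> real C" using real_arch_simple by blast
        have "\<exists>N::nat. \<forall>b\<in>L. real N \<le> snd b \<longrightarrow> real C < approx x b * ln (snd b)"
          using x unfolding ill_approx_def well_approx_def mem_Collect_eq by (meson not_le)
        then obtain N :: nat where N: "\<And>b. b \<in> L \<Longrightarrow> real N \<le> snd b \<Longrightarrow> real C < approx x b * ln (snd b)"
          by blast
        obtain k1 where k1: "real N < K ^ k1" using real_arch_pow[OF K] by blast
        define Q where "Q = Sigma {..<k1} W"
        have finQ: "finite Q" unfolding Q_def using W(1) by auto
        have out: "x \<notin> I i" if i: "i \<in> P n" "i \<notin> Q" for i n
        proof
          assume xI: "x \<in> I i"
          obtain k b where kb: "i = (k, b)" "b \<in> W k" "k1 \<le> k" using i by (auto simp: P_def Q_def not_less[symmetric])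
          have b: "b \<in> L" "K ^ k < snd b" "snd b \<le> H k" "0 < snd b" "1 \<le> snd b"
            using kb(2) den_pos den_ge_1 by (auto simp: W_def)
          have "K ^ k1 \<le> K ^ k" using K kb by (intro power_increasing) auto
          then have "real N \<le> snd b" using k1 b by linarith
          then have "real C < approx x b * ln (snd b)" using N b by blast
          moreover have "approx x b * ln (snd b) \<le> ln K"
          proof -
            have d: "\<bar>x - val b\<bar> \<le> r k" using xI by (auto simp: kb I_def)
            have "(snd b)\<^sup>2 \<le> (H k)\<^sup>2" using b by (intro power_mono) auto
            then have "approx x b \<le> (H k)\<^sup>2 * r k"
              unfolding approx_eq[OF b(1)] using d H2[of k] by (intro mult_mono) auto
            then have a: "approx x b \<le> 1 / (real k + 1)" using rH[of k] by (simp add: mult.commute)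
            have "ln (snd b) \<le> ln (H k)" using b by (intro ln_mono) auto
            also have "\<dots> = (real k + 1) * ln K" using K by (simp add: H_def ln_realpow add.commute del: power_Suc)
            finally have l: "ln (snd b) \<le> (real k + 1) * ln K" .
            have "approx x b * ln (snd b) \<le> (1 / (real k + 1)) * ((real k + 1) * ln K)"
              using a l b by (intro mult_mono) auto
            then show ?thesis by simp
          qed
          ultimately show False using C by linarith
        qed
        have "(\<Sum>i\<in>P n. indicator (I i) x) \<le> real (card Q)" for n
        proof -
          have fP: "finite (P n)" unfolding P_def T_def using W(1) by auto
          have "(\<Sum>i\<in>P n. indicator (I i) x) = (\<Sum>i\<in>P n \<inter> Q. indicator (I i) x :: real)"
            using out[of _ n] fP by (intro sum.mono_neutral_right) auto
          also have "\<dots> \<le> (\<Sum>i\<in>P n \<inter> Q. 1)" by (intro sum_mono) (auto split: split_indicator)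
          also have "\<dots> \<le> real (card Q)" using finQ by (simp add: card_mono)
          finally show ?thesis .
        qed
        then show ?thesis by blast
      qed
    qed
  qed
  then have "emeasure lborel (ill_approx \<inter> {0..<1}) = 0"
    using emeasure_mono[of "ill_approx \<inter> {0..<1}" "{0..<1}" lborel]
    by (subst emeasure_eq_ennreal_measure) (auto simp: \<beta>_def top_unique)
  then have "ill_approx \<inter> {0..<1} \<in> null_sets lborel" by (simp add: null_sets_def)
  then have "AE x in lborel. x \<notin> ill_approx \<inter> {0..<1}" by (rule AE_not_in)
  then show ?thesis by eventually_elim (auto simp: ill_approx_def)
qed

end

section \<open>Excursions of vertical geodesics\<close>

lemma hdist_eq_iff:
  assumes "0 < Im z" "0 < Im w" "0 < Im z'" "0 < Im w'"
  shows "hdist z w = hdist z' w' \<longleftrightarrow>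
    (cmod (z - w))\<^sup>2 / (2 * Im z * Im w) = (cmod (z' - w'))\<^sup>2 / (2 * Im z' * Im w')"
proof
  assume eq: "hdist z w = hdist z' w'"
  have "1 \<le> 1 + (cmod (z - w))\<^sup>2 / (2 * Im z * Im w)" "1 \<le> 1 + (cmod (z' - w'))\<^sup>2 / (2 * Im z' * Im w')"
    using assms by simp_all
  then have "1 + (cmod (z - w))\<^sup>2 / (2 * Im z * Im w) = 1 + (cmod (z' - w'))\<^sup>2 / (2 * Im z' * Im w')"
    using eq unfolding hdist_def by (metis cosh_arcosh_real)
  then show "(cmod (z - w))\<^sup>2 / (2 * Im z * Im w) = (cmod (z' - w'))\<^sup>2 / (2 * Im z' * Im w')" by simp
qed (simp add: hdist_def)

lemma hdist_act:
  assumes A: "unimodular A" and z: "0 < Im z" and w: "0 < Im w"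
  shows "hdist (act A z) (act A w) = hdist z w"
proof -
  define dz dw where "dz = of_real (A$2$1) * z + of_real (A$2$2)" and "dw = of_real (A$2$1) * w + of_real (A$2$2)"
  have nz: "dz \<noteq> 0" "dw \<noteq> 0" using denom_nz[OF A z] denom_nz[OF A w] by (auto simp: dz_def dw_def)
  have c: "complex_of_real (A$1$1) * of_real (A$2$2) - of_real (A$1$2) * of_real (A$2$1) = 1"
    using A by (metis of_real_1 of_real_diff of_real_mult)
  have "act A z - act A w = ((of_real (A$1$1) * z + of_real (A$1$2)) * dw - (of_real (A$1$1) * w + of_real (A$1$2)) * dz) / (dz * dw)"
    unfolding act_eq dz_def[symmetric] dw_def[symmetric] by (rule diff_frac_eq[OF nz])
  also have "(of_real (A$1$1) * z + of_real (A$1$2)) * dw - (of_real (A$1$1) * w + of_real (A$1$2)) * dz =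
    (of_real (A$1$1) * of_real (A$2$2) - of_real (A$1$2) * of_real (A$2$1)) * (z - w)"
    by (simp add: dz_def dw_def algebra_simps)
  finally have d: "(cmod (act A z - act A w))\<^sup>2 = (cmod (z - w))\<^sup>2 / ((cmod dz)\<^sup>2 * (cmod dw)\<^sup>2)"
    by (simp add: c norm_divide norm_mult power_divide power_mult_distrib)
  have i: "Im (act A z) = Im z / (cmod dz)\<^sup>2" "Im (act A w) = Im w / (cmod dw)\<^sup>2"
    using Im_act[OF A z] Im_act[OF A w] by (simp_all add: dz_def dw_def)
  have "(cmod (act A z - act A w))\<^sup>2 / (2 * Im (act A z) * Im (act A w)) = (cmod (z - w))\<^sup>2 / (2 * Im z * Im w)"
    unfolding d i using nz by (simp add: field_simps)
  then show ?thesis by (simp add: hdist_def)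
qed

lemma Im_vertical: "Im (vertical x t) = 2 * exp (- t)" "0 < Im (vertical x t)" "Re (vertical x t) = x"
  by (simp_all add: vertical_def)

text \<open>
  The distances of a point to two points of a vertical line determine its height and its
  distance to the line.
\<close>
lemma geodesic_eq_vertical:
  assumes \<delta>: "unit_speed_geodesic \<delta>" and st: "s \<noteq> t"
    and eq: "\<delta> s = vertical x s" "\<delta> t = vertical x t"
  shows "\<delta> r = vertical x r"
proof -
  define u v y where "u = Re (\<delta> r) - x" and "v = Im (\<delta> r)" and "y = Im (vertical x r)"
  have v: "0 < v" using \<delta> by (simp add: unit_speed_geodesic_def halfplane_def v_def)
  have y: "0 < y" using Im_vertical(2) by (simp add: y_def)
  have key: "(u\<^sup>2 + v\<^sup>2 + (Im (vertical x s))\<^sup>2) * y = (y\<^sup>2 + (Im (vertical x s))\<^sup>2) * v" if "\<delta> s = vertical x s" for s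
  proof -
    define a where "a = Im (vertical x s)"
    have a: "0 < a" using Im_vertical(2) by (simp add: a_def)
    have "hdist (\<delta> r) (\<delta> s) = hdist (vertical x r) (vertical x s)"
      using \<delta> unit_speed_geodesic_vertical[of x] by (simp add: unit_speed_geodesic_def)
    then have "(cmod (\<delta> r - vertical x s))\<^sup>2 / (2 * v * a) = (cmod (vertical x r - vertical x s))\<^sup>2 / (2 * y * a)"
      unfolding that using hdist_eq_iff[of "\<delta> r" "vertical x s" "vertical x r" "vertical x s"] v Im_vertical(2)
      by (simp add: v_def y_def a_def)
    moreover have "(cmod (\<delta> r - vertical x s))\<^sup>2 = u\<^sup>2 + (v - a)\<^sup>2"
      by (simp add: cmod_power2 u_def v_def a_def Im_vertical(3))
    moreover have "(cmod (vertical x r - vertical x s))\<^sup>2 = (y - a)\<^sup>2"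
      by (simp add: cmod_power2 y_def a_def Im_vertical(3))
    ultimately have "(u\<^sup>2 + (v - a)\<^sup>2) / (2 * v * a) = (y - a)\<^sup>2 / (2 * y * a)" by simp
    then have "(u\<^sup>2 + (v - a)\<^sup>2) * (2 * y * a) = (y - a)\<^sup>2 * (2 * v * a)"
      using v y a by (simp add: frac_eq_eq)
    then have "2 * a * ((u\<^sup>2 + (v - a)\<^sup>2) * y) = 2 * a * ((y - a)\<^sup>2 * v)" by (simp add: mult_ac)
    then have "(u\<^sup>2 + (v - a)\<^sup>2) * y = (y - a)\<^sup>2 * v" using a by simp
    then show ?thesis unfolding a_def[symmetric] by (simp add: power2_eq_square algebra_simps)
  qed
  define a b where "a = Im (vertical x s)" and "b = Im (vertical x t)"
  have ab: "0 < a" "0 < b" "a \<noteq> b" using st by (auto simp: a_def b_def Im_vertical)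
  have k: "(u\<^sup>2 + v\<^sup>2 + a\<^sup>2) * y = (y\<^sup>2 + a\<^sup>2) * v" "(u\<^sup>2 + v\<^sup>2 + b\<^sup>2) * y = (y\<^sup>2 + b\<^sup>2) * v"
    using key[OF eq(1)] key[OF eq(2)] by (simp_all add: a_def b_def)
  have "(a\<^sup>2 - b\<^sup>2) * y = (a\<^sup>2 - b\<^sup>2) * v"
    using k by (simp add: algebra_simps)
  moreover have "a\<^sup>2 - b\<^sup>2 \<noteq> 0" using ab by (simp add: power2_eq_iff)
  ultimately have vy: "v = y" by simp
  then have "(u\<^sup>2 + y\<^sup>2 + a\<^sup>2) * y = (y\<^sup>2 + a\<^sup>2) * y" using k(1) by simp
  then have "u = 0" using y by simp
  then show ?thesis using vy by (simp add: complex_eq_iff u_def v_def y_def Im_vertical)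
qed

context zonal
begin

lemma unit_speed_act:
  assumes "A \<in> M" "unit_speed_geodesic \<delta>"
  shows "unit_speed_geodesic (\<lambda>t. act A (\<delta> t))"
  using assms Im_act_pos[OF det_M[OF assms(1)]] hdist_act[OF det_M[OF assms(1)]]
  by (simp add: unit_speed_geodesic_def halfplane_def)

lemma proj_act:
  assumes A: "A \<in> M" and z: "0 < Im z"
  shows "proj \<Gamma> (act A z) = proj \<Gamma> z"
proof -
  have "proj \<Gamma> (act B w) \<subseteq> proj \<Gamma> w" if "B \<in> M" "0 < Im w" for B w
  proof
    fix u assume "u \<in> proj \<Gamma> (act B w)"
    then obtain C where C: "C \<in> M" "u = act C (act B w)" by (auto simp: proj_def M_def[symmetric])
    then have "u = act (C ** B) w" using act_mult[OF det_M[OF that(1)] that(2)] by simp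
    then show "u \<in> proj \<Gamma> w" using M_mult[OF C(1) that(1)] by (auto simp: proj_def M_def[symmetric])
  qed
  note * = this
  have "proj \<Gamma> z = proj \<Gamma> (act (inv2 A) (act A z))"
    using act_inv2(1)[OF det_M[OF A] z] by simp
  also have "\<dots> \<subseteq> proj \<Gamma> (act A z)"
    using *[OF M_inv[OF A] Im_act_pos[OF det_M[OF A] z]] .
  finally show ?thesis using *[OF A z] by blast
qed

abbreviation (input) moved :: "real^2^2 \<Rightarrow> real \<Rightarrow> real \<Rightarrow> complex" where
  "moved A x \<equiv> \<lambda>t. act A (vertical x t)"

text \<open>
  For every time some matrix moves the vertical geodesic to the lift at that time. There are
  uncountably many times and countably many matrices, so one matrix does this at two different
  times, hence always.
\<close>
lemma is_lift_iff: "is_lift \<Gamma> (beta \<Gamma> x) \<delta> \<longleftrightarrow> (\<exists>A\<in>M. \<delta> = moved A x)"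
proof
  assume lift: "is_lift \<Gamma> (beta \<Gamma> x) \<delta>"
  then have us: "unit_speed_geodesic \<delta>" by (simp add: is_lift_def)
  have "\<exists>A\<in>M. \<delta> t = act A (vertical x t)" for t
  proof -
    have "\<delta> t \<in> proj \<Gamma> (\<delta> t)"
      using M_one act_one by (force simp: proj_def M_def[symmetric])
    then show ?thesis using lift by (auto simp: is_lift_def beta_def proj_def M_def[symmetric])
  qed
  then obtain A where A: "\<And>t. A t \<in> M" "\<And>t. \<delta> t = act (A t) (vertical x t)" by metis
  have "\<not> inj A"
  proof
    assume "inj A"
    moreover have "range A \<subseteq> M" using A(1) by auto
    then have "countable (range A)" using countable_M by (rule countable_subset)
    ultimately have "countable (UNIV :: real set)" using countable_image_inj_on by blast
    then show False using uncountable_UNIV_real by simp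
  qed
  then obtain s t where st: "s \<noteq> t" "A s = A t" by (auto simp: inj_def)
  define B where "B = A s"
  have B: "B \<in> M" using A by (simp add: B_def)
  have us': "unit_speed_geodesic (\<lambda>t. act (inv2 B) (\<delta> t))"
    by (rule unit_speed_act[OF M_inv[OF B] us])
  have e: "act (inv2 B) (\<delta> s) = vertical x s" "act (inv2 B) (\<delta> t) = vertical x t"
    unfolding A(2) st(2)[symmetric] B_def[symmetric]
    using act_inv2(1)[OF det_M[OF B]] Im_vertical(2) by auto
  have "\<delta> r = act B (vertical x r)" for r
  proof -
    have "act (inv2 B) (\<delta> r) = vertical x r"
      by (rule geodesic_eq_vertical[OF us' st(1) e])
    moreover have "0 < Im (\<delta> r)" using us by (simp add: unit_speed_geodesic_def halfplane_def)
    ultimately show ?thesis using act_inv2(2)[OF det_M[OF B], of "\<delta> r"] by simp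
  qed
  then show "\<exists>A\<in>M. \<delta> = moved A x" using B by blast
next
  assume "\<exists>A\<in>M. \<delta> = moved A x"
  then obtain A where A: "A \<in> M" "\<delta> = moved A x" by blast
  then show "is_lift \<Gamma> (beta \<Gamma> x) \<delta>"
    using unit_speed_act[OF A(1) unit_speed_geodesic_vertical] proj_act[OF A(1) Im_vertical(2)]
    by (simp add: is_lift_def beta_def)
qed

text \<open>
  The velocity at height \<open>y\<close> is \<open>- \<i> y / (c z + d)\<^sup>2\<close>; it is horizontal when the real
  part of \<open>(c z + d)\<^sup>2\<close> vanishes.
\<close>
lemma tangent_iff:
  assumes A: "A \<in> M"
  shows "tangent_horoball (moved A x) t m \<longleftrightarrow>
    (A$2$1 * x + A$2$2)\<^sup>2 = (A$2$1 * (2 * exp (- t)))\<^sup>2 \<and> Im (act A (vertical x t)) = m"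
proof -
  define z where "z = vertical x t"
  define y where "y = 2 * exp (- t)"
  have z: "z = Complex x y" "0 < Im z" "0 < y" by (simp_all add: z_def y_def vertical_def)
  define w where "w = of_real (A$2$1) * z + of_real (A$2$2)"
  have w: "w \<noteq> 0" using denom_nz[OF det_M[OF A] z(2)] by (simp add: w_def)
  define D where "D = - (\<i> * of_real y) * (1 / w\<^sup>2)"
  have dv: "(vertical x has_vector_derivative - (\<i> * of_real y)) (at t)"
  proof -
    have "((\<lambda>t. of_real x + \<i> * of_real (2 * exp (- t))) has_vector_derivative - (\<i> * of_real y)) (at t)"
      unfolding has_vector_derivative_complex_iff by (auto simp: y_def intro!: derivative_eq_intros)
    moreover have "(\<lambda>t. of_real x + \<i> * of_real (2 * exp (- t))) = vertical x"
      by (auto simp: vertical_def complex_eq_iff)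
    ultimately show ?thesis by simp
  qed
  have der: "((moved A x) has_vector_derivative D) (at t)"
    using field_vector_diff_chain_at[OF dv, of "act A" "1 / w\<^sup>2"] has_field_derivative_act[OF det_M[OF A] z(2)]
    by (simp add: o_def D_def w_def z_def)
  have D0: "D \<noteq> 0" using w z(3) by (simp add: D_def)
  have "D = - (\<i> * of_real y) * cnj (w\<^sup>2) / of_real ((cmod (w\<^sup>2))\<^sup>2)"
    unfolding D_def by (simp add: complex_div_cnj[of 1])
  moreover have "Re ((cnj w)\<^sup>2) = Re (w\<^sup>2)" by (simp add: power2_eq_square)
  ultimately have "Im D = - y * Re (w\<^sup>2) / (cmod (w\<^sup>2))\<^sup>2"
    by (simp add: complex_is_Real_iff Im_divide_of_real)
  then have "Im D = 0 \<longleftrightarrow> Re (w\<^sup>2) = 0" using w z(3) by simp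
  also have "Re (w\<^sup>2) = (A$2$1 * x + A$2$2)\<^sup>2 - (A$2$1 * y)\<^sup>2"
    by (simp add: w_def z(1) power2_eq_square)
  finally have ImD: "Im D = 0 \<longleftrightarrow> (A$2$1 * x + A$2$2)\<^sup>2 = (A$2$1 * y)\<^sup>2" by simp
  have "(\<exists>v. v \<noteq> 0 \<and> ((moved A x) has_vector_derivative complex_of_real v) (at t)) \<longleftrightarrow> Im D = 0"
  proof
    assume "\<exists>v. v \<noteq> 0 \<and> ((moved A x) has_vector_derivative complex_of_real v) (at t)"
    then obtain v where "((moved A x) has_vector_derivative complex_of_real v) (at t)" by blast
    then have "D = complex_of_real v" using der vector_derivative_unique_at by blast
    then show "Im D = 0" by simp
  next
    assume "Im D = 0"
    then have e: "D = complex_of_real (Re D)" by (simp add: complex_eq_iff)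
    then have "Re D \<noteq> 0" using D0 by auto
    then show "\<exists>v. v \<noteq> 0 \<and> ((moved A x) has_vector_derivative complex_of_real v) (at t)"
      using der e by metis
  qed
  then show ?thesis unfolding tangent_horoball_def ImD y_def[symmetric] by auto
qed

text \<open>
  The bottom row \<open>(-q, p)\<close> means that \<open>p/q\<close> is moved to infinity; the matrix is determined up to
  integer translations.
\<close>
definition uncusp :: "real \<times> real \<Rightarrow> real^2^2" where
  "uncusp b = (SOME A. A \<in> M \<and> A$2$1 = - snd b \<and> A$2$2 = fst b)"

lemma uncusp: "b \<in> L \<Longrightarrow> uncusp b \<in> M \<and> uncusp b $2$1 = - snd b \<and> uncusp b $2$2 = fst b"
  unfolding uncusp_def
proof (rule someI_ex)
  assume "b \<in> L"
  then obtain g where "g \<in> M" "g$1$1 = fst b" "g$2$1 = snd b" by (auto simp: L_iff)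
  then show "\<exists>A. A \<in> M \<and> A$2$1 = - snd b \<and> A$2$2 = fst b"
    by (intro exI[of _ "inv2 g"]) (auto intro: M_inv)
qed

text \<open>
  Excluded are the fractions themselves, midpoints of two fractions (where two excursions would
  have the same parameter), and points whose images under the group are integers (where no
  translate of a lift has its endpoints in \<^const>\<open>J_set\<close>).
\<close>
definition generic :: "real \<Rightarrow> bool" where
  "generic x \<longleftrightarrow> (\<forall>b\<in>L. x \<noteq> val b) \<and> inj_on (\<lambda>b. \<bar>x - val b\<bar>) L \<and>
    (\<forall>A\<in>M. A$2$1 * x + A$2$2 \<noteq> 0 \<longrightarrow> real_act A x \<notin> \<int>)"

lemma AE_generic: "AE x in lborel. generic x"
proof -
  define N1 where "N1 = val ` L"
  define N2 where "N2 = (\<lambda>(a, b). (val a + val b) / 2) ` (L \<times> L)"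
  define N3 where "N3 = (\<lambda>(A, n). (of_int n * A$2$2 - A$1$2) / (A$1$1 - of_int n * A$2$1)) ` (M \<times> (UNIV :: int set))"
  have "countable (N1 \<union> N2 \<union> N3)"
    unfolding N1_def N2_def N3_def using countable_L countable_M by auto
  then have "N1 \<union> N2 \<union> N3 \<in> null_sets lborel" by (rule countable_imp_null_set_lborel)
  then have "AE x in lborel. x \<notin> N1 \<union> N2 \<union> N3" by (rule AE_not_in)
  then show ?thesis
  proof eventually_elim
    case (elim x)
    have "\<forall>b\<in>L. x \<noteq> val b" using elim by (auto simp: N1_def)
    moreover have "inj_on (\<lambda>b. \<bar>x - val b\<bar>) L"
    proof (rule inj_onI, rule ccontr)
      fix a b assume ab: "a \<in> L" "b \<in> L" "\<bar>x - val a\<bar> = \<bar>x - val b\<bar>" "a \<noteq> b"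
      have "0 < 1 / (snd a * snd b)" using den_pos ab by simp
      then have "val a \<noteq> val b" using separation[OF ab(1,2,4)] by auto
      then have "x = (val a + val b) / 2" using ab(3) by (auto simp: abs_eq_iff)
      then have "x \<in> N2" using ab by (force simp: N2_def)
      then show False using elim by simp
    qed
    moreover have "real_act A x \<notin> \<int>" if A: "A \<in> M" "A$2$1 * x + A$2$2 \<noteq> 0" for A
    proof
      assume "real_act A x \<in> \<int>"
      then obtain n :: int where "real_act A x = of_int n" by (elim Ints_cases)
      then have e: "A$1$1 * x + A$1$2 = of_int n * (A$2$1 * x + A$2$2)"
        using A(2) by (simp add: real_act_def field_simps)
      have "A$1$1 - of_int n * A$2$1 \<noteq> 0"
      proof
        assume 0: "A$1$1 - of_int n * A$2$1 = 0"
        then have a: "A$1$1 = of_int n * A$2$1" by simp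
        then have "A$1$2 = of_int n * A$2$2" using e by (simp add: algebra_simps)
        then show False using det_M[OF A(1)] a by simp
      qed
      then have "x = (of_int n * A$2$2 - A$1$2) / (A$1$1 - of_int n * A$2$1)"
        using e by (simp add: field_simps)
      then have "x \<in> N3" using A(1) by (force simp: N3_def)
      then show False using elim by simp
    qed
    ultimately show ?case unfolding generic_def by blast
  qed
qed

context
  fixes x :: real
  assumes x: "generic x"
begin

lemma irr: "b \<in> L \<Longrightarrow> x \<noteq> val b"
  using x by (auto simp: generic_def)

lemma time_inj: "a \<in> L \<Longrightarrow> b \<in> L \<Longrightarrow> time x a = time x b \<Longrightarrow> a = b"
proof -
  assume ab: "a \<in> L" "b \<in> L" "time x a = time x b"
  have "0 < \<bar>x - val a\<bar>" "0 < \<bar>x - val b\<bar>" using irr ab by auto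
  then have "\<bar>x - val a\<bar> = \<bar>x - val b\<bar>" using ab(3) by (simp add: time_def)
  then show ?thesis using x ab unfolding generic_def inj_on_def by blast
qed

lemma time_eq_iff: "b \<in> L \<Longrightarrow> t = time x b \<longleftrightarrow> 2 * exp (- t) = \<bar>x - val b\<bar>"
proof -
  assume "b \<in> L"
  then have p: "0 < \<bar>x - val b\<bar>" using irr by simp
  have "t = time x b \<longleftrightarrow> exp t = 2 / \<bar>x - val b\<bar>"
    unfolding time_def using p by (metis divide_pos_pos exp_ln ln_exp zero_less_numeral)
  also have "\<dots> \<longleftrightarrow> 2 * exp (- t) = \<bar>x - val b\<bar>"
    using p by (auto simp: exp_minus field_simps)
  finally show ?thesis .
qed

lemma tangent_uncusp:
  assumes A: "A \<in> M" "A$2$1 = - snd b" "A$2$2 = fst b" and b: "b \<in> L"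
  shows "tangent_horoball (moved A x) t m \<longleftrightarrow> t = time x b \<and> m = 1 / (2 * approx x b)"
proof -
  define y where "y = 2 * exp (- t)"
  have y: "0 < y" by (simp add: y_def)
  have q: "0 < snd b" using den_pos b by simp
  have p: "0 < \<bar>x - val b\<bar>" using irr b by simp
  have dx: "A$2$1 * x + A$2$2 = - snd b * (x - val b)"
    using q by (simp add: A val_def field_simps)
  have sq: "(A$2$1 * x + A$2$2)\<^sup>2 = (A$2$1 * y)\<^sup>2 \<longleftrightarrow> t = time x b"
  proof -
    have "(A$2$1 * x + A$2$2)\<^sup>2 = (A$2$1 * y)\<^sup>2 \<longleftrightarrow> \<bar>x - val b\<bar> = y"
      unfolding dx using q y by (simp add: A power_mult_distrib power2_eq_iff abs_if) argo
    then show ?thesis using time_eq_iff[OF b, of t] by (auto simp: y_def)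
  qed
  have "Im (act A (vertical x t)) = 1 / (2 * approx x b)" if "t = time x b"
  proof -
    have xy: "\<bar>x - val b\<bar> = y" using time_eq_iff[OF b, of t] that by (simp add: y_def)
    have "(cmod (of_real (A$2$1) * vertical x t + of_real (A$2$2)))\<^sup>2 = (A$2$1 * x + A$2$2)\<^sup>2 + (A$2$1 * y)\<^sup>2"
      by (simp add: cmod_power2 vertical_def y_def)
    also have "\<dots> = 2 * (snd b)\<^sup>2 * y\<^sup>2"
      unfolding dx using xy by (auto simp: A power_mult_distrib)
    finally have "Im (act A (vertical x t)) = y / (2 * (snd b)\<^sup>2 * y\<^sup>2)"
      using Im_act[OF det_M[OF A(1)] Im_vertical(2), of x t] by (simp add: Im_vertical y_def)
    also have "\<dots> = 1 / (2 * approx x b)"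
      using y q by (simp add: approx_eq[OF b] xy power2_eq_square)
    finally show ?thesis .
  qed
  then show ?thesis unfolding tangent_iff[OF A(1)] y_def[symmetric] sq by auto
qed

lemma tangent_lift:
  assumes "is_lift \<Gamma> (beta \<Gamma> x) \<delta>" "tangent_horoball \<delta> t m"
  shows "\<exists>b\<in>L. \<exists>A\<in>M. A$2$1 = - snd b \<and> A$2$2 = fst b \<and> \<delta> = moved A x"
proof -
  obtain A where A: "A \<in> M" "\<delta> = moved A x" using assms(1) by (auto simp: is_lift_iff)
  have e: "(A$2$1 * x + A$2$2)\<^sup>2 = (A$2$1 * (2 * exp (- t)))\<^sup>2"
    using assms(2) unfolding A(2) tangent_iff[OF A(1)] by simp
  have "A$2$1 \<noteq> 0" using e det_M[OF A(1)] by auto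
  then obtain B where B: "B \<in> M" "B$2$1 < 0" "\<delta> = moved B x"
    using A M_uminus[OF A(1)] by (cases "A$2$1 < 0") (force simp: act_uminus)+
  have "(B$2$2, - B$2$1) \<in> L"
    unfolding L_iff using B by (intro conjI bexI[of _ "inv2 B"] M_inv) auto
  then show ?thesis using B by (intro bexI[of _ "(B$2$2, - B$2$1)"] bexI[of _ B]) auto
qed

lemma excursion_of_depth_iff:
  "excursion_of_depth \<Gamma> (beta \<Gamma> x) t d \<longleftrightarrow> (\<exists>b\<in>L. t = time x b \<and> d = 2 * approx x b \<and> approx x b < 1)"
proof
  assume e: "excursion_of_depth \<Gamma> (beta \<Gamma> x) t d"
  then obtain \<delta> where \<delta>: "is_lift \<Gamma> (beta \<Gamma> x) \<delta>" "tangent_horoball \<delta> t (1 / d)" "0 < d" "d < 2"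
    by (auto simp: excursion_of_depth_def)
  obtain b A where b: "b \<in> L" "A \<in> M" "A$2$1 = - snd b" "A$2$2 = fst b" "\<delta> = moved A x"
    using tangent_lift[OF \<delta>(1,2)] by blast
  have "t = time x b" "1 / d = 1 / (2 * approx x b)"
    using \<delta>(2) unfolding b(5) tangent_uncusp[OF b(2-4,1)] by auto
  then have "t = time x b" "d = 2 * approx x b" by auto
  then show "\<exists>b\<in>L. t = time x b \<and> d = 2 * approx x b \<and> approx x b < 1" using b(1) \<delta> by auto
next
  assume "\<exists>b\<in>L. t = time x b \<and> d = 2 * approx x b \<and> approx x b < 1"
  then obtain b where b: "b \<in> L" "t = time x b" "d = 2 * approx x b" "approx x b < 1" by blast
  have "0 < approx x b" using irr[OF b(1)] den_pos[OF b(1)] by (simp add: approx_eq[OF b(1)])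
  moreover have "tangent_horoball (moved (uncusp b) x) t (1 / d)"
    using tangent_uncusp uncusp[OF b(1)] b by simp
  ultimately show "excursion_of_depth \<Gamma> (beta \<Gamma> x) t d"
    using b uncusp[OF b(1)] unfolding excursion_of_depth_def is_lift_iff by auto
qed

lemma excursion_iff: "excursion \<Gamma> (beta \<Gamma> x) t \<longleftrightarrow> (\<exists>b\<in>L. t = time x b \<and> approx x b < 1)"
  unfolding excursion_def excursion_of_depth_iff by blast

lemma depth_eq:
  assumes "b \<in> L" "approx x b < 1"
  shows "depth \<Gamma> (beta \<Gamma> x) (time x b) = 2 * approx x b"
  unfolding depth_def excursion_of_depth_iff
proof (rule the_equality)
  show "\<exists>a\<in>L. time x b = time x a \<and> 2 * approx x b = 2 * approx x a \<and> approx x a < 1"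
    using assms by blast
  fix d assume "\<exists>a\<in>L. time x b = time x a \<and> d = 2 * approx x a \<and> approx x a < 1"
  then obtain a where a: "a \<in> L" "time x b = time x a" "d = 2 * approx x a" by blast
  then show "d = 2 * approx x b" using time_inj[OF assms(1) a(1,2)] by simp
qed

lemma endpoints:
  assumes A: "A \<in> M" and c: "A$2$1 \<noteq> 0" and d: "A$2$1 * x + A$2$2 \<noteq> 0"
  shows "((moved A x) \<longlongrightarrow> complex_of_real (real_act A x)) at_top"
    "((moved A x) \<longlongrightarrow> complex_of_real (A$1$1 / A$2$1)) at_bot"
proof -
  have nz: "of_real (A$2$1) * of_real x + of_real (A$2$2) \<noteq> (0::complex)"
    using d by (metis of_real_0 of_real_add of_real_eq_iff of_real_mult)
  have "((moved A x) \<longlongrightarrow> act A (of_real x)) at_top"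
    unfolding act_eq by (intro tendsto_intros vertical_forward nz)
  then show "((moved A x) \<longlongrightarrow> complex_of_real (real_act A x)) at_top"
    by (simp add: act_eq real_act_def)
  have e: "act A z = of_real (A$1$1 / A$2$1) - 1 / (of_real (A$2$1) * (of_real (A$2$1) * z + of_real (A$2$2)))"
    if "0 < Im z" for z
  proof -
    define w where "w = of_real (A$2$1) * z + of_real (A$2$2)"
    have w: "w \<noteq> 0" using denom_nz[OF det_M[OF A] that] by (simp add: w_def)
    have cc: "complex_of_real (A$1$1) * of_real (A$2$2) - of_real (A$1$2) * of_real (A$2$1) = 1"
      using det_M[OF A] by (metis of_real_1 of_real_diff of_real_mult)
    have "of_real (A$1$1 / A$2$1) - 1 / (of_real (A$2$1) * w) = (of_real (A$1$1) * w - 1) / (of_real (A$2$1) * w)"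
      using w c by (simp add: diff_divide_distrib)
    also have "of_real (A$1$1) * w - 1 = of_real (A$2$1) * (of_real (A$1$1) * z + of_real (A$1$2))"
      using cc by (simp add: w_def algebra_simps)
    also have "of_real (A$2$1) * (of_real (A$1$1) * z + of_real (A$1$2)) / (of_real (A$2$1) * w) = act A z"
      using c by (simp add: act_eq w_def)
    finally show ?thesis by (simp add: w_def)
  qed
  have "((\<lambda>t. 1 / (of_real (A$2$1) * (of_real (A$2$1) * vertical x t + of_real (A$2$2)))) \<longlongrightarrow> 0) at_bot"
  proof (rule Lim_null_comparison)
    have "norm (1 / (of_real (A$2$1) * (of_real (A$2$1) * vertical x t + of_real (A$2$2)))) \<le> exp t / (2 * (A$2$1)\<^sup>2)" for t
    proof -
      define w where "w = of_real (A$2$1) * vertical x t + of_real (A$2$2)"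
      have "Im w = A$2$1 * (2 * exp (- t))" by (simp add: w_def vertical_def)
      then have "\<bar>A$2$1\<bar> * (2 * exp (- t)) \<le> cmod w" using abs_Im_le_cmod[of w] by (simp add: abs_mult)
      then have "\<bar>A$2$1\<bar> * (\<bar>A$2$1\<bar> * (2 * exp (- t))) \<le> \<bar>A$2$1\<bar> * cmod w" by (rule mult_left_mono) simp
      moreover have "0 < \<bar>A$2$1\<bar> * (\<bar>A$2$1\<bar> * (2 * exp (- t)))" using c by simp
      ultimately have "1 / (\<bar>A$2$1\<bar> * cmod w) \<le> 1 / (\<bar>A$2$1\<bar> * (\<bar>A$2$1\<bar> * (2 * exp (- t))))"
        by (intro frac_le) auto
      also have "\<dots> = exp t / (2 * (A$2$1)\<^sup>2)" by (simp add: exp_minus field_simps power2_eq_square)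
      finally show ?thesis by (simp add: norm_divide norm_mult w_def)
    qed
    then show "\<forall>\<^sub>F t in at_bot. norm (1 / (of_real (A$2$1) * (of_real (A$2$1) * vertical x t + of_real (A$2$2)))) \<le> exp t / (2 * (A$2$1)\<^sup>2)"
      by simp
    show "((\<lambda>t. exp t / (2 * (A$2$1)\<^sup>2)) \<longlongrightarrow> 0) at_bot"
      using tendsto_divide[OF exp_at_bot tendsto_const[of "2 * (A$2$1)\<^sup>2"]] c by simp
  qed
  from tendsto_diff[OF tendsto_const[of "of_real (A$1$1 / A$2$1)"] this]
  show "((moved A x) \<longlongrightarrow> complex_of_real (A$1$1 / A$2$1)) at_bot"
    using e[OF Im_vertical(2)] by simp
qed

lemma endpoints_in_iff:
  assumes A: "A \<in> M" and c: "A$2$1 \<noteq> 0" and d: "A$2$1 * x + A$2$2 \<noteq> 0"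
  shows "endpoints_in (moved A x) E \<longleftrightarrow> (real_act A x, A$1$1 / A$2$1) \<in> E"
proof
  assume "endpoints_in (moved A x) E"
  then obtain u v where uv: "((moved A x) \<longlongrightarrow> complex_of_real u) at_top"
    "((moved A x) \<longlongrightarrow> complex_of_real v) at_bot" "(u, v) \<in> E"
    by (auto simp: endpoints_in_def)
  have "complex_of_real u = complex_of_real (real_act A x)"
    by (rule tendsto_unique[OF _ uv(1) endpoints(1)[OF assms]]) simp
  moreover have "complex_of_real v = complex_of_real (A$1$1 / A$2$1)"
    by (rule tendsto_unique[OF _ uv(2) endpoints(2)[OF assms]]) simp
  ultimately show "(real_act A x, A$1$1 / A$2$1) \<in> E" using uv(3) by (metis of_real_eq_iff)
qed (use endpoints[OF assms] in \<open>unfold endpoints_in_def, blast\<close>)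

text \<open>
  The lifts tangent at the given time differ by integer translations. The endpoints are at
  distance \<open>1/\<theta> > 1\<close>, so exactly one translate has them in \<^const>\<open>J_set\<close>: the forward endpoint
  lies in a unit interval whose side is determined by the orientation, and the backward endpoint is
  then on the other side of \<open>0\<close>. If \<open>1/\<theta> > 2\<close>, it is even beyond \<open>1\<close> or \<open>-1\<close>.
\<close>
lemma excursion_lift_exists:
  assumes b: "b \<in> L" "approx x b < 1"
  shows "\<exists>A\<in>M. A$2$1 = - snd b \<and> A$2$2 = fst b \<and>
    excursion_lift \<Gamma> (beta \<Gamma> x) (time x b) = moved A x \<and>
    (approx x b < 1 / 2 \<longrightarrow> endpoints_in (moved A x) I_set)"
proof -
  define A where "A = uncusp b"
  have A: "A \<in> M" "A$2$1 = - snd b" "A$2$2 = fst b" using uncusp[OF b(1)] by (auto simp: A_def)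
  have q: "0 < snd b" using den_pos[OF b(1)] .
  have nz: "A$2$1 \<noteq> 0" using q A by simp
  have \<Delta>: "A$2$1 * x + A$2$2 = - snd b * (x - val b)"
    using q by (simp add: A val_def field_simps)
  have dnz: "A$2$1 * x + A$2$2 \<noteq> 0" unfolding \<Delta> using q irr[OF b(1)] by simp
  define \<theta> where "\<theta> = approx x b"
  have \<theta>: "0 < \<theta>" "\<theta> < 1" using b q irr[OF b(1)] by (auto simp: \<theta>_def approx_eq[OF b(1)])
  define u v where "u = real_act A x" and "v = A$1$1 / A$2$1"
  have uv: "\<bar>v - u\<bar> = 1 / \<theta>"
  proof -
    have "v - u = (A$1$1 * (A$2$1 * x + A$2$2) - (A$1$1 * x + A$1$2) * A$2$1) / (A$2$1 * (A$2$1 * x + A$2$2))"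
      unfolding u_def v_def real_act_def by (rule diff_frac_eq[OF nz dnz])
    also have "A$1$1 * (A$2$1 * x + A$2$2) - (A$1$1 * x + A$1$2) * A$2$1 = 1"
      using det_M[OF A(1)] by (simp add: algebra_simps)
    finally have "\<bar>v - u\<bar> = 1 / \<bar>A$2$1 * (A$2$1 * x + A$2$2)\<bar>" by simp
    also have "\<bar>A$2$1 * (A$2$1 * x + A$2$2)\<bar> = \<theta>"
      unfolding \<Delta> \<theta>_def approx_eq[OF b(1)] using q by (simp add: A(2) abs_mult power2_eq_square)
    finally show ?thesis .
  qed
  have \<theta>1: "1 < 1 / \<theta>" using \<theta> by (simp add: pos_less_divide_eq)
  have uZ: "u \<notin> \<int>" using x A(1) dnz by (auto simp: generic_def u_def)
  define fl where "fl = \<lfloor>u\<rfloor>"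
  have fl: "of_int fl < u" "u < of_int fl + 1"
  proof -
    have "u \<noteq> of_int fl" using uZ by auto
    then show "of_int fl < u" "u < of_int fl + 1" unfolding fl_def by linarith+
  qed
  define n where "n = (if u < v then - fl - 1 else - fl)"
  have J: "(u + of_int k, v + of_int k) \<in> J_set \<longleftrightarrow> k = n" for k :: int
  proof (cases "u < v")
    case True
    then have v: "v = u + 1 / \<theta>" using uv by simp
    have "(u + of_int k, v + of_int k) \<in> J_set \<longleftrightarrow> -1 < u + of_int k \<and> u + of_int k < 0"
      unfolding J_set_def v using \<theta>1 by auto
    also have "\<dots> \<longleftrightarrow> k = - fl - 1" using fl by linarith
    finally show ?thesis using True by (simp add: n_def)
  next
    case False
    then have v: "v = u - 1 / \<theta>" using uv by simp
    have "(u + of_int k, v + of_int k) \<in> J_set \<longleftrightarrow> 0 < u + of_int k \<and> u + of_int k < 1"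
      unfolding J_set_def v using \<theta>1 by auto
    also have "\<dots> \<longleftrightarrow> k = - fl" using fl by linarith
    finally show ?thesis using False by (simp add: n_def)
  qed
  define B where "B k = transl k ** A" for k
  have B: "B k \<in> M" "B k $2$1 = - snd b" "B k $2$2 = fst b" for k
    using M_mult[OF M_transl A(1)] by (auto simp: B_def A transl_def)
  have Bact: "real_act (B k) x = u + of_int k" "B k $1$1 / B k $2$1 = v + of_int k" for k
    using dnz nz by (auto simp: B_def transl_def real_act_def u_def v_def field_simps)
  have Bend: "endpoints_in (moved (B k) x) E \<longleftrightarrow> (u + of_int k, v + of_int k) \<in> E" for k E
  proof -
    have "B k $2$1 \<noteq> 0" "B k $2$1 * x + B k $2$2 \<noteq> 0" using nz dnz by (simp_all add: B A)
    from endpoints_in_iff[OF B(1) this] show ?thesis unfolding Bact .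
  qed
  have "excursion_lift \<Gamma> (beta \<Gamma> x) (time x b) = moved (B n) x"
    unfolding excursion_lift_def depth_eq[OF b]
  proof (rule the_equality)
    show "is_lift \<Gamma> (beta \<Gamma> x) (moved (B n) x) \<and>
      tangent_horoball (moved (B n) x) (time x b) (1 / (2 * approx x b)) \<and>
      endpoints_in (moved (B n) x) J_set"
      unfolding tangent_uncusp[OF B b(1)] Bend J is_lift_iff using B(1) by blast
    fix \<delta> assume \<delta>: "is_lift \<Gamma> (beta \<Gamma> x) \<delta> \<and> tangent_horoball \<delta> (time x b) (1 / (2 * approx x b)) \<and>
      endpoints_in \<delta> J_set"
    then obtain a C where C: "a \<in> L" "C \<in> M" "C$2$1 = - snd a" "C$2$2 = fst a" "\<delta> = moved C x"
      using tangent_lift by blast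
    have "time x b = time x a" using \<delta> tangent_uncusp[OF C(2-4,1)] C(5) by simp
    then have "b = a" by (rule time_inj[OF b(1) C(1)])
    then obtain k where k: "C = B k"
      using same_bottom_row[OF A(1) C(2)] A C by (auto simp: B_def)
    then have "k = n" using \<delta> unfolding C(5) k Bend J by simp
    then show "\<delta> = moved (B n) x" using C(5) k by simp
  qed
  moreover have "endpoints_in (moved (B n) x) I_set" if "approx x b < 1 / 2"
  proof -
    have 2: "2 < 1 / \<theta>" using that \<theta> by (simp add: \<theta>_def pos_less_divide_eq)
    have "(u + of_int n, v + of_int n) \<in> J_set" unfolding J by simp
    then show ?thesis unfolding Bend using uv 2 by (auto simp: J_set_def I_set_def)
  qed
  ultimately show ?thesis using B by blast
qed

text \<open>
  Comparing real and imaginary parts at the heights \<open>2\<close> and \<open>1\<close> determines all entries.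
\<close>
lemma act_vertical_id:
  assumes C: "C \<in> M" and id: "\<And>s. act C (vertical x s) = vertical x s"
  shows "C = mat 1 \<or> C = - mat 1"
proof -
  have eq: "C$1$1 * x + C$1$2 = C$2$1 * (x\<^sup>2 - y\<^sup>2) + C$2$2 * x \<and> C$1$1 * y = C$2$1 * (2 * x * y) + C$2$2 * y"
    if y: "Complex x y = vertical x s" for y s
  proof -
    have y0: "0 < Im (Complex x y)" using Im_vertical(2)[of x s] y by simp
    define w where "w = of_real (C$2$1) * Complex x y + of_real (C$2$2)"
    have w: "w \<noteq> 0" using denom_nz[OF det_M[OF C] y0] by (simp add: w_def)
    have "(of_real (C$1$1) * Complex x y + of_real (C$1$2)) / w = Complex x y"
      using id[of s] unfolding y[symmetric] act_eq w_def .
    then have e: "of_real (C$1$1) * Complex x y + of_real (C$1$2) = Complex x y * w"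
      using w by (simp add: divide_eq_eq)
    from arg_cong[OF e, of Re] arg_cong[OF e, of Im] show ?thesis
      by (simp add: w_def power2_eq_square algebra_simps)
  qed
  have e2: "Complex x 2 = vertical x 0" by (simp add: vertical_def)
  have e1: "Complex x 1 = vertical x (ln 2)" by (simp add: vertical_def exp_minus)
  have "C$2$1 = 0" using eq[OF e2] eq[OF e1] by (simp add: algebra_simps)
  then have "C$1$1 = C$2$2" "C$1$2 = 0" using eq[OF e1] by auto
  moreover from this \<open>C$2$1 = 0\<close> have "C$1$1 * C$1$1 = 1" using det_M[OF C] by simp
  then have "C$1$1 = 1 \<or> C$1$1 = -1" by (simp add: square_eq_1_iff)
  ultimately show ?thesis using \<open>C$2$1 = 0\<close> by (auto intro!: mat2_eqI)
qed

lemma fraction_val: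
  assumes b: "b \<in> L"
  shows "fraction \<Gamma> (Some (val b)) = b"
  unfolding fraction_def
proof (rule the_equality)
  obtain A where "A \<in> M" "A$1$1 = fst b" "A$2$1 = snd b" "0 < snd b" using b by (auto simp: L_iff)
  then show "case b of (p, q) \<Rightarrow> \<exists>A\<in>\<Union> \<Gamma>. act_inf A = Some (val b) \<and> A $ 1 $ 1 = p \<and> A $ 2 $ 1 = q \<and> 0 < q"
    by (auto simp: split_def M_def[symmetric] act_inf_def val_def intro!: bexI[of _ A])
  fix a :: "real \<times> real"
  assume "case a of (p, q) \<Rightarrow> \<exists>A\<in>\<Union> \<Gamma>. act_inf A = Some (val b) \<and> A $ 1 $ 1 = p \<and> A $ 2 $ 1 = q \<and> 0 < q"
  then obtain A where A: "A \<in> M" "act_inf A = Some (val b)" "A$1$1 = fst a" "A$2$1 = snd a" "0 < snd a"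
    by (auto simp: split_def M_def[symmetric])
  then have aL: "a \<in> L" unfolding L_iff by blast
  have "val a = val b" using A by (auto simp: act_inf_def val_def)
  show "a = b"
  proof (rule ccontr)
    assume "a \<noteq> b"
    then have "1 / (snd a * snd b) \<le> 0" using separation[OF aL b] \<open>val a = val b\<close> by simp
    moreover have "0 < 1 / (snd a * snd b)" using den_pos[OF b] A(5) by simp
    ultimately show False by linarith
  qed
qed

text \<open>
  The inverse of the matrix defining the excursion lift moves it back to the vertical geodesic, and
  sends infinity to the fraction.
\<close>
lemma fraction_cusp_point:
  assumes b: "b \<in> L" "approx x b < 1"
  shows "fraction \<Gamma> (cusp_point \<Gamma> (vertical x) (time x b)) = b"
proof -
  obtain A where A: "A \<in> M" "A$2$1 = - snd b" "A$2$2 = fst b"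
    and lift: "excursion_lift \<Gamma> (beta \<Gamma> x) (time x b) = moved A x"
    using excursion_lift_exists[OF b] by blast
  have beta: "(\<lambda>r. proj \<Gamma> (vertical x r)) = beta \<Gamma> x" by (simp add: beta_def fun_eq_iff)
  have inf: "act_inf (inv2 A) = Some (val b)"
    using den_pos[OF b(1)] by (simp add: act_inf_def A val_def)
  have "cusp_point \<Gamma> (vertical x) (time x b) = Some (val b)"
    unfolding cusp_point_def beta lift
  proof (rule the_equality)
    show "\<exists>B\<in>\<Union> \<Gamma>. (\<forall>s. act B (act A (vertical x s)) = vertical x s) \<and> Some (val b) = act_inf B"
      using M_inv[OF A(1)] inf act_inv2(1)[OF det_M[OF A(1)] Im_vertical(2)]
      by (intro bexI[of _ "inv2 A"]) (auto simp: M_def[symmetric])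
    fix c assume "\<exists>B\<in>\<Union> \<Gamma>. (\<forall>s. act B (act A (vertical x s)) = vertical x s) \<and> c = act_inf B"
    then obtain B where B: "B \<in> M" "\<And>s. act B (act A (vertical x s)) = vertical x s" "c = act_inf B"
      by (auto simp: M_def[symmetric])
    have "act (B ** A) (vertical x s) = vertical x s" for s
      using act_mult[OF det_M[OF A(1)] Im_vertical(2)] B(2) by simp
    then have "B ** A = mat 1 \<or> B ** A = - mat 1"
      by (rule act_vertical_id[OF M_mult[OF B(1) A(1)]])
    moreover have "B = (B ** A) ** inv2 A"
      using A(1) by (simp add: matrix_mul_assoc[symmetric] inv2_mult M_iff)
    ultimately have "B = inv2 A \<or> B = - inv2 A"
      by (metis matrix_mul_lid minus_mult_mat(1))
    then show "c = Some (val b)" using B(3) inf by (auto simp: act_inf_def)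
  qed
  then show ?thesis using fraction_val[OF b(1)] by simp
qed

lemma time_nonneg: "b \<in> L \<Longrightarrow> approx x b < 1 \<Longrightarrow> 0 \<le> time x b"
proof -
  assume b: "b \<in> L" "approx x b < 1"
  have "1 \<le> (snd b)\<^sup>2" using den_ge_1[OF b(1)] by (simp add: one_le_power)
  then have "1 * \<bar>x - val b\<bar> \<le> (snd b)\<^sup>2 * \<bar>x - val b\<bar>" by (rule mult_right_mono) simp
  then have "\<bar>x - val b\<bar> < 1" using b by (simp add: approx_eq)
  moreover have "0 < \<bar>x - val b\<bar>" using irr[OF b(1)] by simp
  ultimately show ?thesis by (simp add: time_def pos_le_divide_eq)
qed

lemma excursion_times_eq: "excursion_times \<Gamma> x = time x ` {b \<in> L. approx x b < 1}"
  unfolding excursion_times_def excursion_iff using time_nonneg by auto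

lemma approximating_times_eq:
  obtains P where "approximating_times \<Gamma> x = time x ` P" "P \<subseteq> L"
    "\<And>b. b \<in> L \<Longrightarrow> approx x b < 1 / 2 \<Longrightarrow> b \<in> P" "\<And>b. b \<in> P \<Longrightarrow> approx x b < 1"
proof -
  define P where "P = {b \<in> L. approx x b < 1 \<and> approximating \<Gamma> (beta \<Gamma> x) (time x b)}"
  have 1: "approximating_times \<Gamma> x = time x ` P"
    using time_nonneg by (auto simp: approximating_times_def P_def approximating_def excursion_iff)
  have 2: "b \<in> P" if b: "b \<in> L" "approx x b < 1 / 2" for b
  proof -
    have b1: "approx x b < 1" using b by simp
    obtain A where "excursion_lift \<Gamma> (beta \<Gamma> x) (time x b) = moved A x"
      "endpoints_in (moved A x) I_set"
      using excursion_lift_exists[OF b(1) b1] b(2) by blast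
    then show ?thesis using b b1 by (auto simp: P_def approximating_def excursion_iff)
  qed
  show ?thesis
    by (rule that[OF 1 _ 2]) (simp_all add: P_def subset_eq)
qed

lemma limsup_theta:
  assumes well_approx: "well_approx x" and fs: "finite_small x"
  shows "log_rate (\<lambda>n. theta \<Gamma> n x) = 1"
    "log_rate (\<lambda>n. theta_a \<Gamma> n x) = 1"
proof -
  define f where "f t = fraction \<Gamma> (cusp_point \<Gamma> (vertical x) t)" for t
  have key: "limsup (\<lambda>n. ereal (- (ln (approx x (f (nth_elem (time x ` P) n))) / ln (real n)))) = 1"
    if P: "P \<subseteq> L" "\<And>b. b \<in> L \<Longrightarrow> approx x b < 1 / 2 \<Longrightarrow> b \<in> P" "\<And>b. b \<in> P \<Longrightarrow> approx x b < 1" for P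
  proof (rule limsup_eq_1[OF irr P _ well_approx fs])
    show "inj_on (\<lambda>b. \<bar>x - val b\<bar>) P"
      using x P(1) unfolding generic_def by (blast intro: inj_on_subset)
    show "f (time x b) = b" if "b \<in> P" for b
      unfolding f_def using fraction_cusp_point P that by blast
  qed
  have theta: "theta \<Gamma> n x = approx x (f (nth_elem (excursion_times \<Gamma> x) n))" for n
    by (simp add: theta_def n_convergent_def f_def approx_def split_def)
  have theta_a: "theta_a \<Gamma> n x = approx x (f (nth_elem (approximating_times \<Gamma> x) n))" for n
    by (simp add: theta_a_def convergent_a_def f_def approx_def split_def)
  show "log_rate (\<lambda>n. theta \<Gamma> n x) = 1"
    unfolding theta excursion_times_eq by (rule key) auto
  obtain P where P: "approximating_times \<Gamma> x = time x ` P" "P \<subseteq> L"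
    "\<And>b. b \<in> L \<Longrightarrow> approx x b < 1 / 2 \<Longrightarrow> b \<in> P" "\<And>b. b \<in> P \<Longrightarrow> approx x b < 1"
    using approximating_times_eq by blast
  show "log_rate (\<lambda>n. theta_a \<Gamma> n x) = 1"
    unfolding theta_a P(1) by (rule key[OF P(2-4)])
qed

end

lemma AE_limsup_theta:
  "AE x in lebesgue_on {0<..<1}.
    log_rate (\<lambda>n. theta \<Gamma> n x) = 1 \<and>
    log_rate (\<lambda>n. theta_a \<Gamma> n x) = 1"
proof -
  have "AE x in lborel. 0 < x \<and> x < 1 \<longrightarrow>
    log_rate (\<lambda>n. theta \<Gamma> n x) = 1 \<and>
    log_rate (\<lambda>n. theta_a \<Gamma> n x) = 1"
    using AE_generic AE_well_approx AE_finite_small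
    by eventually_elim (auto intro: limsup_theta)
  then have ae: "AE x in lebesgue. 0 < x \<and> x < 1 \<longrightarrow>
    log_rate (\<lambda>n. theta \<Gamma> n x) = 1 \<and>
    log_rate (\<lambda>n. theta_a \<Gamma> n x) = 1"
    by (rule AE_completion)
  show ?thesis
  proof (subst AE_restrict_space_iff)
    show "AE x in lebesgue. x \<in> {0<..<1} \<longrightarrow>
      log_rate (\<lambda>n. theta \<Gamma> n x) = 1 \<and>
      log_rate (\<lambda>n. theta_a \<Gamma> n x) = 1"
      using ae by eventually_elim simp
  qed simp
qed

end

theorem theorem3:
  fixes \<Gamma> :: "(real^2^2) set set"
  assumes "zonal_fuchsian \<Gamma>" and "normalized_zonal \<Gamma>"
  shows
    "(AE x in lebesgue_on {0<..<1}.
        limsup (\<lambda>n. ereal (- (ln (theta_a \<Gamma> n x) / ln (real n)))) = 1) \<and>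
     (\<Gamma> = PSL2Z \<or> U_eta \<Gamma> \<notin> \<Gamma> \<longrightarrow>
      (AE x in lebesgue_on {0<..<1}.
        limsup (\<lambda>n. ereal (- (ln (theta \<Gamma> n x) / ln (real n)))) = 1))"
proof -
  interpret zonal \<Gamma> by unfold_locales (rule assms(1))
  have "AE x in lebesgue_on {0<..<1}. limsup (\<lambda>n. ereal (- (ln (theta_a \<Gamma> n x) / ln (real n)))) = 1"
    using AE_limsup_theta by eventually_elim simp
  moreover have "AE x in lebesgue_on {0<..<1}. limsup (\<lambda>n. ereal (- (ln (theta \<Gamma> n x) / ln (real n)))) = 1"
    using AE_limsup_theta by eventually_elim simp
  ultimately show ?thesis by blast
qed

end
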